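(* Let $p\in[1,\infty)\setminus\{2\}$, let $\mathcal T$ be a homogeneous tree of degree $q\ge 2$ with reference point $o$, and let $k$ be a radial function on $\mathcal T$. The following are equivalent: (i) $k$ is in $Cv_p(\mathcal T)$; (ii) the spherical Fourier transform $\widetilde k$ is a holomorphic Weyl-invariant function on the strip $\mathbf S_{\delta(p)}$, and its boundary value $\widetilde k_{\delta(p)}$ is in $\mathcal M_p(\mathbb T)$. Furthermore, there exist positive constants $c$ and $C$, independent of $k$, such that $$ c\,\|\widetilde k_{\delta(p)}\|_{\mathcal M_p(\mathbb T)}\le \|k\|_{Cv_p(\mathcal T)}\le C\,\|\widetilde k_{\delta(p)}\|_{\mathcal M_p(\mathbb T)} . $$
   Context: **Tree.** A homogeneous tree $\mathcal T$ of degree $q$ ($q\ge 2$ an integer) is a connected graph with no loops (i.e. no cycles) in which every vertex has exactly $q+1$ neighbours. It is endowed with the counting measure and the natural graph distance $d$. Fix a vertex $o$ and write $|x|=d(x,o)$. A function $f$ on $\mathcal T$ is radial if $f(x)$ depends only on $|x|$. **The space $Cv_p(\mathcal T)$.** A radial function $k$, say $k(x)=K(|x|)$, defines the operator (invariant under all isometries of $\mathcal T$) $$ (f*k)(x)=\sum_{y\in\mathcal T}f(y)\,K(d(x,y)), $$ initially on finitely supported $f$. (Equivalently, this is right convolution by the corresponding $G_o$-bi-invariant function on $G$, where $G$ is the isometry group of $\mathcal T$ and $G_o$ is the stabiliser of $o$.) $Cv_p(\mathcal T)$ is the space of radial functions $k$ for which this operator is bounded on $L^p(\mathcal T)$, and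 $\|k\|_{Cv_p(\mathcal T)}$ is its operator norm on $L^p(\mathcal T)$. **Multipliers on the torus.** Set $\tau=2\pi/\log q$ and $\mathbb T=\mathbb R/\tau\mathbb Z$. For $F$ on $\mathbb Z$ put $\mathcal F F(s)=\sum_{d\in\mathbb Z}F(d)q^{-ids}$, with inversion $F(d)=\frac1\tau\int_{\mathbb T}\mathcal F F(s)q^{ids}\,ds$. $Cv_p(\mathbb Z)$ is the space of functions on $\mathbb Z$ whose convolution operator is bounded on $L^p(\mathbb Z)=\ell^p(\mathbb Z)$, with the operator norm. A distribution $m$ on $\mathbb T$ is in $\mathcal M_p(\mathbb T)$ if $\mathcal F^{-1}m\in Cv_p(\mathbb Z)$, and $\|m\|_{\mathcal M_p(\mathbb T)}=\|\mathcal F^{-1}m\|_{Cv_p(\mathbb Z)}$. (Every element of $\mathcal M_p(\mathbb T)$ is a bounded function.) **Strips.** $\delta(p)=|1/p-1/2|$. For $t>0$, $\mathbf S_t=\{z\in\mathbb C:|\mathrm{Im}\,z|<t\}$. For $f$ holomorphic on $\mathbf S_t$ and $v\in(-t,t)$, $f_v(u)=f(u+iv)$ for $u\in\mathbb R$. $f_t$ and $f_{-t}$ denote the boundary values of $f$ on $\mathrm{Im}\,z=t$ and $\mathrm{Im}\,z=-t$, when they exist in the sense of distributions. A holomorphic function on $\mathbf S_{\delta(p)}$ is Weyl-invariant if it is even and $\tau$-periodic there (so its boundary value is viewed as a distribution on $\mathbb T$). **Spherical Fourier transform.** Let $$ \mathbf c(z)=\frac{q^{1/2}}{q+1}\,\frac{q^{1/2+iz}-q^{-1/2-iz}}{q^{iz}-q^{-iz}},\qquad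 z\in\mathbb C\setminus(\tau/2)\mathbb Z . $$ The spherical functions are $\phi_z(x)=\mathbf c(z)q^{(iz-1/2)|x|}+\mathbf c(-z)q^{(-iz-1/2)|x|}$ for $z\notin(\tau/2)\mathbb Z$, extended to entire functions of $z$ by - $\phi_z(x)=\bigl(1+\frac{q-1}{q+1}|x|\bigr)q^{-|x|/2}$ for $z\in\tau\mathbb Z$, - $\phi_z(x)=\bigl(1+\frac{q-1}{q+1}|x|\bigr)q^{-|x|/2}(-1)^{|x|}$ for $z\in\tau/2+\tau\mathbb Z$. For radial $f\in L^1(\mathcal T)$ the spherical Fourier transform is $\widetilde f(z)=\sum_{x\in\mathcal T}f(x)\phi_z(x)$ for $z\in\overline{\mathbf S}_{1/2}$. With $c_G=\frac{q\log q}{4\pi(q+1)}$, the inversion formula is $$ f(x)=2c_G\,q^{-|x|/2}\int_{\mathbb T}\widetilde f(s)\,\mathbf c(-s)^{-1}q^{is|x|}\,ds . $$ For a general radial function $k$, the assertion in (ii) that $\widetilde k$ is a holomorphic Weyl-invariant function on $\mathbf S_{\delta(p)}$ means that there is a holomorphic Weyl-invariant function on $\mathbf S_{\delta(p)}$, denoted $\widetilde k$, for which this inversion formula holds with $f=k$. If $k\in Cv_p(\mathcal T)$, the series $\sum_x k(x)\phi_z(x)$ converges absolutely for $z\in\mathbf S_{\delta(p)}$ and gives this function. The constants $c,C$ may depend on $p$ and $q$. *)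

theory Defs
  imports "HOL-Analysis.Analysis"
begin

section \<open>Homogeneous trees\<close>

text \<open>The vertex set is the whole type; a graph is given by its adjacency relation.\<close>

definition graph_cycle :: "('v \<Rightarrow> 'v \<Rightarrow> bool) \<Rightarrow> 'v list \<Rightarrow> bool" where
  "graph_cycle adj xs \<longleftrightarrow> 3 \<le> length xs \<and> distinct xs \<and>
     (\<forall>i<length xs. adj (xs ! i) (xs ! ((i + 1) mod length xs)))"

definition homogeneous_tree :: "nat \<Rightarrow> ('v \<Rightarrow> 'v \<Rightarrow> bool) \<Rightarrow> bool" where
  "homogeneous_tree q adj \<longleftrightarrow>
     (\<forall>x y. adj x y \<longrightarrow> adj y x) \<and> (\<forall>x. \<not> adj x x) \<and>
     (\<forall>x y. adj\<^sup>*\<^sup>* x y) \<and> (\<nexists>xs. graph_cycle adj xs) \<and>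
     (\<forall>x. card {y. adj x y} = q + 1)"

definition gdist :: "('v \<Rightarrow> 'v \<Rightarrow> bool) \<Rightarrow> 'v \<Rightarrow> 'v \<Rightarrow> nat" where
  "gdist adj x y = (LEAST n. (adj ^^ n) x y)"

definition radial :: "('v \<Rightarrow> 'v \<Rightarrow> bool) \<Rightarrow> 'v \<Rightarrow> ('v \<Rightarrow> complex) \<Rightarrow> bool" where
  "radial adj x0 k \<longleftrightarrow> (\<exists>K. \<forall>x. k x = K (gdist adj x x0))"

text \<open>On a homogeneous tree with \<open>q \<ge> 1\<close> every sphere around \<open>x0\<close> is nonempty, so a radial
  function determines its profile \<open>K\<close> completely.\<close>

definition radial_profile :: "('v \<Rightarrow> 'v \<Rightarrow> bool) \<Rightarrow> 'v \<Rightarrow> ('v \<Rightarrow> complex) \<Rightarrow> nat \<Rightarrow> complex" where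
  "radial_profile adj x0 k = (THE K. \<forall>x. k x = K (gdist adj x x0))"


section \<open>Operators bounded on \<open>\<ell>\<^sup>p\<close>\<close>

definition in_lp :: "real \<Rightarrow> ('a \<Rightarrow> complex) \<Rightarrow> bool" where
  "in_lp p f \<longleftrightarrow> (\<lambda>x. norm (f x) powr p) summable_on UNIV"

definition lp_norm :: "real \<Rightarrow> ('a \<Rightarrow> complex) \<Rightarrow> real" where
  "lp_norm p f = (\<Sum>\<^sub>\<infinity>x. norm (f x) powr p) powr (1 / p)"

definition lp_bound :: "real \<Rightarrow> (('a \<Rightarrow> complex) \<Rightarrow> ('a \<Rightarrow> complex)) \<Rightarrow> real \<Rightarrow> bool" where
  "lp_bound p A B \<longleftrightarrow> 0 \<le> B \<and>
     (\<forall>f. finite {x. f x \<noteq> 0} \<longrightarrow> in_lp p (A f) \<and> lp_norm p (A f) \<le> B * lp_norm p f)"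

text \<open>Operators are given on finitely supported functions. These are dense in \<open>\<ell>\<^sup>p\<close> for
  \<open>p < \<infinity>\<close>, so the least bound on them is the operator norm of the extension to \<open>\<ell>\<^sup>p\<close>.\<close>

definition lp_bounded :: "real \<Rightarrow> (('a \<Rightarrow> complex) \<Rightarrow> ('a \<Rightarrow> complex)) \<Rightarrow> bool" where
  "lp_bounded p A \<longleftrightarrow> (\<exists>B. lp_bound p A B)"

definition lp_opnorm :: "real \<Rightarrow> (('a \<Rightarrow> complex) \<Rightarrow> ('a \<Rightarrow> complex)) \<Rightarrow> real" where
  "lp_opnorm p A = Inf {B. lp_bound p A B}"

definition tree_conv ::
  "('v \<Rightarrow> 'v \<Rightarrow> bool) \<Rightarrow> 'v \<Rightarrow> ('v \<Rightarrow> complex) \<Rightarrow> ('v \<Rightarrow> complex) \<Rightarrow> ('v \<Rightarrow> complex)" where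
  "tree_conv adj x0 k f = (\<lambda>x. \<Sum>y | f y \<noteq> 0. f y * radial_profile adj x0 k (gdist adj x y))"

definition Cv_tree :: "real \<Rightarrow> ('v \<Rightarrow> 'v \<Rightarrow> bool) \<Rightarrow> 'v \<Rightarrow> ('v \<Rightarrow> complex) set" where
  "Cv_tree p adj x0 = {k. radial adj x0 k \<and> lp_bounded p (tree_conv adj x0 k)}"

definition Cv_tree_norm ::
  "real \<Rightarrow> ('v \<Rightarrow> 'v \<Rightarrow> bool) \<Rightarrow> 'v \<Rightarrow> ('v \<Rightarrow> complex) \<Rightarrow> real" where
  "Cv_tree_norm p adj x0 k = lp_opnorm p (tree_conv adj x0 k)"

definition int_conv :: "(int \<Rightarrow> complex) \<Rightarrow> (int \<Rightarrow> complex) \<Rightarrow> (int \<Rightarrow> complex)" where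
  "int_conv F f = (\<lambda>n. \<Sum>m | f m \<noteq> 0. f m * F (n - m))"

definition Cv_int :: "real \<Rightarrow> (int \<Rightarrow> complex) set" where
  "Cv_int p = {F. lp_bounded p (int_conv F)}"

definition Cv_int_norm :: "real \<Rightarrow> (int \<Rightarrow> complex) \<Rightarrow> real" where
  "Cv_int_norm p F = lp_opnorm p (int_conv F)"


section \<open>Distributions and multipliers on the torus\<close>

definition tau :: "nat \<Rightarrow> real" where
  "tau q = 2 * pi / ln (real q)"

definition nth_vderiv :: "nat \<Rightarrow> (real \<Rightarrow> complex) \<Rightarrow> (real \<Rightarrow> complex)" where
  "nth_vderiv n = ((\<lambda>g x. vector_derivative g (at x)) ^^ n)"

text \<open>Functions on the torus \<open>\<real> / \<tau>\<int>\<close> are \<open>\<tau>\<close>-periodic functions on \<open>\<real>\<close>; the test functions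
  are the smooth ones.\<close>

definition test_functions :: "nat \<Rightarrow> (real \<Rightarrow> complex) set" where
  "test_functions q = {\<phi>. (\<forall>n x. nth_vderiv n \<phi> differentiable (at x)) \<and>
                           (\<forall>x. \<phi> (x + tau q) = \<phi> x)}"

text \<open>Only the values of \<open>m\<close> on \<open>test_functions q\<close> are meaningful.\<close>

definition torus_distribution :: "nat \<Rightarrow> ((real \<Rightarrow> complex) \<Rightarrow> complex) \<Rightarrow> bool" where
  "torus_distribution q m \<longleftrightarrow>
     (\<forall>\<phi>\<in>test_functions q. \<forall>\<psi>\<in>test_functions q. m (\<lambda>u. \<phi> u + \<psi> u) = m \<phi> + m \<psi>) \<and>
     (\<forall>a. \<forall>\<phi>\<in>test_functions q. m (\<lambda>u. a * \<phi> u) = a * m \<phi>) \<and>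
     (\<exists>N C. \<forall>\<phi>\<in>test_functions q. norm (m \<phi>) \<le> C * (\<Sum>j\<le>N. SUP u. norm (nth_vderiv j \<phi> u)))"

text \<open>A function \<open>h\<close> on the torus acts as \<open>\<phi> \<mapsto> \<integral>\<^sub>\<bbbT> h \<phi>\<close>, whence the following
  inverse Fourier transform of a distribution.\<close>

definition inv_fourier :: "nat \<Rightarrow> ((real \<Rightarrow> complex) \<Rightarrow> complex) \<Rightarrow> int \<Rightarrow> complex" where
  "inv_fourier q m d =
     complex_of_real (1 / tau q) * m (\<lambda>s. of_nat q powr (\<i> * of_int d * of_real s))"

definition M_torus :: "real \<Rightarrow> nat \<Rightarrow> ((real \<Rightarrow> complex) \<Rightarrow> complex) set" where
  "M_torus p q = {m. torus_distribution q m \<and> inv_fourier q m \<in> Cv_int p}"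

definition M_torus_norm :: "real \<Rightarrow> nat \<Rightarrow> ((real \<Rightarrow> complex) \<Rightarrow> complex) \<Rightarrow> real" where
  "M_torus_norm p q m = Cv_int_norm p (inv_fourier q m)"


section \<open>Strips, boundary values and the spherical Fourier transform\<close>

definition delta :: "real \<Rightarrow> real" where
  "delta p = \<bar>1 / p - 1 / 2\<bar>"

definition strip :: "real \<Rightarrow> complex set" where
  "strip t = {z. \<bar>Im z\<bar> < t}"

definition weyl_invariant_on_strip :: "nat \<Rightarrow> real \<Rightarrow> (complex \<Rightarrow> complex) \<Rightarrow> bool" where
  "weyl_invariant_on_strip q t f \<longleftrightarrow>
     (\<forall>z\<in>strip t. f (- z) = f z \<and> f (z + of_real (tau q)) = f z)"

text \<open>\<open>m\<close> is the limit, in the sense of distributions on the torus, of \<open>u \<mapsto> f (u + \<i>v)\<close> as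
  \<open>v\<close> tends to \<open>t\<close> from below.\<close>

definition has_boundary_value ::
  "nat \<Rightarrow> real \<Rightarrow> (complex \<Rightarrow> complex) \<Rightarrow> ((real \<Rightarrow> complex) \<Rightarrow> complex) \<Rightarrow> bool" where
  "has_boundary_value q t f m \<longleftrightarrow> torus_distribution q m \<and>
     (\<forall>\<phi>\<in>test_functions q.
        ((\<lambda>v. integral {0..tau q} (\<lambda>u. f (Complex u v) * \<phi> u)) \<longlongrightarrow> m \<phi>) (at_left t))"

definition c_fun :: "nat \<Rightarrow> complex \<Rightarrow> complex" where
  "c_fun q z = of_real (sqrt (real q) / (real q + 1)) *
     ((of_nat q powr (1 / 2 + \<i> * z) - of_nat q powr (- 1 / 2 - \<i> * z)) /
      (of_nat q powr (\<i> * z) - of_nat q powr (- \<i> * z)))"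

definition c_G :: "nat \<Rightarrow> real" where
  "c_G q = real q * ln (real q) / (4 * pi * (real q + 1))"

text \<open>\<open>g\<close> is the spherical Fourier transform of the radial function \<open>k\<close> on the strip of
  half-width \<open>t\<close>: it is holomorphic and Weyl-invariant there and \<open>k\<close> is recovered from it by the
  inversion formula. At the points of \<open>(\<tau>/2)\<int>\<close>, where \<open>c_fun\<close> has its poles, \<open>inverse (c_fun q _)\<close>
  takes the value 0, which is the limit.\<close>

definition is_spherical_transform ::
  "nat \<Rightarrow> ('v \<Rightarrow> 'v \<Rightarrow> bool) \<Rightarrow> 'v \<Rightarrow> real \<Rightarrow> ('v \<Rightarrow> complex) \<Rightarrow> (complex \<Rightarrow> complex) \<Rightarrow> bool" where
  "is_spherical_transform q adj x0 t k g \<longleftrightarrow>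
     g holomorphic_on strip t \<and> weyl_invariant_on_strip q t g \<and>
     (\<forall>x. k x = of_real (2 * c_G q * real q powr (- real (gdist adj x x0) / 2)) *
        integral {0..tau q} (\<lambda>s. g (of_real s) * inverse (c_fun q (- of_real s)) *
          of_nat q powr (\<i> * of_real s * of_nat (gdist adj x x0))))"

end

theory Submission
  imports Defs "HOL-Complex_Analysis.Complex_Analysis"
begin

text \<open>Write \<open>K\<close> for the profile of \<open>k\<close>, so that the operator on the tree has the kernel \<open>K (d x y)\<close>, and
put \<open>t = delta p > 0\<close>. Both sides of the theorem are statements about one null sequence \<open>b\<close>.

A function \<open>g\<close> on the strip that is even and periodic is determined by its Fourier coefficients \<open>G d\<close>
on the real axis, and \<open>G\<close> is even. Moving the contour up to height \<open>t\<close> multiplies the coefficient of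
index \<open>d\<close> by \<open>q powr (t * d)\<close>. Hence the boundary value of \<open>g\<close> is a multiplier exactly when the
sequence \<open>F d = q powr (t * d) * G \<bar>d\<bar>\<close> convolves the \<open>p\<close>-summable sequences on the integers into
themselves. In the inversion formula \<open>1 / c\<close> is a quotient of two geometric factors. Dividing \<open>g\<close> by
the denominator only gives a function whose coefficients \<open>b n\<close> tend to \<open>0\<close> and satisfy
\<open>q powr (n / 2) * K n = b n - b (n + 2)\<close> and \<open>G n = b n - b (n + 2) / q\<close>
(\<open>inversion_integral\<close>, \<open>fourier_coeff_tail\<close>, \<open>tail_coeff_tendsto_0\<close>). Each of \<open>K\<close> and \<open>G\<close>
determines \<open>b\<close>: this is the Abel transform and its inverse. Conversely, a sequence \<open>G\<close> with
\<open>G n = O (q powr (- t * n))\<close> is the coefficient sequence of a cosine series, which has a boundary value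
because the Fourier coefficients of a test function are summable (\<open>exists_boundary_function\<close>).

What remains is to compare the norm of the kernel \<open>K (d x y)\<close> on the tree with that of \<open>F (n - m)\<close> on
the integers. Transposition does not change the first and reflects the second, so duality
allows the exponent to be replaced by its conjugate, and \<open>p < 2\<close> may be assumed.

From the tree to the integers (\<open>abel_transform_bound\<close>): the kernel is tested on functions
\<open>q powr (- \<bar>y\<bar> / p) * \<phi> (\<bar>y\<bar> - M)\<close> of the distance \<open>\<bar>y\<bar>\<close> to the root. A sphere of radius \<open>r \<ge> 1\<close> has
\<open>(1 + 1 / q) * q ^ r\<close> points, so the norm of this function is that of \<open>\<phi>\<close> up to a fixed factor, and as
\<open>M\<close> grows its image becomes, in the same sense, the convolution of \<open>F\<close> and \<open>\<phi>\<close>. The norm of \<open>F\<close> is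
therefore at most that of \<open>K\<close>.

From the integers to the tree (\<open>inverse_abel_transform_bound\<close>): a path from \<open>x\<close> to \<open>y\<close> climbs \<open>j\<close> steps
towards the root and descends \<open>i\<close> steps, and \<open>radial_kernel_confluent\<close> decomposes \<open>K (d x y)\<close> accordingly.
For fixed \<open>i\<close> the climbing part is a one-sided convolution along the rays that end at the root;
averaging over the rays bounds it by a one-sided convolution on the integers (\<open>ray_kernel_bound\<close>),
whose kernel is the restriction to \<open>j \<ge> 0\<close> of a series of translates of \<open>F\<close>. Such a restriction can destroy
boundedness. Here it does not: as \<open>G\<close> is even, \<open>F (- d) = q powr (- 2 * t * d) * F d\<close>, so the part that
is cut off is summable, with sum at most a constant times \<open>q powr (t * i)\<close>. The descending part has norm
at most \<open>2 * q powr (i * (1 - 1 / p))\<close>. Altogether the \<open>i\<close>-th term is \<open>O (q powr (- t * i))\<close>, and the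
series converges because \<open>t > 0\<close>; this is where \<open>p \<noteq> 2\<close> enters.\<close>

section \<open>Kernel operators on sequence spaces\<close>

lemma convex_on_powr_nonneg:
  fixes p :: real
  assumes "1 \<le> p"
  shows "convex_on {0..} (\<lambda>x. x powr p)"
proof (rule convex_onI)
  fix t x y :: real
  assume t: "0 < t" "t < 1" and xy: "x \<in> {0..}" "y \<in> {0..}"
  have small: "s powr p \<le> s" if "0 < s" "s < 1" for s :: real
    using powr_mono'[of 1 p s] assms that by simp
  show "((1 - t) *\<^sub>R x + t *\<^sub>R y) powr p \<le> (1 - t) * x powr p + t * y powr p"
  proof (cases "x = 0 \<or> y = 0")
    case True
    then show ?thesis
      using t xy small[of t] small[of "1 - t"] assms
      by (auto simp: powr_mult intro!: mult_right_mono)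
  next
    case False
    then show ?thesis
      using convex_onD[OF powr_convex[OF assms], of t x y] t xy by simp
  qed
qed simp

lemma powr_le_cancel:
  fixes x y p :: real
  assumes "0 < p" "0 \<le> x" "0 \<le> y" "x powr p \<le> y powr p"
  shows "x \<le> y"
  using assms powr_less_mono2[of p y x] by fastforce

text \<open>The degenerate case of the inequalities below, in which the normalisation by the norm is impossible.\<close>

lemma sum_powr_le_zero_imp_zero:
  fixes w :: "'a \<Rightarrow> real"
  assumes "finite S" "(\<Sum>x\<in>S. w x powr p) \<le> 0 powr p"
  shows "\<forall>x\<in>S. w x = 0"
proof -
  have "(\<Sum>x\<in>S. w x powr p) \<le> 0" using assms(2) by simp
  then have "(\<Sum>x\<in>S. w x powr p) = 0"
    by (intro antisym sum_nonneg) auto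
  then show ?thesis
    using assms(1) by (subst (asm) sum_nonneg_eq_0_iff) auto
qed

text \<open>After both factors are normalised this is Young's inequality, applied to every term.\<close>

lemma holder_sum:
  fixes u v :: "'a \<Rightarrow> real"
  assumes p: "1 < p" "1 < p'" "1 / p + 1 / p' = 1" and S: "finite S" and nn: "0 \<le> a" "0 \<le> b"
    and u: "\<And>x. 0 \<le> u x" and v: "\<And>x. 0 \<le> v x"
    and ua: "(\<Sum>x\<in>S. u x powr p) \<le> a powr p" and vb: "(\<Sum>x\<in>S. v x powr p') \<le> b powr p'"
  shows "(\<Sum>x\<in>S. u x * v x) \<le> a * b"
proof -
  note vanish = sum_powr_le_zero_imp_zero[OF S]
  consider "a = 0" | "b = 0" | "0 < a" "0 < b"
    using nn by linarith
  then show ?thesis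
  proof cases
    case 1
    then show ?thesis using vanish[of u] ua vb by simp
  next
    case 2
    then show ?thesis using vanish[of v] ua vb by simp
  next
    case 3
    have "(\<Sum>x\<in>S. u x * v x) = a * b * (\<Sum>x\<in>S. (u x / a) * (v x / b))"
      using 3 by (simp add: sum_distrib_left)
    also have "\<dots> \<le> a * b * (\<Sum>x\<in>S. (u x / a) powr p / p + (v x / b) powr p' / p')"
      using 3 u v p by (intro mult_left_mono sum_mono Youngs_inequality) auto
    also have "\<dots> = a * b * ((\<Sum>x\<in>S. u x powr p) / a powr p / p + (\<Sum>x\<in>S. v x powr p') / b powr p' / p')"
      using 3 u v by (simp add: powr_divide sum.distrib sum_divide_distrib)
    also have "\<dots> \<le> a * b * (1 / p + 1 / p')"
      using 3 p ua vb by (intro mult_left_mono add_mono divide_right_mono) (auto simp: field_simps)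
    finally show ?thesis using p(3) by simp
  qed
qed

text \<open>\<open>u + v\<close> is \<open>a + b\<close> times the convex combination of \<open>u / a\<close> and \<open>v / b\<close> with weights \<open>a / (a + b)\<close>
and \<open>b / (a + b)\<close>; convexity of the power function does the rest.\<close>

lemma minkowski_two:
  fixes u v :: "'a \<Rightarrow> real"
  assumes p: "1 \<le> p" and S: "finite S" and nn: "0 \<le> a" "0 \<le> b"
    and u: "\<And>x. 0 \<le> u x" and v: "\<And>x. 0 \<le> v x"
    and ua: "(\<Sum>x\<in>S. u x powr p) \<le> a powr p" and vb: "(\<Sum>x\<in>S. v x powr p) \<le> b powr p"
  shows "(\<Sum>x\<in>S. (u x + v x) powr p) \<le> (a + b) powr p"
proof -
  note vanish = sum_powr_le_zero_imp_zero[OF S]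
  consider "a = 0" | "b = 0" | "0 < a" "0 < b"
    using nn by linarith
  then show ?thesis
  proof cases
    case 1
    then show ?thesis using vanish[of u] ua vb by simp
  next
    case 2
    then show ?thesis using vanish[of v] ua vb by simp
  next
    case 3
    define t where "t = b / (a + b)"
    have t: "0 < t" "t < 1" "1 - t = a / (a + b)"
      using 3 by (auto simp: t_def field_simps)
    have "(u x + v x) powr p \<le> (a + b) powr p * ((1 - t) * (u x powr p / a powr p) + t * (v x powr p / b powr p))"
      for x
    proof -
      have "u x + v x = (a + b) * ((1 - t) * (u x / a) + t * (v x / b))"
        using 3 by (simp add: t(3) distrib_left) (simp add: t_def)
      then have "(u x + v x) powr p = (a + b) powr p * ((1 - t) * (u x / a) + t * (v x / b)) powr p"
        using 3 t u v by (simp add: powr_mult)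
      moreover have "((1 - t) *\<^sub>R (u x / a) + t *\<^sub>R (v x / b)) powr p
          \<le> (1 - t) * (u x / a) powr p + t * (v x / b) powr p"
        using convex_onD[OF convex_on_powr_nonneg[OF p], of t "u x / a" "v x / b"] t u v 3 by auto
      ultimately show ?thesis
        using u v 3 by (simp add: powr_divide mult_left_mono)
    qed
    then have "(\<Sum>x\<in>S. (u x + v x) powr p)
        \<le> (\<Sum>x\<in>S. (a + b) powr p * ((1 - t) * (u x powr p / a powr p) + t * (v x powr p / b powr p)))"
      by (intro sum_mono)
    also have "\<dots> = (a + b) powr p * ((1 - t) * ((\<Sum>x\<in>S. u x powr p) / a powr p)
        + t * ((\<Sum>x\<in>S. v x powr p) / b powr p))"
      by (simp add: sum.distrib sum_distrib_left sum_divide_distrib distrib_left)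
    also have "\<dots> \<le> (a + b) powr p * ((1 - t) * 1 + t * 1)"
      using ua vb t 3 by (intro mult_left_mono add_mono) (auto simp: field_simps)
    finally show ?thesis by simp
  qed
qed

text \<open>Jensen's inequality for the uniform weights on \<open>A\<close>.\<close>

lemma power_mean_bound:
  fixes c :: "'a \<Rightarrow> complex"
  assumes p: "1 \<le> p" and A: "finite A" "real (card A) \<le> N"
  shows "norm (\<Sum>y\<in>A. c y) powr p \<le> N powr (p - 1) * (\<Sum>y\<in>A. norm (c y) powr p)"
proof (cases "A = {}")
  case False
  define n where "n = real (card A)"
  have n: "0 < n" "n \<le> N" using A False by (auto simp: n_def card_gt_0_iff)
  have "norm (\<Sum>y\<in>A. c y) \<le> n * (\<Sum>y\<in>A. (1 / n) *\<^sub>R norm (c y))"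
    using n by (simp add: norm_sum flip: sum_divide_distrib)
  then have "norm (\<Sum>y\<in>A. c y) powr p \<le> (n * (\<Sum>y\<in>A. (1 / n) *\<^sub>R norm (c y))) powr p"
    using p by (intro powr_mono2) auto
  also have "\<dots> = n powr p * (\<Sum>y\<in>A. (1 / n) *\<^sub>R norm (c y)) powr p"
    using n by (intro powr_mult)
  also have "\<dots> \<le> n powr p * (\<Sum>y\<in>A. (1 / n) * norm (c y) powr p)"
    using n A False by (intro mult_left_mono convex_on_sum[OF _ _ convex_on_powr_nonneg[OF p]]) (auto simp: n_def)
  also have "\<dots> = n powr (p - 1) * (\<Sum>y\<in>A. norm (c y) powr p)"
    using n by (simp add: powr_diff flip: sum_divide_distrib)
  also have "\<dots> \<le> N powr (p - 1) * (\<Sum>y\<in>A. norm (c y) powr p)"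
    using n p by (intro mult_right_mono powr_mono2 sum_nonneg) auto
  finally show ?thesis .
qed simp

text \<open>The operator with kernel \<open>\<kappa>\<close> maps \<open>p\<close>-summable functions to \<open>p\<close>-summable functions with norm at most \<open>B\<close>.
Only finite sections are compared, so that every estimate is about finite sums.\<close>

definition kernel_bound :: "real \<Rightarrow> ('a \<Rightarrow> 'b \<Rightarrow> complex) \<Rightarrow> real \<Rightarrow> bool" where
  "kernel_bound p \<kappa> B \<longleftrightarrow> 0 \<le> B \<and> (\<forall>S T f. finite S \<longrightarrow> finite T \<longrightarrow>
     (\<Sum>x\<in>S. norm (\<Sum>y\<in>T. \<kappa> x y * f y) powr p) \<le> B powr p * (\<Sum>y\<in>T. norm (f y) powr p))"

lemma kernel_boundI:
  assumes "0 \<le> B"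
    and "\<And>S T f. finite S \<Longrightarrow> finite T \<Longrightarrow>
      (\<Sum>x\<in>S. norm (\<Sum>y\<in>T. \<kappa> x y * f y) powr p) \<le> B powr p * (\<Sum>y\<in>T. norm (f y) powr p)"
  shows "kernel_bound p \<kappa> B"
  using assms unfolding kernel_bound_def by blast

lemma kernel_boundD:
  assumes "kernel_bound p \<kappa> B" "finite S" "finite T"
  shows "(\<Sum>x\<in>S. norm (\<Sum>y\<in>T. \<kappa> x y * f y) powr p) \<le> B powr p * (\<Sum>y\<in>T. norm (f y) powr p)"
  using assms unfolding kernel_bound_def by blast

lemma kernel_bound_nonneg: "kernel_bound p \<kappa> B \<Longrightarrow> 0 \<le> B"
  unfolding kernel_bound_def by blast

lemma kernel_bound_entry:
  assumes p: "1 \<le> p" and \<kappa>: "kernel_bound p \<kappa> B"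
  shows "norm (\<kappa> x y) \<le> B"
proof (rule powr_le_cancel)
  show "norm (\<kappa> x y) powr p \<le> B powr p"
    using kernel_boundD[OF \<kappa>, of "{x}" "{y}" "\<lambda>_. 1"] by simp
qed (use p kernel_bound_nonneg[OF \<kappa>] in auto)

lemma kernel_bound_mono:
  fixes \<kappa> :: "'a \<Rightarrow> 'b \<Rightarrow> complex"
  assumes "1 \<le> p" "kernel_bound p \<kappa> A" "A \<le> B"
  shows "kernel_bound p \<kappa> B"
proof (rule kernel_boundI)
  fix S :: "'a set" and T :: "'b set" and f :: "'b \<Rightarrow> complex"
  assume "finite S" "finite T"
  note kernel_boundD[OF assms(2) this, of f]
  also have "A powr p * (\<Sum>y\<in>T. norm (f y) powr p) \<le> B powr p * (\<Sum>y\<in>T. norm (f y) powr p)"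
    using assms kernel_bound_nonneg[OF assms(2)] by (intro mult_right_mono powr_mono2 sum_nonneg) auto
  finally show "(\<Sum>x\<in>S. norm (\<Sum>y\<in>T. \<kappa> x y * f y) powr p) \<le> B powr p * (\<Sum>y\<in>T. norm (f y) powr p)" .
qed (use assms kernel_bound_nonneg[OF assms(2)] in auto)

text \<open>Only finite rectangles are tested, so a decomposition of the kernel may depend on the rectangle.\<close>

lemma kernel_bound_local:
  fixes \<kappa> :: "'a \<Rightarrow> 'b \<Rightarrow> complex"
  assumes "0 \<le> B"
    and "\<And>S T. finite S \<Longrightarrow> finite T \<Longrightarrow>
      \<exists>\<kappa>'. kernel_bound p \<kappa>' B \<and> (\<forall>x\<in>S. \<forall>y\<in>T. \<kappa> x y = \<kappa>' x y)"
  shows "kernel_bound p \<kappa> B"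
proof (rule kernel_boundI)
  fix S :: "'a set" and T :: "'b set" and f :: "'b \<Rightarrow> complex"
  assume fin: "finite S" "finite T"
  then obtain \<kappa>' where \<kappa>': "kernel_bound p \<kappa>' B" "\<forall>x\<in>S. \<forall>y\<in>T. \<kappa> x y = \<kappa>' x y"
    using assms(2) by meson
  have "(\<Sum>x\<in>S. norm (\<Sum>y\<in>T. \<kappa> x y * f y) powr p) = (\<Sum>x\<in>S. norm (\<Sum>y\<in>T. \<kappa>' x y * f y) powr p)"
    using \<kappa>'(2) by simp
  then show "(\<Sum>x\<in>S. norm (\<Sum>y\<in>T. \<kappa> x y * f y) powr p) \<le> B powr p * (\<Sum>y\<in>T. norm (f y) powr p)"
    using kernel_boundD[OF \<kappa>'(1) fin] by simp
qed fact

lemma kernel_bound_zero: "1 \<le> p \<Longrightarrow> kernel_bound p (\<lambda>x y. 0) 0"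
  by (auto intro!: kernel_boundI)

lemma kernel_bound_add:
  fixes \<kappa> :: "'a \<Rightarrow> 'b \<Rightarrow> complex"
  assumes p: "1 \<le> p" and \<kappa>: "kernel_bound p \<kappa> A" and l: "kernel_bound p l B"
  shows "kernel_bound p (\<lambda>x y. \<kappa> x y + l x y) (A + B)"
proof (rule kernel_boundI)
  fix S :: "'a set" and T :: "'b set" and f :: "'b \<Rightarrow> complex"
  assume fin: "finite S" "finite T"
  define R where "R = (\<Sum>y\<in>T. norm (f y) powr p)"
  define r where "r = R powr (1 / p)"
  have R: "0 \<le> R" "r powr p = R"
    using p by (auto simp: r_def powr_powr R_def sum_nonneg abs_of_nonneg)
  have nn: "0 \<le> A" "0 \<le> B" "0 \<le> r"
    using \<kappa> l kernel_bound_nonneg by (auto simp: r_def)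
  have "(\<Sum>x\<in>S. norm (\<Sum>y\<in>T. (\<kappa> x y + l x y) * f y) powr p)
      \<le> (\<Sum>x\<in>S. (norm (\<Sum>y\<in>T. \<kappa> x y * f y) + norm (\<Sum>y\<in>T. l x y * f y)) powr p)"
    using p by (intro sum_mono powr_mono2)
      (auto simp: distrib_right sum.distrib norm_triangle_ineq)
  also have "\<dots> \<le> (A * r + B * r) powr p"
    using kernel_boundD[OF \<kappa> fin, of f] kernel_boundD[OF l fin, of f] nn
    by (intro minkowski_two) (auto simp: p fin powr_mult R_def[symmetric] R)
  also have "\<dots> = (A + B) powr p * R"
    using nn R by (simp add: powr_mult flip: distrib_right)
  finally show "(\<Sum>x\<in>S. norm (\<Sum>y\<in>T. (\<kappa> x y + l x y) * f y) powr p)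
      \<le> (A + B) powr p * (\<Sum>y\<in>T. norm (f y) powr p)"
    unfolding R_def .
qed (use kernel_bound_nonneg[OF \<kappa>] kernel_bound_nonneg[OF l] in simp)

lemma kernel_bound_scale:
  fixes \<kappa> :: "'a \<Rightarrow> 'b \<Rightarrow> complex"
  assumes \<kappa>: "kernel_bound p \<kappa> B"
  shows "kernel_bound p (\<lambda>x y. c * \<kappa> x y) (norm c * B)"
proof (rule kernel_boundI)
  fix S :: "'a set" and T :: "'b set" and f :: "'b \<Rightarrow> complex"
  assume fin: "finite S" "finite T"
  have "(\<Sum>x\<in>S. norm (\<Sum>y\<in>T. c * \<kappa> x y * f y) powr p)
      = norm c powr p * (\<Sum>x\<in>S. norm (\<Sum>y\<in>T. \<kappa> x y * f y) powr p)"
  proof -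
    have eq: "(\<Sum>y\<in>T. c * \<kappa> x y * f y) = c * (\<Sum>y\<in>T. \<kappa> x y * f y)" for x
      by (simp add: sum_distrib_left mult.assoc)
    then show ?thesis
      by (simp only: eq norm_mult powr_mult sum_distrib_left[symmetric])
  qed
  also have "\<dots> \<le> norm c powr p * (B powr p * (\<Sum>y\<in>T. norm (f y) powr p))"
    by (intro mult_left_mono kernel_boundD[OF \<kappa>] fin) auto
  finally show "(\<Sum>x\<in>S. norm (\<Sum>y\<in>T. c * \<kappa> x y * f y) powr p)
      \<le> (norm c * B) powr p * (\<Sum>y\<in>T. norm (f y) powr p)"
    using kernel_bound_nonneg[OF \<kappa>] by (simp add: powr_mult mult.assoc)
qed (use kernel_bound_nonneg[OF \<kappa>] in auto)

lemma kernel_bound_diff: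
  assumes "1 \<le> p" "kernel_bound p \<kappa> A" "kernel_bound p l B"
  shows "kernel_bound p (\<lambda>x y. \<kappa> x y - l x y) (A + B)"
  using kernel_bound_add[OF assms(1,2) kernel_bound_scale[OF assms(3), of "- 1"]] by simp

lemma kernel_bound_sum:
  assumes "1 \<le> p" "finite I" "\<And>i. i \<in> I \<Longrightarrow> kernel_bound p (\<kappa> i) (b i)"
  shows "kernel_bound p (\<lambda>x y. \<Sum>i\<in>I. \<kappa> i x y) (\<Sum>i\<in>I. b i)"
  using assms(2,3)
proof (induction I rule: finite_induct)
  case empty
  then show ?case using kernel_bound_zero[OF assms(1)] by simp
next
  case (insert i I)
  then show ?case using kernel_bound_add[OF assms(1), of "\<kappa> i" "b i"] by simp
qed

text \<open>For fixed finite sets both sides of the estimate are continuous in the kernel.\<close>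

lemma kernel_bound_limit:
  fixes \<kappa> :: "nat \<Rightarrow> 'a \<Rightarrow> 'b \<Rightarrow> complex"
  assumes p: "1 \<le> p" and \<kappa>: "\<And>N. kernel_bound p (\<kappa> N) B"
    and lim: "\<And>x y. (\<lambda>N. \<kappa> N x y) \<longlonglongrightarrow> l x y"
  shows "kernel_bound p l B"
proof (rule kernel_boundI)
  fix S :: "'a set" and T :: "'b set" and f :: "'b \<Rightarrow> complex"
  assume fin: "finite S" "finite T"
  have "(\<lambda>N. \<Sum>x\<in>S. norm (\<Sum>y\<in>T. \<kappa> N x y * f y) powr p)
      \<longlonglongrightarrow> (\<Sum>x\<in>S. norm (\<Sum>y\<in>T. l x y * f y) powr p)"
    using p by (intro tendsto_sum tendsto_powr' tendsto_norm tendsto_mult lim tendsto_const) auto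
  then show "(\<Sum>x\<in>S. norm (\<Sum>y\<in>T. l x y * f y) powr p) \<le> B powr p * (\<Sum>y\<in>T. norm (f y) powr p)"
    by (rule LIMSEQ_le_const2) (use kernel_boundD[OF \<kappa> fin] in blast)
qed (use kernel_bound_nonneg[OF \<kappa>] in auto)

lemma kernel_bound_reindex_on:
  fixes \<kappa> :: "'a \<Rightarrow> 'b \<Rightarrow> complex" and \<sigma> :: "'c \<Rightarrow> 'a" and \<rho> :: "'d \<Rightarrow> 'b"
  assumes \<kappa>: "kernel_bound p \<kappa> B" and inj: "inj_on \<sigma> X" "inj_on \<rho> Y"
  shows "kernel_bound p (\<lambda>x y. if x \<in> X \<and> y \<in> Y then \<kappa> (\<sigma> x) (\<rho> y) else 0) B"
proof (rule kernel_boundI)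
  fix S :: "'c set" and T :: "'d set" and f :: "'d \<Rightarrow> complex"
  assume fin: "finite S" "finite T"
  define g where "g = f \<circ> the_inv_into Y \<rho>"
  have g: "g (\<rho> y) = f y" if "y \<in> Y" for y using inj that by (simp add: g_def the_inv_into_f_f)
  have inj': "inj_on \<sigma> (S \<inter> X)" "inj_on \<rho> (T \<inter> Y)" using inj by (auto intro: inj_on_subset)
  have "(\<Sum>x\<in>S. norm (\<Sum>y\<in>T. (if x \<in> X \<and> y \<in> Y then \<kappa> (\<sigma> x) (\<rho> y) else 0) * f y) powr p)
      = (\<Sum>x\<in>S \<inter> X. norm (\<Sum>y\<in>T \<inter> Y. \<kappa> (\<sigma> x) (\<rho> y) * f y) powr p)"
  proof (intro sum.mono_neutral_cong_right fin)
    fix x assume "x \<in> S \<inter> X"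
    then have "(\<Sum>y\<in>T. (if x \<in> X \<and> y \<in> Y then \<kappa> (\<sigma> x) (\<rho> y) else 0) * f y) = (\<Sum>y\<in>T \<inter> Y. \<kappa> (\<sigma> x) (\<rho> y) * f y)"
      using fin by (intro sum.mono_neutral_cong_right) auto
    then show "norm (\<Sum>y\<in>T. (if x \<in> X \<and> y \<in> Y then \<kappa> (\<sigma> x) (\<rho> y) else 0) * f y) powr p
        = norm (\<Sum>y\<in>T \<inter> Y. \<kappa> (\<sigma> x) (\<rho> y) * f y) powr p" by simp
  qed auto
  also have "\<dots> = (\<Sum>x\<in>\<sigma> ` (S \<inter> X). norm (\<Sum>y\<in>\<rho> ` (T \<inter> Y). \<kappa> x y * g y) powr p)"
    by (simp add: sum.reindex[OF inj'(1)] sum.reindex[OF inj'(2)] g)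
  also have "\<dots> \<le> B powr p * (\<Sum>y\<in>\<rho> ` (T \<inter> Y). norm (g y) powr p)"
    using fin by (intro kernel_boundD[OF \<kappa>]) auto
  also have "\<dots> = B powr p * (\<Sum>y\<in>T \<inter> Y. norm (f y) powr p)"
    by (simp add: sum.reindex[OF inj'(2)] g)
  also have "\<dots> \<le> B powr p * (\<Sum>y\<in>T. norm (f y) powr p)"
    using fin by (intro mult_left_mono sum_mono2) auto
  finally show "(\<Sum>x\<in>S. norm (\<Sum>y\<in>T. (if x \<in> X \<and> y \<in> Y then \<kappa> (\<sigma> x) (\<rho> y) else 0) * f y) powr p)
      \<le> B powr p * (\<Sum>y\<in>T. norm (f y) powr p)" .
qed (use kernel_bound_nonneg[OF \<kappa>] in auto)

lemma kernel_bound_reindex: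
  assumes "kernel_bound p \<kappa> B" "inj \<sigma>" "inj \<rho>"
  shows "kernel_bound p (\<lambda>x y. \<kappa> (\<sigma> x) (\<rho> y)) B"
  using kernel_bound_reindex_on[OF assms] by simp

text \<open>The kernel factors through the map that sums a function on \<open>Y\<close> over the fibres of \<open>\<pi>\<close>, and by the
power mean inequality this map has norm at most \<open>N powr (1 - 1 / p)\<close>.\<close>

lemma kernel_bound_fibres:
  fixes \<kappa> :: "'a \<Rightarrow> 'b \<Rightarrow> complex" and \<pi> :: "'c \<Rightarrow> 'b"
  assumes p: "1 \<le> p" and \<kappa>: "kernel_bound p \<kappa> B" and N: "0 \<le> N"
    and fibre: "\<And>z. finite {y \<in> Y. \<pi> y = z} \<and> real (card {y \<in> Y. \<pi> y = z}) \<le> N"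
  shows "kernel_bound p (\<lambda>x y. if y \<in> Y then \<kappa> x (\<pi> y) else 0) (B * N powr (1 - 1 / p))"
proof (rule kernel_boundI)
  fix S :: "'a set" and T :: "'c set" and f :: "'c \<Rightarrow> complex"
  assume fin: "finite S" "finite T"
  define T' where "T' = T \<inter> Y"
  have T': "finite T'" using fin by (simp add: T'_def)
  define h where "h z = (\<Sum>y | y \<in> T' \<and> \<pi> y = z. f y)" for z
  have B: "0 \<le> B" using kernel_bound_nonneg[OF \<kappa>] .
  have "(\<Sum>y\<in>T. (if y \<in> Y then \<kappa> x (\<pi> y) else 0) * f y) = (\<Sum>z\<in>\<pi> ` T'. \<kappa> x z * h z)" for x
  proof -
    have "(\<Sum>y\<in>T. (if y \<in> Y then \<kappa> x (\<pi> y) else 0) * f y) = (\<Sum>y\<in>T'. \<kappa> x (\<pi> y) * f y)"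
      unfolding T'_def using fin by (intro sum.mono_neutral_cong_right) auto
    also have "\<dots> = (\<Sum>z\<in>\<pi> ` T'. \<Sum>y | y \<in> T' \<and> \<pi> y = z. \<kappa> x (\<pi> y) * f y)"
      using T' by (rule sum.image_gen)
    also have "\<dots> = (\<Sum>z\<in>\<pi> ` T'. \<kappa> x z * h z)"
      unfolding h_def sum_distrib_left by (intro sum.cong) auto
    finally show ?thesis .
  qed
  then have "(\<Sum>x\<in>S. norm (\<Sum>y\<in>T. (if y \<in> Y then \<kappa> x (\<pi> y) else 0) * f y) powr p)
      = (\<Sum>x\<in>S. norm (\<Sum>z\<in>\<pi> ` T'. \<kappa> x z * h z) powr p)" by simp
  also have "\<dots> \<le> B powr p * (\<Sum>z\<in>\<pi> ` T'. norm (h z) powr p)"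
    using fin T' by (intro kernel_boundD[OF \<kappa>]) auto
  also have "\<dots> \<le> B powr p * (\<Sum>z\<in>\<pi> ` T'. N powr (p - 1) * (\<Sum>y | y \<in> T' \<and> \<pi> y = z. norm (f y) powr p))"
  proof (intro mult_left_mono sum_mono)
    fix z
    have "card {y \<in> T'. \<pi> y = z} \<le> card {y \<in> Y. \<pi> y = z}"
      using fibre[of z] by (intro card_mono) (auto simp: T'_def)
    then have "real (card {y \<in> T'. \<pi> y = z}) \<le> N" using fibre[of z] by linarith
    then show "norm (h z) powr p \<le> N powr (p - 1) * (\<Sum>y | y \<in> T' \<and> \<pi> y = z. norm (f y) powr p)"
      unfolding h_def using T' by (intro power_mean_bound p) auto
  qed auto
  also have "\<dots> = B powr p * N powr (p - 1) * (\<Sum>y\<in>T'. norm (f y) powr p)"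
    by (simp add: sum.image_gen[OF T', of "\<lambda>y. norm (f y) powr p" \<pi>] sum_distrib_left mult_ac)
  also have "\<dots> \<le> B powr p * N powr (p - 1) * (\<Sum>y\<in>T. norm (f y) powr p)"
    using fin by (intro mult_left_mono sum_mono2) (auto simp: T'_def)
  also have "B powr p * N powr (p - 1) = (B * N powr (1 - 1 / p)) powr p"
    using B N p by (simp add: powr_mult powr_powr algebra_simps)
  finally show "(\<Sum>x\<in>S. norm (\<Sum>y\<in>T. (if y \<in> Y then \<kappa> x (\<pi> y) else 0) * f y) powr p)
      \<le> (B * N powr (1 - 1 / p)) powr p * (\<Sum>y\<in>T. norm (f y) powr p)" .
qed (use kernel_bound_nonneg[OF \<kappa>] in auto)

lemma kernel_bound_translation:
  fixes u :: "int \<Rightarrow> complex"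
  assumes "kernel_bound p (\<lambda>n m. u (n - m)) B"
  shows "kernel_bound p (\<lambda>n m. u (n - m + d)) B"
  using kernel_bound_reindex[OF assms, of "\<lambda>n. n + d" id] by (simp add: algebra_simps)

text \<open>Convolution with a unit mass is an isometry, and on a finite rectangle \<open>u\<close> is a finite combination of
unit masses.\<close>

lemma kernel_bound_summable:
  fixes u :: "int \<Rightarrow> complex"
  assumes p: "1 \<le> p" and U: "\<And>D. finite D \<Longrightarrow> (\<Sum>d\<in>D. norm (u d)) \<le> U"
  shows "kernel_bound p (\<lambda>n m. u (n - m)) U"
proof (rule kernel_bound_local)
  show "0 \<le> U" using U[of "{}"] by simp
  have id: "kernel_bound p (\<lambda>n m. if n - m = (0::int) then 1 else 0) 1"
  proof (rule kernel_boundI)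
    fix S T :: "int set" and f :: "int \<Rightarrow> complex"
    assume fin: "finite S" "finite T"
    have "(\<Sum>m\<in>T. (if n - m = 0 then 1 else 0) * f m) = (if n \<in> T then f n else 0)" for n
      using fin by (simp add: if_distrib[of "\<lambda>c. c * _"] cong: if_cong)
    then have "(\<Sum>n\<in>S. norm (\<Sum>m\<in>T. (if n - m = 0 then 1 else 0) * f m) powr p)
        = (\<Sum>n\<in>S \<inter> T. norm (f n) powr p)"
      using fin by (intro sum.mono_neutral_cong_right) auto
    also have "\<dots> \<le> (\<Sum>n\<in>T. norm (f n) powr p)"
      using fin by (intro sum_mono2) auto
    finally show "(\<Sum>n\<in>S. norm (\<Sum>m\<in>T. (if n - m = 0 then 1 else 0) * f m) powr p)
        \<le> 1 powr p * (\<Sum>n\<in>T. norm (f n) powr p)" by simp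
  qed simp
  fix S T :: "int set"
  assume fin: "finite S" "finite T"
  define D where "D = (\<lambda>(n, m). n - m) ` (S \<times> T)"
  have D: "finite D" using fin by (simp add: D_def)
  define \<kappa>' where "\<kappa>' n m = (\<Sum>d\<in>D. u d * (if n - m + (- d) = 0 then 1 else 0))" for n m
  have "kernel_bound p \<kappa>' (\<Sum>d\<in>D. norm (u d) * 1)"
    unfolding \<kappa>'_def
    by (intro kernel_bound_sum p D kernel_bound_scale
        kernel_bound_translation[where u = "\<lambda>n. if n = 0 then 1 else 0"]) (use id in simp)
  then have "kernel_bound p \<kappa>' U"
    by (rule kernel_bound_mono[OF p]) (use U[OF D] in simp)
  moreover have "u (n - m) = \<kappa>' n m" if "n \<in> S" "m \<in> T" for n m
  proof -
    have "\<kappa>' n m = (\<Sum>d\<in>D. if d = n - m then u d else 0)"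
      unfolding \<kappa>'_def by (intro sum.cong) auto
    also have "\<dots> = u (n - m)"
      using D that by (force simp: D_def)
    finally show ?thesis ..
  qed
  ultimately show "\<exists>\<kappa>'. kernel_bound p \<kappa>' U \<and> (\<forall>n\<in>S. \<forall>m\<in>T. u (n - m) = \<kappa>' n m)" by blast
qed

text \<open>The norm of the image under the transpose is attained by pairing with its extremal function \<open>g\<close>; moving
the kernel to \<open>g\<close> leaves one application of Hoelder's inequality.\<close>

lemma kernel_bound_dual:
  fixes \<kappa> :: "'a \<Rightarrow> 'b \<Rightarrow> complex"
  assumes p: "1 < p" "1 < p'" "1 / p + 1 / p' = 1" and \<kappa>: "kernel_bound p \<kappa> B"
  shows "kernel_bound p' (\<lambda>y x. \<kappa> x y) B"
proof (rule kernel_boundI)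
  fix T :: "'b set" and S :: "'a set" and f :: "'a \<Rightarrow> complex"
  assume fin: "finite T" "finite S"
  define h where "h y = (\<Sum>x\<in>S. \<kappa> x y * f x)" for y
  \<comment> \<open>the function for which Hoelder's inequality is an equality when paired with \<open>h\<close>\<close>
  define g where "g y = cnj (sgn (h y)) * of_real (norm (h y) powr (p' - 1))" for y
  define E where "E = (\<Sum>y\<in>T. norm (h y) powr p')"
  define R where "R = (\<Sum>x\<in>S. norm (f x) powr p') powr (1 / p')"
  have B: "0 \<le> B" using kernel_bound_nonneg[OF \<kappa>] .
  have E0: "0 \<le> E" and R0: "0 \<le> R" by (auto simp: E_def R_def intro: sum_nonneg)
  have hg: "h y * g y = of_real (norm (h y) powr p')" for y
  proof (cases "h y = 0")
    case False
    have "h y * g y = of_real (norm (h y) * norm (h y) powr (p' - 1))"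
      using False unfolding g_def sgn_eq
      by (simp add: complex_norm_square[symmetric] power2_eq_square field_simps)
    also have "norm (h y) * norm (h y) powr (p' - 1) = norm (h y) powr p'"
      using False by (simp add: powr_diff)
    finally show ?thesis .
  qed (use p in simp)
  have pp: "(p' - 1) * p = p'" using p by (simp add: field_simps)
  have gp: "norm (g y) powr p = norm (h y) powr p'" for y
    using pp by (cases "h y = 0") (auto simp: g_def norm_mult norm_sgn powr_powr)
  have "complex_of_real E = (\<Sum>y\<in>T. h y * g y)"
    by (simp add: E_def hg)
  also have "\<dots> = (\<Sum>y\<in>T. \<Sum>x\<in>S. f x * (\<kappa> x y * g y))"
    unfolding h_def sum_distrib_right by (intro sum.cong refl) (simp add: mult_ac)
  also have "\<dots> = (\<Sum>x\<in>S. f x * (\<Sum>y\<in>T. \<kappa> x y * g y))"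
    by (subst sum.swap) (simp add: sum_distrib_left)
  finally have "E = norm (\<Sum>x\<in>S. f x * (\<Sum>y\<in>T. \<kappa> x y * g y))"
    using E0 by (metis abs_of_nonneg norm_of_real)
  also have "\<dots> \<le> (\<Sum>x\<in>S. norm (\<Sum>y\<in>T. \<kappa> x y * g y) * norm (f x))"
    by (rule order_trans[OF norm_sum]) (simp add: norm_mult mult.commute)
  also have "\<dots> \<le> (B * E powr (1 / p)) * R"
  proof (rule holder_sum[OF p fin(2)])
    show "(\<Sum>x\<in>S. norm (\<Sum>y\<in>T. \<kappa> x y * g y) powr p) \<le> (B * E powr (1 / p)) powr p"
      using kernel_boundD[OF \<kappa> fin(2,1), of g] p B E0
      by (simp add: gp E_def[symmetric] powr_mult powr_powr)
    show "(\<Sum>x\<in>S. norm (f x) powr p') \<le> R powr p'"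
      using p by (simp add: R_def powr_powr sum_nonneg)
  qed (use B R0 in auto)
  finally have EE: "E \<le> B * E powr (1 / p) * R" .
  have "E \<le> (B * R) powr p'"
  proof (cases "E = 0")
    case False
    have "E powr (1 / p') * E powr (1 / p) = E"
      using p(3) E0 by (simp add: add.commute flip: powr_add)
    then have "E powr (1 / p') * E powr (1 / p) \<le> (B * R) * E powr (1 / p)"
      using EE by (simp add: mult_ac)
    then have "E powr (1 / p') \<le> B * R"
      using False E0 by (subst (asm) mult_le_cancel_right_pos) auto
    then have "(E powr (1 / p')) powr p' \<le> (B * R) powr p'"
      using p by (intro powr_mono2) auto
    then show ?thesis using p E0 by (simp add: powr_powr)
  qed simp
  also have "\<dots> = B powr p' * (\<Sum>x\<in>S. norm (f x) powr p')"
    using B R0 p by (simp add: powr_mult) (simp add: R_def powr_powr sum_nonneg)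
  finally show "(\<Sum>y\<in>T. norm (\<Sum>x\<in>S. \<kappa> x y * f x) powr p') \<le> B powr p' * (\<Sum>x\<in>S. norm (f x) powr p')"
    unfolding E_def h_def .
qed (use kernel_bound_nonneg[OF \<kappa>] in auto)

lemma lp_bound_iff_kernel_bound:
  fixes \<kappa> :: "'a \<Rightarrow> 'a \<Rightarrow> complex"
  assumes p: "1 \<le> p"
  shows "lp_bound p (\<lambda>f x. \<Sum>y | f y \<noteq> 0. f y * \<kappa> x y) B \<longleftrightarrow> kernel_bound p \<kappa> B"
proof
  assume b: "lp_bound p (\<lambda>f x. \<Sum>y | f y \<noteq> 0. f y * \<kappa> x y) B"
  show "kernel_bound p \<kappa> B"
  proof (rule kernel_boundI)
    show B: "0 \<le> B" using b by (simp add: lp_bound_def)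
    fix S :: "'a set" and T :: "'a set" and f :: "'a \<Rightarrow> complex"
    assume fin: "finite S" "finite T"
    define g where "g y = (if y \<in> T then f y else 0)" for y
    define h where "h x = (\<Sum>y | g y \<noteq> 0. g y * \<kappa> x y)" for x
    have supp: "{y. g y \<noteq> 0} \<subseteq> T" by (auto simp: g_def)
    have h: "h x = (\<Sum>y\<in>T. \<kappa> x y * f y)" for x
      unfolding h_def using fin supp
      by (intro sum.mono_neutral_cong_left) (auto simp: g_def)
    have "finite {y. g y \<noteq> 0}" using supp fin finite_subset by blast
    with b have hlp: "in_lp p h" "lp_norm p h \<le> B * lp_norm p g"
      unfolding lp_bound_def h_def by blast+
    have gsum: "(\<Sum>\<^sub>\<infinity>y. norm (g y) powr p) = (\<Sum>y\<in>T. norm (f y) powr p)"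
    proof -
      have "(\<Sum>\<^sub>\<infinity>y. norm (g y) powr p) = (\<Sum>\<^sub>\<infinity>y\<in>T. norm (f y) powr p)"
        using p by (intro infsum_cong_neutral) (auto simp: g_def)
      then show ?thesis using fin by simp
    qed
    have "(\<Sum>x\<in>S. norm (h x) powr p) \<le> (\<Sum>\<^sub>\<infinity>x. norm (h x) powr p)"
      using hlp(1) fin unfolding in_lp_def by (intro finite_sum_le_infsum) auto
    also have "\<dots> = lp_norm p h powr p"
      using p by (simp add: lp_norm_def powr_powr infsum_nonneg)
    also have "\<dots> \<le> (B * lp_norm p g) powr p"
      using hlp(2) p by (intro powr_mono2) (auto simp: lp_norm_def)
    also have "\<dots> = B powr p * (\<Sum>y\<in>T. norm (f y) powr p)"
      using B p by (simp add: powr_mult lp_norm_def gsum powr_powr sum_nonneg)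
    finally show "(\<Sum>x\<in>S. norm (\<Sum>y\<in>T. \<kappa> x y * f y) powr p) \<le> B powr p * (\<Sum>y\<in>T. norm (f y) powr p)"
      by (simp add: h)
  qed
next
  assume \<kappa>: "kernel_bound p \<kappa> B"
  have B: "0 \<le> B" using kernel_bound_nonneg[OF \<kappa>] .
  show "lp_bound p (\<lambda>f x. \<Sum>y | f y \<noteq> 0. f y * \<kappa> x y) B"
    unfolding lp_bound_def
  proof (intro conjI allI impI B)
    fix f :: "'a \<Rightarrow> complex"
    assume fin: "finite {y. f y \<noteq> 0}"
    define h where "h x = (\<Sum>y | f y \<noteq> 0. f y * \<kappa> x y)" for x
    define R where "R = (\<Sum>y | f y \<noteq> 0. norm (f y) powr p)"
    have R: "0 \<le> R" by (auto simp: R_def intro: sum_nonneg)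
    have fR: "lp_norm p f = R powr (1 / p)"
    proof -
      have "(\<Sum>\<^sub>\<infinity>y. norm (f y) powr p) = (\<Sum>\<^sub>\<infinity>y\<in>{y. f y \<noteq> 0}. norm (f y) powr p)"
        using p by (intro infsum_cong_neutral) auto
      then show ?thesis using fin by (simp add: lp_norm_def R_def)
    qed
    have fs: "(\<Sum>x\<in>S. norm (h x) powr p) \<le> B powr p * R" if "finite S" for S
      using kernel_boundD[OF \<kappa> that fin, of f] by (simp add: h_def R_def mult.commute)
    have hs: "(\<lambda>x. norm (h x) powr p) summable_on UNIV"
      by (rule nonneg_bdd_above_summable_on) (use fs in \<open>auto intro!: bdd_aboveI[of _ "B powr p * R"]\<close>)
    have "(\<Sum>\<^sub>\<infinity>x. norm (h x) powr p) \<le> B powr p * R"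
      by (rule infsum_le_finite_sums[OF hs]) (use fs in auto)
    then have "lp_norm p h \<le> (B powr p * R) powr (1 / p)"
      unfolding lp_norm_def using p by (intro powr_mono2 infsum_nonneg) auto
    also have "\<dots> = B * lp_norm p f"
      using B R p by (simp add: powr_mult fR powr_powr)
    finally show "lp_norm p (\<lambda>x. \<Sum>y | f y \<noteq> 0. f y * \<kappa> x y) \<le> B * lp_norm p f"
      unfolding h_def .
    show "in_lp p (\<lambda>x. \<Sum>y | f y \<noteq> 0. f y * \<kappa> x y)"
      using hs unfolding in_lp_def h_def .
  qed
qed

section \<open>Inverting geometric and difference recursions\<close>

lemma sum_negative_powers_le:
  fixes \<rho> :: real
  assumes \<rho>: "0 < \<rho>" "\<rho> < 1" and D: "finite D" "\<And>d. d \<in> D \<Longrightarrow> d < (0::int)"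
  shows "(\<Sum>d\<in>D. \<rho> ^ nat (- d)) \<le> 1 / (1 - \<rho>)"
proof -
  have "inj_on (\<lambda>d. nat (- d)) D"
    using D(2) by (auto simp: inj_on_def dest: D(2))
  then have "(\<Sum>d\<in>D. \<rho> ^ nat (- d)) = (\<Sum>n\<in>(\<lambda>d. nat (- d)) ` D. \<rho> ^ n)"
    by (simp add: sum.reindex)
  also have "\<dots> \<le> (\<Sum>n. \<rho> ^ n)"
    using \<rho> D(1) by (intro sum_le_suminf) auto
  finally show ?thesis using \<rho> by (simp add: suminf_geometric)
qed

text \<open>The facts of this locale depend on \<open>q\<close> alone, so that the final constant does not depend on the tree.\<close>

locale tree_degree =
  fixes q :: nat
  assumes q2: "2 \<le> q"
begin

lemma powr_neg_nat: "real q powr (- real n) = inverse (real q ^ n)"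
  using q2 by (simp add: powr_minus powr_realpow)

text \<open>For \<open>a n = q powr (n / 2) * K n\<close> this is the null sequence \<open>b\<close> with \<open>b n - b (n + 2) = a n\<close>.\<close>

definition tail_sum :: "(nat \<Rightarrow> complex) \<Rightarrow> nat \<Rightarrow> complex" where
  "tail_sum a n = (\<Sum>j. a (n + 2 * j))"

context
  fixes a :: "nat \<Rightarrow> complex" and B r :: real
  assumes r: "0 < r" "r < 1" and a: "\<And>n. norm (a n) \<le> B * r ^ n"
begin

lemma tail_term_bound: "norm (a (n + 2 * j)) \<le> B * r ^ n * (r ^ 2) ^ j"
  using a[of "n + 2 * j"] by (simp add: power_add power_mult mult.assoc)

lemma r2_less_1: "r ^ 2 < 1"
  using r by (simp add: power_less_one_iff)

lemma summable_tail_bound: "summable (\<lambda>j. B * r ^ n * (r ^ 2) ^ j)"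
  using r2_less_1 by (intro summable_mult) simp

lemma summable_tail: "summable (\<lambda>j. a (n + 2 * j))"
  by (rule summable_comparison_test'[OF summable_tail_bound tail_term_bound])

lemma tail_sum_sums: "(\<lambda>j. a (n + 2 * j)) sums tail_sum a n"
  unfolding tail_sum_def by (rule summable_sums[OF summable_tail])

lemma tail_sum_step: "tail_sum a n - tail_sum a (n + 2) = a n"
  using suminf_split_head[OF summable_tail[of n]] by (simp add: tail_sum_def add.assoc)

lemma tail_sum_bound: "norm (tail_sum a n) \<le> B / (1 - r ^ 2) * r ^ n"
proof -
  have "norm (tail_sum a n) \<le> (\<Sum>j. B * r ^ n * (r ^ 2) ^ j)"
    unfolding tail_sum_def by (intro norm_suminf_le summable_tail_bound tail_term_bound)
  also have "\<dots> = B * r ^ n * (1 / (1 - r ^ 2))"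
    using r2_less_1 by (subst suminf_mult) (auto simp: suminf_geometric)
  finally show ?thesis by simp
qed

lemma tail_sum_tendsto_0: "tail_sum a \<longlonglongrightarrow> 0"
proof (rule Lim_null_comparison)
  show "\<forall>\<^sub>F n in sequentially. norm (tail_sum a n) \<le> B / (1 - r ^ 2) * r ^ n"
    using tail_sum_bound by simp
  show "(\<lambda>n. B / (1 - r ^ 2) * r ^ n) \<longlonglongrightarrow> 0"
    using r by (intro tendsto_mult_right_zero LIMSEQ_power_zero) auto
qed

end

text \<open>The exponent is negative for \<open>p < 2\<close>: the weighted profile decays geometrically.\<close>

lemma half_power_decay:
  fixes K :: "nat \<Rightarrow> complex"
  assumes "norm (K n) \<le> B * real q powr (- real n / p)"
  shows "norm (of_real (real q powr (real n / 2)) * K n) \<le> B * (real q powr (- (1 / p - 1 / 2))) ^ n"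
proof -
  have "norm (of_real (real q powr (real n / 2)) * K n) = real q powr (real n / 2) * norm (K n)"
    by (simp add: norm_mult)
  also have "\<dots> \<le> real q powr (real n / 2) * (B * real q powr (- real n / p))"
    by (intro mult_left_mono assms) simp
  also have "\<dots> = B * (real q powr (real n / 2) * real q powr (- real n / p))"
    by simp
  also have "real q powr (real n / 2) * real q powr (- real n / p) = (real q powr (- (1 / p - 1 / 2))) ^ n"
    using q2 by (simp add: powr_powr algebra_simps flip: powr_realpow powr_add)
  finally show ?thesis .
qed

text \<open>The partial sums telescope to \<open>b n - b (n + 2 * J) / q ^ J\<close>.\<close>

lemma geometric_inversion:
  fixes b :: "nat \<Rightarrow> complex"
  assumes b: "b \<longlonglongrightarrow> 0"
  shows "(\<lambda>j. (b (n + 2 * j) - b (n + 2 * j + 2) / of_nat q) / of_nat q ^ j) sums b n"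
proof -
  have "(\<Sum>j<J. (b (n + 2 * j) - b (n + 2 * j + 2) / of_nat q) / of_nat q ^ j)
      = b n - b (n + 2 * J) / of_nat q ^ J" for J
  proof (induction J)
    case (Suc J)
    have "n + 2 * Suc J = n + 2 * J + 2" by simp
    then show ?case
      unfolding sum.lessThan_Suc Suc.IH by (simp only: power_Suc2 diff_divide_distrib divide_divide_eq_left mult.commute) simp
  qed simp
  moreover have "(\<lambda>J. b (n + 2 * J) / of_nat q ^ J) \<longlonglongrightarrow> 0"
  proof (rule Lim_null_comparison)
    show "\<forall>\<^sub>F J in sequentially. norm (b (n + 2 * J) / of_nat q ^ J) \<le> norm (b (n + 2 * J))"
      using q2 by (intro always_eventually allI) (simp add: norm_divide norm_power divide_le_eq mult_le_cancel_left1)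
    have "filterlim (\<lambda>J. n + 2 * J) at_top sequentially"
      by (rule filterlim_subseq) (auto simp: strict_mono_def)
    from filterlim_compose[OF b this] show "(\<lambda>J. norm (b (n + 2 * J))) \<longlonglongrightarrow> 0"
      by (rule tendsto_norm_zero)
  qed
  ultimately show ?thesis
    using tendsto_diff[OF tendsto_const[of "b n"], of "\<lambda>J. b (n + 2 * J) / of_nat q ^ J" 0 sequentially]
    by (simp add: sums_def)
qed

text \<open>The coefficients at height \<open>t\<close> of the even function with coefficients \<open>G n = b n - b (n + 2) / q\<close>.\<close>

definition boundary_coeff :: "real \<Rightarrow> (nat \<Rightarrow> complex) \<Rightarrow> int \<Rightarrow> complex" where
  "boundary_coeff t b n
    = of_real (real q powr (t * of_int n)) * (b (nat \<bar>n\<bar>) - b (nat \<bar>n\<bar> + 2) / of_nat q)"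

text \<open>The relation between a radial profile \<open>K\<close> and the sequence \<open>b\<close> through which it is compared with its
spherical transform. The limit condition makes \<open>b\<close> unique.\<close>

definition difference_pair :: "(nat \<Rightarrow> complex) \<Rightarrow> (nat \<Rightarrow> complex) \<Rightarrow> bool" where
  "difference_pair K b \<longleftrightarrow> b \<longlonglongrightarrow> 0 \<and> (\<forall>n. of_real (real q powr (real n / 2)) * K n = b n - b (n + 2))"

text \<open>The factor \<open>1 + 1 / (1 - q powr (- d))\<close> is the cost of cutting a convolution kernel off at \<open>0\<close>;
division by \<open>1 - q powr (- d)\<close> sums the geometric series over the number of descending steps.\<close>

definition bound_constant :: "real \<Rightarrow> real" where
  "bound_constant d = 32 * (1 + 1 / (1 - real q powr (- d))) / (1 - real q powr (- d))"

lemma bound_constant_pos: "0 < t \<Longrightarrow> 0 < bound_constant t"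
proof -
  assume "0 < t"
  then have "0 < 1 - real q powr (- t)" using q2 powr_less_one[of "real q" "- t"] by simp
  then show ?thesis unfolding bound_constant_def by (intro divide_pos_pos mult_pos_pos add_pos_pos) auto
qed

end

section \<open>Geometry of the rooted homogeneous tree\<close>

text \<open>The index of the successor wraps around in the definition of a cycle, whereas a path is a list of
successive neighbours; its two ends give the wrapped case.\<close>

lemma successively_cyclic:
  assumes "successively R xs" "xs \<noteq> []" "R (last xs) (hd xs)" "i < length xs"
  shows "R (xs ! i) (xs ! ((i + 1) mod length xs))"
proof (cases "Suc i = length xs")
  case True
  then have "xs ! i = last xs" using assms(2) by (metis diff_Suc_1 last_conv_nth)
  then show ?thesis using True assms by (simp add: hd_conv_nth)
next
  case False
  then have "Suc i < length xs" using assms(4) by simp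
  then show ?thesis using assms(1) by (simp add: successively_conv_nth)
qed

locale htree = tree_degree q for q :: nat +
  fixes adj :: "'v \<Rightarrow> 'v \<Rightarrow> bool" and x0 :: 'v
  assumes tree: "homogeneous_tree q adj"
begin

lemma adj_sym: "adj x y \<Longrightarrow> adj y x"
  and adj_irrefl: "\<not> adj x x"
  and connected: "adj\<^sup>*\<^sup>* x y"
  and acyclic: "\<not> graph_cycle adj xs"
  and card_neighbours: "card {y. adj x y} = q + 1"
  using tree unfolding homogeneous_tree_def by blast+

lemma finite_neighbours: "finite {y. adj x y}"
  by (rule card_ge_0_finite) (simp add: card_neighbours)

lemma gdist_walk: "(adj ^^ gdist adj x y) x y"
  using LeastI_ex[of "\<lambda>n. (adj ^^ n) x y"] connected[of x y] by (simp add: gdist_def rtranclp_power)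

lemma gdist_le: "(adj ^^ n) x y \<Longrightarrow> gdist adj x y \<le> n"
  unfolding gdist_def by (rule Least_le)

lemma gdist_self [simp]: "gdist adj x x = 0"
  using gdist_le[of 0 x x] by simp

lemma gdist_eq_0_iff [simp]: "gdist adj x y = 0 \<longleftrightarrow> x = y"
  using gdist_walk[of x y] by auto

lemma walk_sym: "(adj ^^ n) x y \<Longrightarrow> (adj ^^ n) y x"
proof (induction n arbitrary: y)
  case (Suc n)
  then obtain z where "(adj ^^ n) x z" "adj z y" by auto
  then show ?case using Suc.IH adj_sym relpowp_Suc_I2[of adj y z n x] by blast
qed auto

lemma gdist_sym: "gdist adj x y = gdist adj y x"
  by (rule antisym; rule gdist_le; rule walk_sym; rule gdist_walk)

lemma gdist_adj: "adj x y \<Longrightarrow> gdist adj x z \<le> Suc (gdist adj y z)"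
  by (rule gdist_le, rule relpowp_Suc_I2[OF _ gdist_walk])

lemma closer_neighbour:
  assumes "x \<noteq> y"
  shows "\<exists>x'. adj x x' \<and> gdist adj x y = Suc (gdist adj x' y)"
proof -
  obtain n where n: "gdist adj x y = Suc n"
    using assms gdist_eq_0_iff not0_implies_Suc by blast
  then have "(adj ^^ Suc n) x y" using gdist_walk by metis
  then obtain x' where x': "adj x x'" "(adj ^^ n) x' y"
    by (meson relpowp_Suc_E2)
  then have "gdist adj x' y \<le> n" using gdist_le by blast
  then show ?thesis using gdist_adj[OF x'(1), of y] n x'(1) by auto
qed

text \<open>Descend towards \<open>z\<close> from \<open>x\<close> and from \<open>y\<close> at the same time until the two walks meet. Every level
strictly below \<open>n\<close> is used at most twice and by different vertices, hence nothing is repeated.\<close>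

lemma path_below:
  assumes "x \<noteq> y" "gdist adj x z = n" "gdist adj y z = n"
  shows "\<exists>xs. successively adj xs \<and> distinct xs \<and> 3 \<le> length xs \<and> hd xs = x \<and> last xs = y \<and>
     (\<forall>v\<in>set xs. gdist adj v z \<le> n)"
  using assms
proof (induction n arbitrary: x y)
  case 0
  then show ?case by simp
next
  case (Suc n)
  obtain x' where x': "adj x x'" "gdist adj x' z = n"
    using closer_neighbour[of x z] Suc.prems by force
  obtain y' where y': "adj y y'" "gdist adj y' z = n"
    using closer_neighbour[of y z] Suc.prems by force
  show ?case
  proof (cases "x' = y'")
    case True
    then have "successively adj [x, x', y]" "distinct [x, x', y]"
      using x' y' Suc.prems adj_sym by auto
    then show ?thesis using x' Suc.prems by (intro exI[of _ "[x, x', y]"]) auto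
  next
    case False
    then obtain xs where xs: "successively adj xs" "distinct xs" "3 \<le> length xs" "hd xs = x'"
        "last xs = y'" "\<forall>v\<in>set xs. gdist adj v z \<le> n"
      using Suc.IH x' y' by blast
    have "xs \<noteq> []" using xs(3) by auto
    then have "successively adj (x # xs @ [y])"
      using xs x' y' adj_sym by (simp add: successively_Cons successively_append_iff)
    moreover have "x \<notin> set xs" "y \<notin> set xs" using xs(6) Suc.prems by auto
    ultimately show ?thesis
      using xs Suc.prems by (intro exI[of _ "x # xs @ [y]"]) auto
  qed
qed

lemma no_closed_path:
  assumes "successively adj xs" "distinct xs" "3 \<le> length xs" "adj (last xs) (hd xs)"
  shows False
proof -
  have "xs \<noteq> []" using assms(3) by auto
  then have "graph_cycle adj xs"
    unfolding graph_cycle_def using assms successively_cyclic[of adj xs] by blast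
  then show False using acyclic by blast
qed

text \<open>Two adjacent vertices at equal distance from \<open>z\<close> would close a path below them to a cycle.\<close>

lemma adj_level:
  assumes "adj x y"
  shows "gdist adj x z = Suc (gdist adj y z) \<or> gdist adj y z = Suc (gdist adj x z)"
proof (rule ccontr)
  assume "\<not> ?thesis"
  then have eq: "gdist adj x z = gdist adj y z"
    using gdist_adj[OF assms, of z] gdist_adj[OF adj_sym[OF assms], of z] by linarith
  have "x \<noteq> y" using assms adj_irrefl by blast
  then obtain xs where "successively adj xs" "distinct xs" "3 \<le> length xs" "hd xs = x" "last xs = y"
    using path_below[of x y z] eq by metis
  then show False using no_closed_path assms adj_sym by metis
qed

text \<open>Two neighbours of \<open>x\<close> that are closer to \<open>z\<close> would be the ends of a path that \<open>x\<close> closes to a cycle.\<close>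

lemma closer_neighbour_unique:
  assumes "adj x y" "adj x y'" "gdist adj x z = Suc (gdist adj y z)" "gdist adj x z = Suc (gdist adj y' z)"
  shows "y = y'"
proof (rule ccontr)
  assume "y \<noteq> y'"
  then obtain xs where xs: "successively adj xs" "distinct xs" "3 \<le> length xs" "hd xs = y" "last xs = y'"
      "\<forall>v\<in>set xs. gdist adj v z \<le> gdist adj y z"
    using path_below[of y y' z "gdist adj y z"] assms by auto
  have "xs \<noteq> []" using xs(3) by auto
  have "x \<notin> set xs" using xs(6) assms(3) by auto
  then have "successively adj (x # xs)" "distinct (x # xs)" "3 \<le> length (x # xs)"
      "adj (last (x # xs)) (hd (x # xs))"
    using xs assms \<open>xs \<noteq> []\<close> adj_sym by (auto simp: successively_Cons)
  then show False using no_closed_path by blast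
qed

definition level :: "'v \<Rightarrow> nat" where
  "level x = gdist adj x x0"

definition parent :: "'v \<Rightarrow> 'v" where
  "parent x = (SOME y. adj x y \<and> level x = Suc (level y))"

lemma level_root [simp]: "level x0 = 0"
  by (simp add: level_def)

lemma level_eq_0_iff [simp]: "level x = 0 \<longleftrightarrow> x = x0"
  by (simp add: level_def)

lemma parent_props:
  assumes "x \<noteq> x0"
  shows "adj x (parent x)" "level x = Suc (level (parent x))"
proof -
  have "adj x (parent x) \<and> level x = Suc (level (parent x))"
    unfolding parent_def by (rule someI_ex) (use closer_neighbour[OF assms] in \<open>simp add: level_def\<close>)
  then show "adj x (parent x)" "level x = Suc (level (parent x))" by blast+
qed

lemma level_parent: "level (parent x) = level x - 1" if "x \<noteq> x0"
  using parent_props[OF that] by simp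

lemma parent_eqI:
  assumes "adj x y" "level x = Suc (level y)"
  shows "parent x = y"
proof -
  have "x \<noteq> x0" using assms(2) by auto
  note parent = parent_props[OF this]
  show ?thesis
    by (rule closer_neighbour_unique[OF parent(1) assms(1)
          parent(2)[unfolded level_def] assms(2)[unfolded level_def]])
qed

lemma adj_cases:
  assumes "adj x y"
  shows "x \<noteq> x0 \<and> y = parent x \<or> y \<noteq> x0 \<and> x = parent y"
proof -
  consider "level x = Suc (level y)" | "level y = Suc (level x)"
    using adj_level[OF assms, of x0] unfolding level_def by blast
  then show ?thesis
  proof cases
    case 1
    then have "parent x = y" "x \<noteq> x0" using parent_eqI[OF assms] by auto
    then show ?thesis by simp
  next
    case 2
    then have "parent y = x" "y \<noteq> x0" using parent_eqI[OF adj_sym[OF assms]] by auto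
    then show ?thesis by simp
  qed
qed

definition children :: "'v \<Rightarrow> 'v set" where
  "children x = {y. y \<noteq> x0 \<and> parent y = x}"

lemma neighbours_eq: "{y. adj x y} = children x \<union> (if x = x0 then {} else {parent x})"
proof (rule set_eqI)
  fix y
  have "adj x y" if "y \<in> children x"
    using that parent_props(1)[of y] adj_sym by (auto simp: children_def)
  moreover have "adj x (parent x)" if "x \<noteq> x0"
    using parent_props(1)[OF that] .
  ultimately show "y \<in> {y. adj x y} \<longleftrightarrow> y \<in> children x \<union> (if x = x0 then {} else {parent x})"
    using adj_cases[of x y] by (auto simp: children_def)
qed

lemma finite_children: "finite (children x)"
  using finite_neighbours[of x] unfolding neighbours_eq by (rule finite_subset[rotated]) blast

lemma card_children: "card (children x) = (if x = x0 then q + 1 else q)"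
proof -
  have "parent x \<notin> children x" if "x \<noteq> x0"
    using parent_props[OF that] parent_props[of "parent x"] by (auto simp: children_def)
  then show ?thesis
    using card_neighbours[of x] finite_children[of x] unfolding neighbours_eq by (auto split: if_splits)
qed

text \<open>A geodesic never turns back. Once it has left the direction of the root, the only neighbour at a lower
level is the vertex from which it came, so its level keeps increasing.\<close>

lemma away_from_root:
  assumes "adj x x'" "gdist adj x y = Suc (gdist adj x' y)" "level x' = Suc (level x)"
  shows "level x < level y"
  using assms
proof (induction "gdist adj x' y" arbitrary: x x')
  case 0
  then show ?case by simp
next
  case (Suc n)
  then have "x' \<noteq> y" by auto
  then obtain x'' where x'': "adj x' x''" "gdist adj x' y = Suc (gdist adj x'' y)"
    using closer_neighbour by blast
  have "parent x' = x" using parent_eqI adj_sym Suc.prems by blast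
  then have "x'' \<noteq> parent x'" using x'' Suc.prems by auto
  then have "level x'' = Suc (level x')"
    using adj_cases[OF x''(1)] parent_props by metis
  then have "level x' < level y" using Suc.hyps(1)[of x'' x'] x'' Suc.hyps(2) by simp
  then show ?case using Suc.prems by simp
qed

text \<open>By \<open>away_from_root\<close> a geodesic that begins with a child of \<open>x\<close> ends at a higher level than \<open>x\<close>.\<close>

lemma gdist_parent:
  assumes "x \<noteq> y" "level y \<le> level x"
  shows "x \<noteq> x0" "gdist adj x y = Suc (gdist adj (parent x) y)"
proof -
  show "x \<noteq> x0" using assms by auto
  obtain x' where x': "adj x x'" "gdist adj x y = Suc (gdist adj x' y)"
    using closer_neighbour assms by blast
  then have "level x' \<noteq> Suc (level x)" using away_from_root assms by fastforce
  then have "x' = parent x" using adj_cases[OF x'(1)] parent_props by metis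
  then show "gdist adj x y = Suc (gdist adj (parent x) y)" using x' by simp
qed

definition ancestor :: "nat \<Rightarrow> 'v \<Rightarrow> 'v" where
  "ancestor i x = (parent ^^ i) x"

lemma ancestor_0 [simp]: "ancestor 0 x = x"
  by (simp add: ancestor_def)

lemma ancestor_Suc: "ancestor (Suc i) x = ancestor i (parent x)"
  by (simp add: ancestor_def funpow_swap1)

lemma ancestor_add: "ancestor i (ancestor j x) = ancestor (i + j) x"
  by (simp add: ancestor_def funpow_add)

lemma level_ancestor: "i \<le> level x \<Longrightarrow> level (ancestor i x) = level x - i"
proof (induction i arbitrary: x)
  case (Suc i)
  then have "x \<noteq> x0" by auto
  then show ?case using Suc level_parent[of x] by (simp add: ancestor_Suc)
qed simp

text \<open>Applied to \<open>f\<close> at \<open>x\<close>, this kernel gives the sum over \<open>j\<close> of \<open>a j * f (ancestor j x)\<close>.\<close>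

definition ray_kernel :: "(nat \<Rightarrow> complex) \<Rightarrow> 'v \<Rightarrow> 'v \<Rightarrow> complex" where
  "ray_kernel a x z = (if level z \<le> level x \<and> ancestor (level x - level z) x = z
     then a (level x - level z) else 0)"

lemma ray_kernel_above: "level x < level z \<Longrightarrow> ray_kernel a x z = 0"
  by (simp add: ray_kernel_def)

lemma ray_kernel_parent:
  assumes "x \<noteq> x0" "z \<noteq> x"
  shows "ray_kernel a x z = ray_kernel (\<lambda>j. a (Suc j)) (parent x) z"
proof -
  have l: "level x = Suc (level (parent x))" using parent_props assms by blast
  show ?thesis
  proof (cases "level z = level x")
    case True
    then show ?thesis using assms l by (auto simp: ray_kernel_def)
  next
    case False
    then show ?thesis using l
      by (cases "level z \<le> level (parent x)") (auto simp: ray_kernel_def Suc_diff_le ancestor_Suc)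
  qed
qed

text \<open>The pairs \<open>(i, j)\<close> for which the \<open>i\<close>-th ancestor of \<open>y\<close> is the \<open>j\<close>-th ancestor of \<open>x\<close> correspond to
the common ancestors of \<open>x\<close> and \<open>y\<close>, and \<open>i + j\<close> grows by two from one common ancestor to the next one
towards the root. The second sum has \<open>i + j + 2\<close> in place of \<open>i + j\<close> and omits the root, so it cancels all
terms of the first one except that of the lowest common ancestor, for which \<open>i + j\<close> is the distance.
The induction replaces the vertex at the higher level by its parent.\<close>

lemma radial_kernel_confluent:
  "(\<Sum>i\<le>level y. ray_kernel (\<lambda>j. K (i + j)) x (ancestor i y))
    - (\<Sum>i<level y. ray_kernel (\<lambda>j. K (i + 2 + j)) x (ancestor i y)) = K (gdist adj x y)"
proof (induction "level x + level y" arbitrary: x y K rule: less_induct)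
  case less
  consider "x = y" | "x \<noteq> y" "level y \<le> level x" | "level x < level y" by linarith
  then show ?case
  proof cases
    case 1
    have anc: "ray_kernel a y (ancestor i y) = a i" if "i \<le> level y" for a i
      using that by (simp add: ray_kernel_def level_ancestor)
    have "(\<Sum>i\<le>level y. ray_kernel (\<lambda>j. K (i + j)) x (ancestor i y)) = (\<Sum>i\<le>level y. K (i + i))"
      using 1 by (intro sum.cong) (auto simp: anc)
    moreover have "(\<Sum>i<level y. ray_kernel (\<lambda>j. K (i + 2 + j)) x (ancestor i y))
        = (\<Sum>i<level y. K (Suc i + Suc i))"
      using 1 by (intro sum.cong) (auto simp: anc)
    ultimately show ?thesis
      using 1 by (simp add: lessThan_Suc_atMost[symmetric] sum.lessThan_Suc_shift del: sum.lessThan_Suc)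
  next
    case 2
    note x = gdist_parent[OF 2]
    have ne: "ancestor i y \<noteq> x" if "i \<le> level y" for i
      using level_ancestor[OF that] 2 that by (cases "i = 0") auto
    have eq: "ray_kernel a x (ancestor i y) = ray_kernel (\<lambda>j. a (Suc j)) (parent x) (ancestor i y)"
      if "i \<le> level y" for a i
      using ray_kernel_parent x(1) ne[OF that] by blast
    have "level (parent x) + level y < level x + level y" using parent_props[OF x(1)] by simp
    from less[OF this, of "\<lambda>n. K (Suc n)"] show ?thesis
      by (simp add: eq x(2))
  next
    case 3
    then have y: "y \<noteq> x0" by auto
    have l: "level y = Suc (level (parent y))" using parent_props[OF y] by blast
    have d: "gdist adj x y = Suc (gdist adj x (parent y))"
      using gdist_parent(2)[of y x] 3 by (auto simp: gdist_sym[of x])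
    have "level x + level (parent y) < level x + level y" using l by simp
    from less[OF this, of "\<lambda>n. K (Suc n)"] show ?thesis
      using 3 unfolding l sum.atMost_Suc_shift sum.lessThan_Suc_shift d
      by (simp add: ray_kernel_above ancestor_Suc l del: sum.atMost_Suc sum.lessThan_Suc)
  qed
qed

definition sphere_at :: "nat \<Rightarrow> 'v set" where
  "sphere_at l = {x. level x = l}"

definition descendants :: "nat \<Rightarrow> 'v \<Rightarrow> 'v set" where
  "descendants i z = {y. i \<le> level y \<and> ancestor i y = z}"

lemma descendants_0: "descendants 0 z = {z}"
  by (auto simp: descendants_def)

lemma descendants_Suc: "descendants (Suc i) z = (\<Union>y\<in>descendants i z. children y)"
proof (rule set_eqI)
  fix w
  show "w \<in> descendants (Suc i) z \<longleftrightarrow> w \<in> (\<Union>y\<in>descendants i z. children y)"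
  proof (cases "w = x0")
    case False
    have "level w = Suc (level (parent w))" using parent_props[OF False] by blast
    then show ?thesis using False
      by (simp add: descendants_def children_def ancestor_Suc)
  qed (auto simp: descendants_def children_def)
qed

lemma finite_descendants: "finite (descendants i z)"
  by (induction i) (auto simp: descendants_0 descendants_Suc finite_children)

lemma card_descendants_Suc: "card (descendants (Suc i) z) = (\<Sum>y\<in>descendants i z. card (children y))"
  unfolding descendants_Suc
proof (rule card_UN_disjoint)
  show "\<forall>x\<in>descendants i z. \<forall>y\<in>descendants i z. x \<noteq> y \<longrightarrow> children x \<inter> children y = {}"
    by (auto simp: children_def)
qed (auto simp: finite_descendants finite_children)

lemma level_descendants: "y \<in> descendants i z \<Longrightarrow> level y = level z + i"
  using level_ancestor[of i y] unfolding descendants_def by fastforce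

lemma card_descendants: "z \<noteq> x0 \<Longrightarrow> card (descendants i z) = q ^ i"
proof (induction i)
  case (Suc i)
  have "card (children y) = q" if "y \<in> descendants i z" for y
    using level_descendants[OF that] Suc.prems by (auto simp: card_children)
  then show ?case using Suc by (simp add: card_descendants_Suc)
qed (simp add: descendants_0)

lemma card_descendants_root: "card (descendants (Suc i) x0) = (q + 1) * q ^ i"
proof (induction i)
  case 0
  show ?case unfolding card_descendants_Suc by (simp add: descendants_0 card_children)
next
  case (Suc i)
  have "card (children y) = q" if "y \<in> descendants (Suc i) x0" for y
    using level_descendants[OF that] by (auto simp: card_children)
  then have "card (descendants (Suc (Suc i)) x0) = card (descendants (Suc i) x0) * q"
    by (subst card_descendants_Suc) simp
  then show ?case using Suc.IH by (simp add: algebra_simps)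
qed

lemma card_descendants_le: "card (descendants i z) \<le> 2 * q ^ i"
proof (cases "z = x0")
  case True
  have "card (descendants (Suc i) x0) \<le> 2 * q ^ Suc i" for i
    unfolding card_descendants_root using q2 by simp
  then show ?thesis using True by (cases i) (auto simp: descendants_0)
qed (simp add: card_descendants)

lemma card_descendants_ge: "q ^ i \<le> card (descendants i z)"
proof (cases "z = x0")
  case True
  have "q ^ Suc i \<le> card (descendants (Suc i) x0)" for i
    unfolding card_descendants_root by simp
  then show ?thesis using True by (cases i) (auto simp: descendants_0)
qed (simp add: card_descendants)

lemma sphere_at_eq: "sphere_at l = descendants l x0"
proof -
  have "ancestor l y = x0" if "level y = l" for y
    using level_ancestor[of l y] that by simp
  moreover have "level y = l" if "y \<in> descendants l x0" for y
    using level_descendants[OF that] by simp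
  ultimately show ?thesis unfolding sphere_at_def descendants_def by blast
qed

lemma finite_sphere_at: "finite (sphere_at l)"
  by (simp add: sphere_at_eq finite_descendants)

lemma card_sphere_at: "l \<noteq> 0 \<Longrightarrow> card (sphere_at l) = (q + 1) * q ^ (l - 1)"
  by (cases l) (auto simp: sphere_at_eq card_descendants_root)

lemma sphere_at_nonempty: "sphere_at l \<noteq> {}"
proof -
  have "0 < q ^ l" using q2 by simp
  then have "card (sphere_at l) \<noteq> 0"
    using card_descendants_ge[of l x0] unfolding sphere_at_eq by linarith
  then show ?thesis by auto
qed

text \<open>Summation over the fibres of \<open>ancestor i\<close>.\<close>

lemma sum_over_descendants:
  "(\<Sum>y\<in>sphere_at (l + i). g (ancestor i y)) = (\<Sum>z\<in>sphere_at l. of_nat (card (descendants i z)) * g z)"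
  for g :: "'v \<Rightarrow> 'a::comm_semiring_1"
proof -
  have sub: "ancestor i ` sphere_at (l + i) \<subseteq> sphere_at l"
    using level_ancestor by (auto simp: sphere_at_def)
  have "(\<Sum>y\<in>sphere_at (l + i). g (ancestor i y))
      = (\<Sum>z\<in>sphere_at l. \<Sum>y | y \<in> sphere_at (l + i) \<and> ancestor i y = z. g (ancestor i y))"
    by (rule sum.group[OF finite_sphere_at finite_sphere_at sub, symmetric])
  also have "\<dots> = (\<Sum>z\<in>sphere_at l. \<Sum>y\<in>descendants i z. g z)"
  proof (rule sum.cong[OF refl])
    fix z assume "z \<in> sphere_at l"
    then have "y \<in> sphere_at (l + i)" if "y \<in> descendants i z" for y
      using level_descendants[OF that] by (simp add: sphere_at_def)
    then have "{y. y \<in> sphere_at (l + i) \<and> ancestor i y = z} = descendants i z"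
      unfolding sphere_at_def descendants_def by auto
    then show "(\<Sum>y | y \<in> sphere_at (l + i) \<and> ancestor i y = z. g (ancestor i y)) = (\<Sum>y\<in>descendants i z. g z)"
      by (intro sum.cong) (auto simp: descendants_def)
  qed
  finally show ?thesis by simp
qed

section \<open>From the tree to the integers\<close>

lemma sum_sphere_ray_kernel:
  assumes "level x = l"
  shows "(\<Sum>z\<in>sphere_at k. c z * ray_kernel a x z) = (if k \<le> l then c (ancestor (l - k) x) * a (l - k) else 0)"
proof (cases "k \<le> l")
  case True
  have "ancestor (l - k) x \<in> sphere_at k"
    using True assms level_ancestor[of "l - k" x] by (simp add: sphere_at_def)
  moreover have "c z * ray_kernel a x z = (if z = ancestor (l - k) x then c z * a (l - k) else 0)"
    if "z \<in> sphere_at k" for z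
    using that True assms by (auto simp: ray_kernel_def sphere_at_def)
  ultimately show ?thesis
    using True finite_sphere_at by simp
next
  case False
  then show ?thesis
    using assms by (auto simp: ray_kernel_def sphere_at_def intro!: sum.neutral)
qed

lemma sum_sphere_ancestor_ray_kernel:
  assumes "level x = l" "i \<le> l'"
  shows "(\<Sum>y\<in>sphere_at l'. ray_kernel a x (ancestor i y))
    = (if l' - i \<le> l then of_nat (card (descendants i (ancestor (l - (l' - i)) x))) * a (l - (l' - i)) else 0)"
  using sum_over_descendants[of "ray_kernel a x" i "l' - i"] assms(2)
    sum_sphere_ray_kernel[OF assms(1), of "\<lambda>z. of_nat (card (descendants i z))" a "l' - i"]
  by simp

text \<open>The index \<open>t\<close> is the level of the common ancestor, as seen from a vertex at level \<open>l\<close>.\<close>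

definition sphere_sum :: "(nat \<Rightarrow> complex) \<Rightarrow> nat \<Rightarrow> nat \<Rightarrow> complex" where
  "sphere_sum K l l' = of_nat (card (sphere_at l')) * K (l + l')
    + (\<Sum>t\<in>{1..min l l'}. of_nat (q ^ (l' - t)) * (K (l + l' - 2 * t) - K (l + l' - 2 * t + 2)))"

text \<open>In \<open>radial_kernel_confluent\<close> the ancestor \<open>ancestor i y\<close> has level \<open>t = l' - i\<close> and contributes only if
it is the ancestor of \<open>x\<close> at that level, which it is for as many \<open>y\<close> as that vertex has descendants.\<close>

lemma sum_sphere_radial:
  fixes K :: "nat \<Rightarrow> complex"
  assumes l: "level x = l"
  shows "(\<Sum>y\<in>sphere_at l'. K (gdist adj x y)) = sphere_sum K l l'"
proof -
  define N :: "nat \<Rightarrow> complex" where "N t = of_nat (card (descendants (l' - t) (ancestor (l - t) x)))" for t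
  have split: "{..min l l'} = insert 0 {1..min l l'}" by auto
  have anc: "card (descendants (l' - t) (ancestor (l - t) x)) = q ^ (l' - t)" if "t \<in> {1..min l l'}" for t
  proof -
    have "level (ancestor (l - t) x) = t" using that l level_ancestor[of "l - t" x] by simp
    then have "ancestor (l - t) x \<noteq> x0" using that level_root by fastforce
    then show ?thesis by (rule card_descendants)
  qed
  have anc0: "ancestor l x = x0" using level_ancestor[of l x] l by simp
  have "(\<Sum>y\<in>sphere_at l'. K (gdist adj x y))
      = (\<Sum>y\<in>sphere_at l'. (\<Sum>i\<le>l'. ray_kernel (\<lambda>j. K (i + j)) x (ancestor i y))
        - (\<Sum>i<l'. ray_kernel (\<lambda>j. K (i + 2 + j)) x (ancestor i y)))"
    by (intro sum.cong refl, subst radial_kernel_confluent[symmetric]) (simp add: sphere_at_def)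
  also have "\<dots> = (\<Sum>i\<le>l'. \<Sum>y\<in>sphere_at l'. ray_kernel (\<lambda>j. K (i + j)) x (ancestor i y))
      - (\<Sum>i<l'. \<Sum>y\<in>sphere_at l'. ray_kernel (\<lambda>j. K (i + 2 + j)) x (ancestor i y))"
    unfolding sum_subtractf by (subst (1 2) sum.swap) simp
  also have "(\<Sum>i\<le>l'. \<Sum>y\<in>sphere_at l'. ray_kernel (\<lambda>j. K (i + j)) x (ancestor i y))
      = (\<Sum>i\<le>l'. if l' - i \<le> l then N (l' - i) * K (i + (l - (l' - i))) else 0)"
    by (intro sum.cong refl) (simp add: sum_sphere_ancestor_ray_kernel[OF l] N_def)
  also have "\<dots> = (\<Sum>t\<le>l'. if t \<le> l then N t * K (l' - t + (l - t)) else 0)"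
    by (rule sum.reindex_bij_witness[of _ "\<lambda>t. l' - t" "\<lambda>i. l' - i"]) auto
  also have "\<dots> = (\<Sum>t\<in>{..min l l'}. N t * K (l' - t + (l - t)))"
    by (intro sum.mono_neutral_cong_right) auto
  also have "\<dots> = of_nat (card (sphere_at l')) * K (l + l')
      + (\<Sum>t\<in>{1..min l l'}. N t * K (l' - t + (l - t)))"
    unfolding split by (subst sum.insert) (auto simp: N_def anc0 sphere_at_eq add.commute)
  also have "(\<Sum>t\<in>{1..min l l'}. N t * K (l' - t + (l - t)))
      = (\<Sum>t\<in>{1..min l l'}. of_nat (q ^ (l' - t)) * K (l + l' - 2 * t))"
  proof (rule sum.cong[OF refl])
    fix t assume t: "t \<in> {1..min l l'}"
    then have "l' - t + (l - t) = l + l' - 2 * t" by auto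
    then show "N t * K (l' - t + (l - t))
        = of_nat (q ^ (l' - t)) * K (l + l' - 2 * t)" using anc[OF t] by (simp add: N_def)
  qed
  also have "(\<Sum>i<l'. \<Sum>y\<in>sphere_at l'. ray_kernel (\<lambda>j. K (i + 2 + j)) x (ancestor i y))
      = (\<Sum>i<l'. if l' - i \<le> l then N (l' - i) * K (i + 2 + (l - (l' - i))) else 0)"
    by (intro sum.cong refl) (simp add: sum_sphere_ancestor_ray_kernel[OF l] N_def)
  also have "\<dots> = (\<Sum>t\<in>{1..l'}. if t \<le> l then N t * K (l' - t + 2 + (l - t)) else 0)"
    by (rule sum.reindex_bij_witness[of _ "\<lambda>t. l' - t" "\<lambda>i. l' - i"]) auto
  also have "\<dots> = (\<Sum>t\<in>{1..min l l'}. N t * K (l' - t + 2 + (l - t)))"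
    by (intro sum.mono_neutral_cong_right) auto
  also have "\<dots> = (\<Sum>t\<in>{1..min l l'}. of_nat (q ^ (l' - t)) * K (l + l' - 2 * t + 2))"
  proof (rule sum.cong[OF refl])
    fix t assume t: "t \<in> {1..min l l'}"
    then have "l' - t + 2 + (l - t) = l + l' - 2 * t + 2" by auto
    then show "N t * K (l' - t + 2 + (l - t))
        = of_nat (q ^ (l' - t)) * K (l + l' - 2 * t + 2)" using anc[OF t] by (simp add: N_def)
  qed
  finally show ?thesis
    by (simp add: sphere_sum_def sum_subtractf right_diff_distrib)
qed

lemma sum_over_levels:
  assumes "finite A"
  shows "(\<Sum>x\<in>(\<Union>a\<in>A. sphere_at (Suc a)). h x) = (\<Sum>a\<in>A. \<Sum>x\<in>sphere_at (Suc a). h x)"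
  using assms by (intro sum.UNION_disjoint) (auto simp: finite_sphere_at, auto simp: sphere_at_def)

text \<open>The action of a radial kernel on functions of the level, normalised so that a function \<open>f\<close> of the level
corresponds to \<open>q powr (- level y / p) * f (level y - 1)\<close>. The root is left out because its sphere is the only
one whose cardinality differs from \<open>(1 + 1 / q) * q ^ l\<close>.\<close>

definition level_kernel :: "real \<Rightarrow> (nat \<Rightarrow> complex) \<Rightarrow> nat \<Rightarrow> nat \<Rightarrow> complex" where
  "level_kernel p K a c = of_real (real q powr ((real a - real c) / p)) * sphere_sum K (Suc a) (Suc c)"

text \<open>Passing from functions of the level to functions on the tree multiplies the \<open>p\<close>-th power of every norm by
the same factor \<open>w\<close>.\<close>

lemma kernel_bound_level_functions:
  assumes p: "1 \<le> p" and \<kappa>: "kernel_bound p (\<lambda>x y. K (gdist adj x y)) B"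
  shows "kernel_bound p (level_kernel p K) B"
proof (rule kernel_boundI)
  fix A C :: "nat set" and f :: "nat \<Rightarrow> complex"
  assume fin: "finite A" "finite C"
  define U where "U A = (\<Union>a\<in>A. sphere_at (Suc a))" for A
  have finU: "finite (U A)" if "finite A" for A using that by (simp add: U_def finite_sphere_at)
  define g where "g y = of_real (real q powr (- real (level y) / p)) * f (level y - 1)" for y
  define w where "w = (real q + 1) / real q"
  have w: "0 < w" using q2 by (simp add: w_def)
  have card: "real (card (sphere_at (Suc a))) * real q powr (- real (Suc a)) = w" for a
    unfolding powr_neg_nat using q2 by (simp add: card_sphere_at w_def field_simps)
  have inner: "(\<Sum>y\<in>U C. K (gdist adj x y) * g y)
      = of_real (real q powr (- real (Suc a) / p)) * (\<Sum>c\<in>C. level_kernel p K a c * f c)"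
    if x: "x \<in> sphere_at (Suc a)" for a x
  proof -
    have "(\<Sum>y\<in>U C. K (gdist adj x y) * g y) = (\<Sum>c\<in>C. \<Sum>y\<in>sphere_at (Suc c). K (gdist adj x y) * g y)"
      unfolding U_def by (rule sum_over_levels[OF fin(2)])
    also have "\<dots> = (\<Sum>c\<in>C. sphere_sum K (Suc a) (Suc c) * (of_real (real q powr (- real (Suc c) / p)) * f c))"
    proof (rule sum.cong[OF refl])
      fix c
      have "(\<Sum>y\<in>sphere_at (Suc c). K (gdist adj x y) * g y)
          = (\<Sum>y\<in>sphere_at (Suc c). K (gdist adj x y) * (of_real (real q powr (- real (Suc c) / p)) * f c))"
        by (intro sum.cong) (auto simp: g_def sphere_at_def)
      then show "(\<Sum>y\<in>sphere_at (Suc c). K (gdist adj x y) * g y)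
          = sphere_sum K (Suc a) (Suc c) * (of_real (real q powr (- real (Suc c) / p)) * f c)"
        using x sum_sphere_radial[of x "Suc a" K "Suc c"]
        by (simp add: sphere_at_def sum_distrib_right[symmetric] del: of_nat_Suc)
    qed
    also have "\<dots> = of_real (real q powr (- real (Suc a) / p)) * (\<Sum>c\<in>C. level_kernel p K a c * f c)"
      unfolding sum_distrib_left
    proof (rule sum.cong[OF refl])
      fix c
      have "real q powr (- real (Suc c) / p) = real q powr (- real (Suc a) / p) * real q powr ((real a - real c) / p)"
        using q2 p by (simp add: field_simps flip: powr_add add_divide_distrib)
      then have "complex_of_real (real q powr (- real (Suc c) / p)) = of_real (real q powr (- real (Suc a) / p)) * of_real (real q powr ((real a - real c) / p))"
        by simp
      then show "sphere_sum K (Suc a) (Suc c) * (of_real (real q powr (- real (Suc c) / p)) * f c)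
          = of_real (real q powr (- real (Suc a) / p)) * (level_kernel p K a c * f c)"
        unfolding level_kernel_def by (simp only: mult_ac)
    qed
    finally show ?thesis .
  qed
  have out: "(\<Sum>x\<in>U A. norm (\<Sum>y\<in>U C. K (gdist adj x y) * g y) powr p)
      = w * (\<Sum>a\<in>A. norm (\<Sum>c\<in>C. level_kernel p K a c * f c) powr p)"
    (is "?L = w * (\<Sum>a\<in>A. norm (?s a) powr p)")
  proof -
    have "?L = (\<Sum>a\<in>A. \<Sum>x\<in>sphere_at (Suc a). norm (\<Sum>y\<in>U C. K (gdist adj x y) * g y) powr p)"
      by (subst (1) U_def) (rule sum_over_levels[OF fin(1)])
    also have "\<dots> = (\<Sum>a\<in>A. \<Sum>x\<in>sphere_at (Suc a). real q powr (- real (Suc a)) * norm (?s a) powr p)"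
    proof (intro sum.cong refl)
      fix a x assume "x \<in> sphere_at (Suc a)"
      then show "norm (\<Sum>y\<in>U C. K (gdist adj x y) * g y) powr p = real q powr (- real (Suc a)) * norm (?s a) powr p"
        using p by (simp add: inner norm_mult powr_mult powr_powr del: of_nat_Suc)
    qed
    also have "\<dots> = (\<Sum>a\<in>A. (real (card (sphere_at (Suc a))) * real q powr (- real (Suc a))) * norm (?s a) powr p)"
      by (simp add: mult.assoc del: of_nat_Suc)
    finally show ?thesis unfolding card sum_distrib_left .
  qed
  have inp: "(\<Sum>y\<in>U C. norm (g y) powr p) = w * (\<Sum>c\<in>C. norm (f c) powr p)"
  proof -
    have "(\<Sum>y\<in>U C. norm (g y) powr p) = (\<Sum>c\<in>C. \<Sum>y\<in>sphere_at (Suc c). norm (g y) powr p)"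
      unfolding U_def by (rule sum_over_levels[OF fin(2)])
    also have "\<dots> = (\<Sum>c\<in>C. \<Sum>y\<in>sphere_at (Suc c). real q powr (- real (Suc c)) * norm (f c) powr p)"
      using p by (intro sum.cong refl) (auto simp: g_def sphere_at_def norm_mult powr_mult powr_powr)
    also have "\<dots> = (\<Sum>c\<in>C. (real (card (sphere_at (Suc c))) * real q powr (- real (Suc c))) * norm (f c) powr p)"
      by (simp add: mult.assoc del: of_nat_Suc)
    finally show ?thesis unfolding card sum_distrib_left .
  qed
  have "w * (\<Sum>a\<in>A. norm (\<Sum>c\<in>C. level_kernel p K a c * f c) powr p)
      \<le> B powr p * (w * (\<Sum>c\<in>C. norm (f c) powr p))"
    using kernel_boundD[OF \<kappa> finU[OF fin(1)] finU[OF fin(2)], of g] unfolding out inp .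
  then have "w * (\<Sum>a\<in>A. norm (\<Sum>c\<in>C. level_kernel p K a c * f c) powr p)
      \<le> w * (B powr p * (\<Sum>c\<in>C. norm (f c) powr p))" by (simp only: mult.left_commute)
  then show "(\<Sum>a\<in>A. norm (\<Sum>c\<in>C. level_kernel p K a c * f c) powr p)
      \<le> B powr p * (\<Sum>c\<in>C. norm (f c) powr p)"
    using w by (simp only: mult_le_cancel_left_pos)
qed (use kernel_bound_nonneg[OF \<kappa>] in auto)

text \<open>The image of the unit mass at the root has absolute value \<open>norm (K n)\<close> on at least \<open>q ^ n\<close> points.\<close>

lemma radial_kernel_decay:
  assumes p: "1 \<le> p" and \<kappa>: "kernel_bound p (\<lambda>x y. K (gdist adj x y)) B"
  shows "norm (K n) \<le> B * real q powr (- real n / p)"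
proof (rule powr_le_cancel)
  have B: "0 \<le> B" by (rule kernel_bound_nonneg[OF \<kappa>])
  have "real (q ^ n) * norm (K n) powr p \<le> (\<Sum>x\<in>sphere_at n. norm (K n) powr p)"
    using card_descendants_ge[of n x0] by (simp add: sphere_at_eq mult_right_mono del: of_nat_power)
  also have "\<dots> = (\<Sum>x\<in>sphere_at n. norm (\<Sum>y\<in>{x0}. K (gdist adj x y) * 1) powr p)"
    by (intro sum.cong) (auto simp: sphere_at_def level_def)
  also have "\<dots> \<le> B powr p * (\<Sum>y\<in>{x0}. norm (1::complex) powr p)"
    by (rule kernel_boundD[OF \<kappa> finite_sphere_at]) simp
  finally have "real (q ^ n) * norm (K n) powr p \<le> B powr p" by simp
  moreover have "(B * real q powr (- real n / p)) powr p = B powr p * real q powr (- real n)"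
    using p by (simp add: powr_mult powr_powr)
  then have eq: "(B * real q powr (- real n / p)) powr p = B powr p / real (q ^ n)"
    unfolding powr_neg_nat by (simp add: divide_inverse)
  moreover have "0 < real (q ^ n)" using q2 by simp
  ultimately show "norm (K n) powr p \<le> (B * real q powr (- real n / p)) powr p"
    unfolding eq by (simp add: pos_le_divide_eq mult.commute del: of_nat_power)
  show "0 \<le> B * real q powr (- real n / p)" using B by simp
qed (use p in auto)

text \<open>Counted downwards from the lower of the two levels, the terms do not depend on the height at which the
two levels lie. Here \<open>e\<close> is the difference of the levels and \<open>e'\<close> its positive part.\<close>

lemma sphere_sum_alt:
  fixes K :: "nat \<Rightarrow> complex"
  assumes "l + l' = e + 2 * \<mu>" "l' = e' + \<mu>" "\<mu> = min l l'"
  shows "sphere_sum K l l' = of_nat (card (sphere_at l')) * K (l + l')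
    + (\<Sum>j<\<mu>. of_nat (q ^ (e' + j)) * (K (e + 2 * j) - K (e + 2 * j + 2)))"
proof -
  have "(\<Sum>t\<in>{1..\<mu>}. of_nat (q ^ (l' - t)) * (K (l + l' - 2 * t) - K (l + l' - 2 * t + 2)))
      = (\<Sum>j<\<mu>. of_nat (q ^ (e' + j)) * (K (e + 2 * j) - K (e + 2 * j + 2)))"
  proof (rule sum.reindex_bij_witness[of _ "\<lambda>j. \<mu> - j" "\<lambda>t. \<mu> - t"])
    fix t assume t: "t \<in> {1..\<mu>}"
    have "e' + (\<mu> - t) = l' - t" "e + 2 * (\<mu> - t) = l + l' - 2 * t"
      using t assms(1,2) unfolding atLeastAtMost_iff by arith+
    then show "of_nat (q ^ (e' + (\<mu> - t))) * (K (e + 2 * (\<mu> - t)) - K (e + 2 * (\<mu> - t) + 2))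
        = of_nat (q ^ (l' - t)) * (K (l + l' - 2 * t) - K (l + l' - 2 * t + 2))"
      by (simp only:)
  qed auto
  then show ?thesis
    unfolding sphere_sum_def assms(3)[symmetric] by (simp only:)
qed

text \<open>Translating the integers by \<open>M\<close> into the levels of the tree, one obtains a kernel of norm at most \<open>B\<close>
for every \<open>M\<close>. As \<open>M\<close> grows, the sum over the common ancestors becomes an infinite series, which is the
difference of two tails of \<open>q powr (n / 2) * K n\<close>, and the exceptional contribution of the root tends to \<open>0\<close>.\<close>

theorem abel_transform_bound:
  fixes K :: "nat \<Rightarrow> complex"
  assumes p: "1 \<le> p" "p < 2" and \<kappa>: "kernel_bound p (\<lambda>x y. K (gdist adj x y)) B"
  defines "b \<equiv> tail_sum (\<lambda>n. of_real (real q powr (real n / 2)) * K n)"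
  shows "kernel_bound p (\<lambda>n m. boundary_coeff (1 / p - 1 / 2) b (n - m)) B"
proof -
  define a where "a n = of_real (real q powr (real n / 2)) * K n" for n
  define d where "d = 1 / p - 1 / 2"
  define r where "r = real q powr (- d)"
  have d: "0 < d" using p by (simp add: d_def field_simps)
  have r: "0 < r" "r < 1" using q2 d by (auto simp: r_def intro!: powr_less_one)
  have ar: "norm (a n) \<le> B * r ^ n" for n
    unfolding a_def r_def d_def by (intro half_power_decay radial_kernel_decay[OF p(1) \<kappa>])
  have ab: "(\<lambda>j. a (n + 2 * j)) sums b n" for n
    unfolding b_def a_def[symmetric] by (rule tail_sum_sums[OF r ar])
  note level = kernel_bound_level_functions[OF p(1) \<kappa>]
  define \<kappa>M where "\<kappa>M M n m = (if n \<in> {- int M..} \<and> m \<in> {- int M..} then level_kernel p K (nat (n + int M)) (nat (m + int M)) else 0)"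
    for M n m
  have "kernel_bound p (\<kappa>M M) B" for M
    unfolding \<kappa>M_def by (rule kernel_bound_reindex_on[OF level]) (auto simp: inj_on_def)
  moreover have "(\<lambda>M. \<kappa>M M n m) \<longlonglongrightarrow> boundary_coeff (1 / p - 1 / 2) b (n - m)" for n m
  proof -
    \<comment> \<open>\<open>l\<close> and \<open>l'\<close> are the two levels, \<open>\<mu>\<close> is the smaller one, \<open>X\<close> the contribution of the root\<close>
    define e where "e = nat \<bar>n - m\<bar>"
    define e' where "e' = nat (m - n)"
    define l l' \<mu> where "l M = Suc (nat (n + int M))" and "l' M = Suc (nat (m + int M))"
      and "\<mu> M = Suc (nat (min n m + int M))" for M
    define c where "c = real q powr (real e' - real e / 2)"
    define X where "X M = of_nat (card (sphere_at (l' M))) * K (l M + l' M)" for M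
    define P where "P J = (\<Sum>j<J. a (e + 2 * j) - a (e + 2 + 2 * j) / of_nat q)" for J
    have ee: "real e' - real e / 2 = of_int (m - n) / 2"
      by (cases "n \<le> m") (auto simp: e_def e'_def field_simps)
    have ev: "\<forall>\<^sub>F M in sequentially. - n \<le> int M \<and> - m \<le> int M"
      using eventually_ge_at_top[of "nat (max (- n) (- m))"] by eventually_elim auto
    have eq: "\<kappa>M M n m = of_real (real q powr (of_int (n - m) / p)) * (X M + of_real c * P (\<mu> M))"
      if M: "- n \<le> int M" "- m \<le> int M" for M
    proof -
      have "l M + l' M = e + 2 * \<mu> M" "l' M = e' + \<mu> M" "\<mu> M = min (l M) (l' M)"
        using M by (auto simp: l_def l'_def \<mu>_def e_def e'_def min_def)
      note alt = sphere_sum_alt[OF this, of K]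
      have summand: "of_nat (q ^ (e' + j)) * (K (e + 2 * j) - K (e + 2 * j + 2))
          = of_real c * (a (e + 2 * j) - a (e + 2 + 2 * j) / of_nat q)" for j
      proof -
        have 1: "real (q ^ (e' + j)) = c * real q powr (real (e + 2 * j) / 2)"
        proof -
          have "c * real q powr (real (e + 2 * j) / 2) = real q powr (real e' - real e / 2 + real (e + 2 * j) / 2)"
            by (simp only: c_def powr_add)
          also have "real e' - real e / 2 + real (e + 2 * j) / 2 = real (e' + j)"
            by (simp add: field_simps)
          finally show ?thesis
            using powr_realpow[of "real q" "e' + j"] q2 by (simp del: of_nat_add)
        qed
        have 2: "real (q ^ (e' + j)) = c * (real q powr (real (e + 2 + 2 * j) / 2) / real q)"
        proof -
          have "real (e + 2 + 2 * j) / 2 = real (e + 2 * j) / 2 + 1" by simp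
          then have "real q powr (real (e + 2 + 2 * j) / 2) = real q powr (real (e + 2 * j) / 2) * real q"
            using q2 by (simp only: powr_add powr_one)
          then show ?thesis unfolding 1 using q2 by simp
        qed
        have "of_nat (q ^ (e' + j)) * K (e + 2 * j) = of_real c * a (e + 2 * j)"
        proof -
          have "complex_of_nat (q ^ (e' + j)) = of_real (real (q ^ (e' + j)))" by simp
          then show ?thesis unfolding 1 a_def by simp
        qed
        moreover have "of_nat (q ^ (e' + j)) * K (e + 2 + 2 * j) = of_real c * (a (e + 2 + 2 * j) / of_nat q)"
        proof -
          have "complex_of_nat (q ^ (e' + j)) = of_real (real (q ^ (e' + j)))" by simp
          then show ?thesis unfolding 2 a_def by simp
        qed
        moreover have "e + 2 * j + 2 = e + 2 + 2 * j" by simp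
        ultimately show ?thesis by (simp only: right_diff_distrib)
      qed
      have "\<kappa>M M n m = of_real (real q powr (of_int (n - m) / p)) * sphere_sum K (l M) (l' M)"
        using M by (simp add: \<kappa>M_def level_kernel_def l_def l'_def)
      then show ?thesis
        unfolding alt summand by (simp only: X_def P_def sum_distrib_left)
    qed
    have "P \<longlonglongrightarrow> b e - b (e + 2) / of_nat q"
      using sums_diff[OF ab[of e] sums_divide[OF ab[of "e + 2"], of "of_nat q"]]
      unfolding sums_def P_def[abs_def] .
    moreover have "filterlim \<mu> at_top sequentially"
      unfolding filterlim_at_top
    proof
      fix Z
      show "\<forall>\<^sub>F M in sequentially. Z \<le> \<mu> M"
        using eventually_ge_at_top[of "Z + nat (- min n m)"] by eventually_elim (auto simp: \<mu>_def)
    qed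
    ultimately have P: "(\<lambda>M. P (\<mu> M)) \<longlonglongrightarrow> b e - b (e + 2) / of_nat q"
      by (rule filterlim_compose)
    have X: "X \<longlonglongrightarrow> 0"
    proof (rule Lim_null_comparison)
      \<comment> \<open>a sphere of radius about \<open>M\<close> against the decay of \<open>K\<close> at about \<open>2 * M\<close>\<close>
      define s where "s = real q powr (1 - 2 / p)"
      have s: "0 < s" "s < 1" using q2 p by (auto simp: s_def field_simps intro!: powr_less_one)
      define C where "C = 2 * B * real q powr (of_int m + 1 - of_int (n + m + 2) / p)"
      show "(\<lambda>M. C * s ^ M) \<longlonglongrightarrow> 0"
        using s by (intro tendsto_mult_right_zero LIMSEQ_power_zero) auto
      show "\<forall>\<^sub>F M in sequentially. norm (X M) \<le> C * s ^ M"
        using ev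
      proof eventually_elim
        case (elim M)
        have l: "real (l M) = of_int n + real M + 1" "real (l' M) = of_int m + real M + 1"
          using elim by (auto simp: l_def l'_def)
        have "norm (X M) = real (card (sphere_at (l' M))) * norm (K (l M + l' M))"
          by (simp add: X_def norm_mult)
        also have "\<dots> \<le> (2 * real q ^ l' M) * (B * real q powr (- real (l M + l' M) / p))"
        proof (intro mult_mono radial_kernel_decay[OF p(1) \<kappa>])
          have "real (card (sphere_at (l' M))) \<le> real (2 * q ^ l' M)"
            using card_descendants_le[of "l' M" x0] unfolding sphere_at_eq of_nat_le_iff .
          then show "real (card (sphere_at (l' M))) \<le> 2 * real q ^ l' M" by simp
        qed auto
        also have "\<dots> = 2 * B * (real q powr real (l' M) * real q powr (- real (l M + l' M) / p))"
          using q2 by (simp add: powr_realpow)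
        also have "\<dots> = 2 * B * real q powr (real (l' M) + - real (l M + l' M) / p)"
          by (simp only: powr_add)
        also have "real (l' M) + - real (l M + l' M) / p
            = (of_int m + 1 - of_int (n + m + 2) / p) + (1 - 2 / p) * real M"
          using p unfolding of_nat_add l by (simp add: field_simps)
        also have "2 * B * real q powr \<dots> = C * s ^ M"
          using q2 by (simp add: C_def s_def powr_add powr_powr flip: powr_realpow)
        finally show ?case .
      qed
    qed
    have "(\<lambda>M. of_real (real q powr (of_int (n - m) / p)) * (X M + of_real c * P (\<mu> M)))
        \<longlonglongrightarrow> of_real (real q powr (of_int (n - m) / p)) * (0 + of_real c * (b e - b (e + 2) / of_nat q))"
      by (intro tendsto_intros X P)
    moreover have "real q powr (of_int (n - m) / p) * c = real q powr ((1 / p - 1 / 2) * of_int (n - m))"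
    proof -
      have "of_int (n - m) / p + of_int (m - n) / 2 = (1 / p - 1 / 2) * of_int (n - m)"
        using p by (simp add: field_simps)
      then show ?thesis unfolding c_def ee by (simp only: powr_add[symmetric])
    qed
    then have "complex_of_real (real q powr (of_int (n - m) / p)) * of_real c = of_real (real q powr ((1 / p - 1 / 2) * of_int (n - m)))"
      by (metis of_real_mult)
    ultimately have "(\<lambda>M. of_real (real q powr (of_int (n - m) / p)) * (X M + of_real c * P (\<mu> M)))
        \<longlonglongrightarrow> of_real (real q powr ((1 / p - 1 / 2) * of_int (n - m))) * (b e - b (e + 2) / of_nat q)"
      by (simp add: mult.assoc[symmetric])
    then show ?thesis
      unfolding boundary_coeff_def e_def[symmetric]
    proof (rule Lim_transform_eventually)
      show "\<forall>\<^sub>F M in sequentially. of_real (real q powr (of_int (n - m) / p)) * (X M + of_real c * P (\<mu> M)) = \<kappa>M M n m"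
        using ev by eventually_elim (simp add: eq)
    qed
  qed
  ultimately show ?thesis
    by (rule kernel_bound_limit[OF p(1)])
qed

lemma sum_ray_kernel:
  assumes T: "finite T"
  shows "(\<Sum>z\<in>T. ray_kernel a x z * f z)
    = (\<Sum>m\<le>level x. a (level x - m) * (if ancestor (level x - m) x \<in> T then f (ancestor (level x - m) x) else 0))"
proof -
  define T' where "T' = {z \<in> T. level z \<le> level x \<and> ancestor (level x - level z) x = z}"
  define M where "M = {m. m \<le> level x \<and> ancestor (level x - m) x \<in> T}"
  have "(\<Sum>z\<in>T. ray_kernel a x z * f z) = (\<Sum>z\<in>T'. a (level x - level z) * f z)"
    using T by (intro sum.mono_neutral_cong_right) (auto simp: T'_def ray_kernel_def)
  also have "\<dots> = (\<Sum>m\<in>M. a (level x - m) * f (ancestor (level x - m) x))"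
    by (rule sum.reindex_bij_witness[of _ "\<lambda>m. ancestor (level x - m) x" level])
      (auto simp: T'_def M_def level_ancestor)
  also have "\<dots> = (\<Sum>m\<le>level x. a (level x - m) * (if ancestor (level x - m) x \<in> T then f (ancestor (level x - m) x) else 0))"
    by (intro sum.mono_neutral_cong_left) (auto simp: M_def)
  finally show ?thesis .
qed

text \<open>Along the ray from a vertex \<open>z\<close> at a high level \<open>N\<close> to the root, the kernel acts as convolution with \<open>s\<close>
on the function \<open>q powr (- (N - m) / p) * f (ancestor (N - m) z)\<close> of the level \<open>m\<close>. A vertex at level \<open>m\<close>
lies on between \<open>q ^ (N - m)\<close> and \<open>2 * q ^ (N - m)\<close> of these rays, so summing over all \<open>z\<close> at level \<open>N\<close>
recovers the norm of \<open>f\<close> on the tree up to the factor \<open>2\<close>.\<close>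

lemma ray_kernel_bound:
  fixes s :: "int \<Rightarrow> complex"
  assumes p: "1 \<le> p" and s: "kernel_bound p (\<lambda>n m. s (n - m)) A" and neg: "\<And>d. d < 0 \<Longrightarrow> s d = 0"
  shows "kernel_bound p (ray_kernel (\<lambda>j. of_real (real q powr (- real j / p)) * s (int j))) (2 * A)"
proof (rule kernel_boundI)
  have A: "0 \<le> A" by (rule kernel_bound_nonneg[OF s])
  then show "0 \<le> 2 * A" by simp
  fix S T :: "'v set" and f :: "'v \<Rightarrow> complex"
  assume fin: "finite S" "finite T"
  define N where "N = Max (insert 0 (level ` (S \<union> T)))"
  have N: "level x \<le> N" if "x \<in> S \<union> T" for x
    unfolding N_def using fin that by (intro Max_ge) auto
  define f' where "f' z = (if z \<in> T then f z else 0)" for z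
  define H where "H x = (\<Sum>z\<in>T. ray_kernel (\<lambda>j. of_real (real q powr (- real j / p)) * s (int j)) x z * f z)" for x
  define w where "w l = real q powr (- real (N - l))" for l
  define \<phi> where "\<phi> z m = of_real (real q powr (- real (N - m) / p)) * f' (ancestor (N - m) z)" for z m
  have sn: "kernel_bound p (\<lambda>l m. s (int l - int m)) A"
    using kernel_bound_reindex[OF s, of int int] by simp
  have w: "0 \<le> w l" for l by (simp add: w_def)
  have wq: "w l * real (q ^ (N - l)) = 1" for l
    unfolding w_def powr_neg_nat using q2 by simp
  have below: "(\<Sum>x\<in>S \<union> T. h x) \<le> (\<Sum>l\<le>N. \<Sum>x\<in>sphere_at l. h x)" if "\<And>x. 0 \<le> h x" for h :: "'v \<Rightarrow> real"
  proof -
    have "(\<Sum>x\<in>S \<union> T. h x) \<le> (\<Sum>x\<in>(\<Union>l\<le>N. sphere_at l). h x)"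
      using N that by (intro sum_mono2) (auto simp: finite_sphere_at, auto simp: sphere_at_def)
    also have "\<dots> = (\<Sum>l\<le>N. \<Sum>x\<in>sphere_at l. h x)"
      by (intro sum.UNION_disjoint) (auto simp: finite_sphere_at, auto simp: sphere_at_def)
    finally show ?thesis .
  qed
  \<comment> \<open>change between sums over the rays and sums over the levels\<close>
  have project: "(\<Sum>z\<in>sphere_at N. h (ancestor (N - l) z)) = (\<Sum>x\<in>sphere_at l. real (card (descendants (N - l) x)) * h x)"
    if "l \<le> N" for h :: "'v \<Rightarrow> real" and l
    using sum_over_descendants[of h "N - l" l] that by simp
  have H: "of_real (real q powr (- real (N - l) / p)) * H (ancestor (N - l) z) = (\<Sum>m\<le>N. s (int l - int m) * \<phi> z m)"
    if z: "z \<in> sphere_at N" and l: "l \<le> N" for z l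
  proof -
    have lev: "level (ancestor (N - l) z) = l"
      using z l level_ancestor[of "N - l" z] by (simp add: sphere_at_def)
    have "H (ancestor (N - l) z) = (\<Sum>m\<le>l. of_real (real q powr (- real (l - m) / p)) * s (int (l - m)) * f' (ancestor (N - m) z))"
      unfolding H_def sum_ray_kernel[OF fin(2)] lev using l
      by (intro sum.cong refl) (auto simp: ancestor_add f'_def)
    then have "of_real (real q powr (- real (N - l) / p)) * H (ancestor (N - l) z)
        = (\<Sum>m\<le>l. of_real (real q powr (- real (N - l) / p)) * (of_real (real q powr (- real (l - m) / p)) * s (int (l - m)) * f' (ancestor (N - m) z)))"
      by (simp add: sum_distrib_left)
    also have "\<dots> = (\<Sum>m\<le>l. s (int l - int m) * \<phi> z m)"
    proof (rule sum.cong[OF refl])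
      fix m assume m: "m \<in> {..l}"
      have "real q powr (- real (N - l) / p) * real q powr (- real (l - m) / p) = real q powr (- real (N - m) / p)"
        using l m by (simp add: of_nat_diff flip: powr_add add_divide_distrib)
      then have *: "complex_of_real (real q powr (- real (N - m) / p))
          = of_real (real q powr (- real (N - l) / p)) * of_real (real q powr (- real (l - m) / p))"
        by (metis of_real_mult)
      then show "of_real (real q powr (- real (N - l) / p)) * (of_real (real q powr (- real (l - m) / p)) * s (int (l - m)) * f' (ancestor (N - m) z))
          = s (int l - int m) * \<phi> z m"
      proof -
        have "int (l - m) = int l - int m" using m by simp
        then show ?thesis using * unfolding \<phi>_def by (simp only: mult_ac)
      qed
    qed
    also have "\<dots> = (\<Sum>m\<le>N. s (int l - int m) * \<phi> z m)"
      using l neg by (intro sum.mono_neutral_left) auto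
    finally show ?thesis .
  qed
  have "(\<Sum>x\<in>S. norm (H x) powr p) \<le> (\<Sum>x\<in>S \<union> T. norm (H x) powr p)"
    using fin by (intro sum_mono2) auto
  also have "\<dots> \<le> (\<Sum>l\<le>N. \<Sum>x\<in>sphere_at l. norm (H x) powr p)"
    by (rule below) simp
  also have "\<dots> \<le> (\<Sum>l\<le>N. w l * (\<Sum>x\<in>sphere_at l. real (card (descendants (N - l) x)) * norm (H x) powr p))"
    unfolding sum_distrib_left
  proof (intro sum_mono)
    fix l x
    have "1 \<le> w l * real (card (descendants (N - l) x))"
      using card_descendants_ge[of "N - l" x] wq[of l] w[of l]
      by (metis mult_left_mono of_nat_le_iff)
    then have "1 * norm (H x) powr p \<le> (w l * real (card (descendants (N - l) x))) * norm (H x) powr p"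
      by (intro mult_right_mono) auto
    then show "norm (H x) powr p \<le> w l * (real (card (descendants (N - l) x)) * norm (H x) powr p)"
      by (simp only: mult_1_left mult.assoc)
  qed
  also have "\<dots> = (\<Sum>l\<le>N. w l * (\<Sum>z\<in>sphere_at N. norm (H (ancestor (N - l) z)) powr p))"
    by (intro sum.cong refl) (simp add: project[where h = "\<lambda>x. norm (H x) powr p"])
  also have "\<dots> = (\<Sum>l\<le>N. \<Sum>z\<in>sphere_at N. norm (\<Sum>m\<le>N. s (int l - int m) * \<phi> z m) powr p)"
    unfolding sum_distrib_left
  proof (intro sum.cong refl)
    fix l z assume l: "l \<in> {..N}" and z: "z \<in> sphere_at N"
    show "w l * norm (H (ancestor (N - l) z)) powr p = norm (\<Sum>m\<le>N. s (int l - int m) * \<phi> z m) powr p"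
      using l z p H[of z l, symmetric] by (simp add: norm_mult powr_mult powr_powr w_def)
  qed
  also have "\<dots> = (\<Sum>z\<in>sphere_at N. \<Sum>l\<le>N. norm (\<Sum>m\<le>N. s (int l - int m) * \<phi> z m) powr p)"
    by (rule sum.swap)
  also have "\<dots> \<le> (\<Sum>z\<in>sphere_at N. A powr p * (\<Sum>m\<le>N. norm (\<phi> z m) powr p))"
    by (intro sum_mono kernel_boundD[OF sn]) auto
  also have "\<dots> = A powr p * (\<Sum>m\<le>N. \<Sum>z\<in>sphere_at N. norm (\<phi> z m) powr p)"
    unfolding sum_distrib_left[symmetric] by (subst sum.swap) (rule refl)
  also have "\<dots> = A powr p * (\<Sum>m\<le>N. w m * (\<Sum>z\<in>sphere_at N. norm (f' (ancestor (N - m) z)) powr p))"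
    using p by (simp add: \<phi>_def norm_mult powr_mult powr_powr w_def sum_distrib_left)
  also have "\<dots> = A powr p * (\<Sum>m\<le>N. w m * (\<Sum>x\<in>sphere_at m. real (card (descendants (N - m) x)) * norm (f' x) powr p))"
    by (simp add: project[where h = "\<lambda>x. norm (f' x) powr p"])
  also have "\<dots> \<le> A powr p * (\<Sum>m\<le>N. \<Sum>x\<in>sphere_at m. 2 * norm (f' x) powr p)"
    unfolding sum_distrib_left[of "w _"]
  proof (intro mult_left_mono sum_mono)
    fix m x
    have "w m * real (card (descendants (N - m) x)) \<le> w m * real (2 * q ^ (N - m))"
      using card_descendants_le[of "N - m" x] w by (intro mult_left_mono) (auto simp only: of_nat_le_iff)
    also have "\<dots> = 2" using wq[of m] by simp
    finally have "w m * real (card (descendants (N - m) x)) * norm (f' x) powr p \<le> 2 * norm (f' x) powr p"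
      by (intro mult_right_mono) auto
    then show "w m * (real (card (descendants (N - m) x)) * norm (f' x) powr p) \<le> 2 * norm (f' x) powr p"
      by (simp only: mult.assoc)
  qed simp
  also have "\<dots> = A powr p * (2 * (\<Sum>x\<in>T. norm (f x) powr p))"
  proof -
    have "(\<Sum>m\<le>N. \<Sum>x\<in>sphere_at m. 2 * norm (f' x) powr p) = (\<Sum>x\<in>(\<Union>m\<le>N. sphere_at m). 2 * norm (f' x) powr p)"
      by (intro sum.UNION_disjoint[symmetric]) (auto simp: finite_sphere_at, auto simp: sphere_at_def)
    also have "\<dots> = (\<Sum>x\<in>T. 2 * norm (f x) powr p)"
    proof (rule sum.mono_neutral_cong_right)
      show "T \<subseteq> (\<Union>m\<le>N. sphere_at m)" using N by (auto simp: sphere_at_def)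
    qed (use p in \<open>auto simp: f'_def finite_sphere_at\<close>)
    finally show ?thesis by (simp add: sum_distrib_left)
  qed
  also have "\<dots> \<le> A powr p * (2 powr p * (\<Sum>x\<in>T. norm (f x) powr p))"
    using p powr_mono[of 1 p 2] by (intro mult_left_mono mult_right_mono sum_nonneg) auto
  finally show "(\<Sum>x\<in>S. norm (\<Sum>z\<in>T. ray_kernel (\<lambda>j. of_real (real q powr (- real j / p)) * s (int j)) x z * f z) powr p)
      \<le> (2 * A) powr p * (\<Sum>x\<in>T. norm (f x) powr p)"
    using A by (simp add: H_def powr_mult mult_ac)
qed

section \<open>From the integers to the tree\<close>

text \<open>Throughout, \<open>F\<close> is a bounded convolution kernel on the integers that arises from an even sequence by
the weight \<open>q powr (d * n)\<close>. The profile of the corresponding radial kernel on the tree is recovered from \<open>F\<close>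
by convolutions with geometric sequences.\<close>

context
  fixes p d B :: real and F :: "int \<Rightarrow> complex" and b :: "nat \<Rightarrow> complex"
  assumes p: "1 \<le> p" and d: "0 < d" "1 / p = d + 1 / 2"
    and F: "kernel_bound p (\<lambda>n m. F (n - m)) B"
    and b: "b \<longlonglongrightarrow> 0"
    and F_eq: "\<And>n. F n = of_real (real q powr (d * of_int n)) * (b (nat \<bar>n\<bar>) - b (nat \<bar>n\<bar> + 2) / of_nat q)"
begin

definition tail_weight :: real where
  "tail_weight = real q powr (- 1 - 2 * d)"

text \<open>The series of \<open>geometric_inversion\<close> for \<open>b\<close>, carried over to height \<open>d\<close> and to all integers.\<close>

definition tail_kernel :: "int \<Rightarrow> complex" where
  "tail_kernel n = (\<Sum>j. of_real (tail_weight ^ j) * F (n + 2 * int j))"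

text \<open>An extension of \<open>q powr (n / p) * K n\<close> to the negative integers that is again a bounded convolution
kernel.\<close>

definition profile :: "int \<Rightarrow> complex" where
  "profile n = tail_kernel n - of_real (real q powr (- 2 * d)) * tail_kernel (n + 2)"

lemma integer_bound_nonneg: "0 \<le> B"
  by (rule kernel_bound_nonneg[OF F])

lemma F_bound: "norm (F n) \<le> B"
  using kernel_bound_entry[OF p F, of n 0] by simp

text \<open>For negative \<open>n\<close> evenness gives the stronger factor \<open>q powr (2 * d * n)\<close>.\<close>

lemma F_decay: "norm (F n) \<le> B * real q powr (d * of_int n)"
proof (cases "0 \<le> n")
  case True
  have "1 \<le> real q powr (d * of_int n)"
    using True d q2 by (intro ge_one_powr_ge_zero) auto
  then have "B * 1 \<le> B * real q powr (d * of_int n)"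
    by (intro mult_left_mono integer_bound_nonneg)
  then show ?thesis using F_bound[of n] by simp
next
  case False
  have "F n = of_real (real q powr (2 * d * of_int n)) * F (- n)"
    unfolding F_eq[of n] F_eq[of "- n"] by (simp add: mult.assoc[symmetric] flip: of_real_mult powr_add)
  then have "norm (F n) = real q powr (2 * d * of_int n) * norm (F (- n))"
    by (simp add: norm_mult)
  also have "\<dots> \<le> real q powr (d * of_int n) * B"
  proof (rule mult_mono[OF _ F_bound])
    have "2 * d * of_int n \<le> d * of_int n"
      using False d by (simp add: mult_le_cancel_right1)
    then show "real q powr (2 * d * of_int n) \<le> real q powr (d * of_int n)"
      using q2 by (intro powr_mono) auto
  qed auto
  finally show ?thesis by (simp add: mult.commute)
qed

lemma tail_weight_bounds: "0 < tail_weight" "tail_weight \<le> 1 / 2"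
proof -
  show "0 < tail_weight" using q2 by (simp add: tail_weight_def)
  have "tail_weight \<le> real q powr (- 1)"
    using q2 d unfolding tail_weight_def by (intro powr_mono) auto
  also have "\<dots> \<le> 1 / 2" using q2 by (simp add: powr_minus field_simps)
  finally show "tail_weight \<le> 1 / 2" .
qed

lemma tail_kernel_term_bound:
  "norm (of_real (tail_weight ^ j) * F (n + 2 * int j)) \<le> B * real q powr (d * of_int n) * (1 / 2) ^ j"
proof -
  have "norm (of_real (tail_weight ^ j) * F (n + 2 * int j)) = tail_weight ^ j * norm (F (n + 2 * int j))"
    using tail_weight_bounds by (simp add: norm_mult norm_power)
  also have "\<dots> \<le> tail_weight ^ j * (B * real q powr (d * of_int (n + 2 * int j)))"
    using tail_weight_bounds by (intro mult_left_mono F_decay) auto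
  also have "tail_weight ^ j * (B * real q powr (d * of_int (n + 2 * int j)))
      = real q powr ((- 1 - 2 * d) * real j) * (B * real q powr (d * of_int (n + 2 * int j)))"
    using q2 by (simp add: tail_weight_def powr_powr flip: powr_realpow)
  also have "\<dots> = B * (real q powr ((- 1 - 2 * d) * real j) * real q powr (d * of_int (n + 2 * int j)))"
    by simp
  also have "real q powr ((- 1 - 2 * d) * real j) * real q powr (d * of_int (n + 2 * int j))
      = real q powr (d * of_int n + (- real j))"
    unfolding powr_add[symmetric] by (simp add: algebra_simps)
  also have "\<dots> = real q powr (d * of_int n) * inverse (real q ^ j)"
    unfolding powr_add powr_neg_nat ..
  also have "B * \<dots> \<le> B * (real q powr (d * of_int n) * (1 / 2) ^ j)"
  proof (intro mult_left_mono integer_bound_nonneg)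
    have "inverse (real q ^ j) = (1 / real q) ^ j" by (simp add: power_one_over inverse_eq_divide)
    also have "\<dots> \<le> (1 / 2) ^ j" using q2 by (intro power_mono) (auto simp: field_simps)
    finally show "inverse (real q ^ j) \<le> (1 / 2) ^ j" .
  qed auto
  finally show ?thesis by (simp only: mult.assoc)
qed

lemma summable_half: "summable (\<lambda>j. C * (1 / 2 :: real) ^ j)"
  by (intro summable_mult) simp

lemma tail_kernel_sums: "(\<lambda>j. of_real (tail_weight ^ j) * F (n + 2 * int j)) sums tail_kernel n"
  unfolding tail_kernel_def
  by (rule summable_sums, rule summable_comparison_test'[OF summable_half tail_kernel_term_bound])

lemma tail_kernel_decay: "norm (tail_kernel n) \<le> 2 * B * real q powr (d * of_int n)"
proof -
  have "norm (tail_kernel n) \<le> (\<Sum>j. B * real q powr (d * of_int n) * (1 / 2) ^ j)"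
    unfolding tail_kernel_def by (intro norm_suminf_le summable_half tail_kernel_term_bound)
  also have "\<dots> = B * real q powr (d * of_int n) * (\<Sum>j. (1 / 2) ^ j)"
    by (intro suminf_mult) simp
  finally show ?thesis by (simp add: suminf_geometric)
qed

lemma tail_kernel_bound: "kernel_bound p (\<lambda>n m. tail_kernel (n - m)) (2 * B)"
proof (rule kernel_bound_limit[OF p])
  show "kernel_bound p (\<lambda>n m. \<Sum>j<J. of_real (tail_weight ^ j) * F (n - m + 2 * int j)) (2 * B)" for J
  proof (rule kernel_bound_mono[OF p])
    show "kernel_bound p (\<lambda>n m. \<Sum>j<J. of_real (tail_weight ^ j) * F (n - m + 2 * int j))
        (\<Sum>j<J. norm (complex_of_real (tail_weight ^ j)) * B)"
      by (intro kernel_bound_sum[OF p] kernel_bound_scale kernel_bound_translation F) simp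
    have "(\<Sum>j<J. norm (complex_of_real (tail_weight ^ j)) * B) \<le> (\<Sum>j<J. (1 / 2) ^ j * B)"
      using tail_weight_bounds by (intro sum_mono mult_right_mono integer_bound_nonneg) (auto simp: norm_power intro!: power_mono)
    also have "\<dots> = (\<Sum>j<J. (1 / 2) ^ j) * B" by (simp add: sum_distrib_right)
    also have "\<dots> \<le> (\<Sum>j. (1 / 2) ^ j) * B"
      by (intro mult_right_mono integer_bound_nonneg sum_le_suminf) auto
    finally show "(\<Sum>j<J. norm (complex_of_real (tail_weight ^ j)) * B) \<le> 2 * B"
      by (simp add: suminf_geometric)
  qed
  show "(\<lambda>J. \<Sum>j<J. of_real (tail_weight ^ j) * F (n - m + 2 * int j)) \<longlonglongrightarrow> tail_kernel (n - m)" for n m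
    using tail_kernel_sums[of "n - m"] by (simp add: sums_def)
qed

lemma tail_kernel_eq: "tail_kernel (int n) = of_real (real q powr (d * real n)) * b n"
proof -
  have "of_real (tail_weight ^ j) * F (int n + 2 * int j)
      = of_real (real q powr (d * real n)) * ((b (n + 2 * j) - b (n + 2 * j + 2) / of_nat q) / of_nat q ^ j)" for j
  proof -
    have "tail_weight ^ j * real q powr (d * of_int (int n + 2 * int j))
        = real q powr ((- 1 - 2 * d) * real j + d * of_int (int n + 2 * int j))"
      using q2 by (simp add: tail_weight_def powr_powr powr_add flip: powr_realpow)
    also have "(- 1 - 2 * d) * real j + d * of_int (int n + 2 * int j) = d * real n + (- real j)"
      by (simp add: algebra_simps)
    also have "real q powr \<dots> = real q powr (d * real n) / real q ^ j"
      unfolding powr_add powr_neg_nat by (simp add: divide_inverse)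
    finally have "complex_of_real (tail_weight ^ j * real q powr (d * of_int (int n + 2 * int j)))
        = of_real (real q powr (d * real n) / real q ^ j)" by (rule arg_cong)
    then have *: "complex_of_real (tail_weight ^ j) * of_real (real q powr (d * of_int (int n + 2 * int j)))
        = of_real (real q powr (d * real n)) / of_nat q ^ j"
      by (simp only: of_real_mult of_real_divide of_real_power of_real_of_nat_eq)
    have "nat \<bar>int n + 2 * int j\<bar> = n + 2 * j" by simp
    then show ?thesis
      unfolding F_eq mult.assoc[symmetric] * by simp
  qed
  then have "(\<lambda>j. of_real (real q powr (d * real n)) * ((b (n + 2 * j) - b (n + 2 * j + 2) / of_nat q) / of_nat q ^ j))
      sums tail_kernel (int n)"
    using tail_kernel_sums[of "int n"] by simp
  from sums_unique2[OF this sums_mult[OF geometric_inversion[OF b]]] show ?thesis .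
qed

lemma exponent_identity: "- real n / p + d * real n = - (real n / 2)"
proof -
  have "- real n / p = - real n * (1 / p)" by simp
  also have "\<dots> = - real n * (d + 1 / 2)" unfolding d(2) ..
  finally show ?thesis by (simp add: algebra_simps)
qed

lemma weight_le_1: "real q powr (- 2 * d) \<le> 1"
  using q2 d powr_mono[of "- 2 * d" 0 "real q"] by simp

lemma profile_bound: "kernel_bound p (\<lambda>n m. profile (n - m)) (4 * B)"
proof (rule kernel_bound_mono[OF p])
  show "kernel_bound p (\<lambda>n m. profile (n - m))
      (2 * B + norm (complex_of_real (real q powr (- 2 * d))) * (2 * B))"
    unfolding profile_def
    by (intro kernel_bound_diff[OF p] kernel_bound_scale kernel_bound_translation tail_kernel_bound)
  have "real q powr (- 2 * d) * (2 * B) \<le> 1 * (2 * B)"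
    using integer_bound_nonneg by (intro mult_right_mono weight_le_1) auto
  then show "2 * B + norm (complex_of_real (real q powr (- 2 * d))) * (2 * B) \<le> 4 * B" by simp
qed

lemma profile_decay: "norm (profile n) \<le> 4 * B * real q powr (d * of_int n)"
proof -
  have "norm (profile n) \<le> norm (tail_kernel n) + real q powr (- 2 * d) * norm (tail_kernel (n + 2))"
    unfolding profile_def by (rule order_trans[OF norm_triangle_ineq4]) (simp add: norm_mult)
  also have "\<dots> \<le> 2 * B * real q powr (d * of_int n)
      + real q powr (- 2 * d) * (2 * B * real q powr (d * of_int (n + 2)))"
    by (intro add_mono mult_left_mono tail_kernel_decay) auto
  also have "real q powr (- 2 * d) * (2 * B * real q powr (d * of_int (n + 2)))
      = 2 * B * (real q powr (- 2 * d) * real q powr (d * of_int (n + 2)))" by simp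
  also have "real q powr (- 2 * d) * real q powr (d * of_int (n + 2)) = real q powr (d * of_int n)"
    unfolding powr_add[symmetric] by (simp add: algebra_simps)
  finally show ?thesis by simp
qed

text \<open>The restriction to nonnegative arguments is the translate of the whole kernel minus a part on the
negative integers, which is summable by \<open>profile_decay\<close>.\<close>

lemma shifted_profile_bound:
  "kernel_bound p (\<lambda>n m. if 0 \<le> n - m then profile (int i + (n - m)) else 0)
    (4 * B * (1 + 1 / (1 - real q powr (- d))) * real q powr (d * real i))"
proof -
  define \<rho> where "\<rho> = real q powr (- d)"
  have \<rho>: "0 < \<rho>" "\<rho> < 1" using q2 d by (auto simp: \<rho>_def intro!: powr_less_one)
  define u where "u k = (if k < 0 then profile (int i + k) else 0)" for k
  have u: "(\<Sum>k\<in>D. norm (u k)) \<le> 4 * B * real q powr (d * real i) * (1 / (1 - \<rho>))" if D: "finite D" for D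
  proof -
    have "(\<Sum>k\<in>D. norm (u k)) = (\<Sum>k\<in>{k\<in>D. k < 0}. norm (profile (int i + k)))"
      using D by (intro sum.mono_neutral_cong_right) (auto simp: u_def)
    also have "\<dots> \<le> (\<Sum>k\<in>{k\<in>D. k < 0}. 4 * B * real q powr (d * real i) * \<rho> ^ nat (- k))"
    proof (rule sum_mono)
      fix k assume k: "k \<in> {k\<in>D. k < 0}"
      have "\<rho> ^ nat (- k) = real q powr (d * of_int k)"
        using k q2 by (simp add: \<rho>_def powr_powr flip: powr_realpow)
      then have "real q powr (d * of_int (int i + k)) = real q powr (d * real i) * \<rho> ^ nat (- k)"
        by (simp add: distrib_left powr_add)
      then show "norm (profile (int i + k)) \<le> 4 * B * real q powr (d * real i) * \<rho> ^ nat (- k)"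
        using profile_decay[of "int i + k"] by (simp only: mult.assoc)
    qed
    also have "\<dots> = 4 * B * real q powr (d * real i) * (\<Sum>k\<in>{k\<in>D. k < 0}. \<rho> ^ nat (- k))"
      by (simp add: sum_distrib_left)
    also have "\<dots> \<le> 4 * B * real q powr (d * real i) * (1 / (1 - \<rho>))"
      using integer_bound_nonneg D by (intro mult_left_mono sum_negative_powers_le[OF \<rho>]) auto
    finally show ?thesis .
  qed
  have "kernel_bound p (\<lambda>n m. profile (n - m + int i) - u (n - m))
      (4 * B + 4 * B * real q powr (d * real i) * (1 / (1 - \<rho>)))"
    by (intro kernel_bound_diff[OF p] kernel_bound_translation profile_bound kernel_bound_summable[OF p] u)
  moreover have "(\<lambda>n m. profile (n - m + int i) - u (n - m)) = (\<lambda>n m. if 0 \<le> n - m then profile (int i + (n - m)) else 0)"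
    by (intro ext) (auto simp: u_def add.commute)
  moreover have "4 * B + 4 * B * real q powr (d * real i) * (1 / (1 - \<rho>))
      \<le> 4 * B * (1 + 1 / (1 - \<rho>)) * real q powr (d * real i)"
  proof -
    have "1 \<le> real q powr (d * real i)" using d q2 by (intro ge_one_powr_ge_zero) auto
    then have "4 * B * 1 \<le> 4 * B * real q powr (d * real i)"
      using integer_bound_nonneg by (intro mult_left_mono) auto
    then show ?thesis by (simp add: algebra_simps)
  qed
  ultimately show ?thesis
    unfolding \<rho>_def[symmetric] by (auto intro: kernel_bound_mono[OF p])
qed

context
  fixes K :: "nat \<Rightarrow> complex"
  assumes K: "\<And>n. of_real (real q powr (real n / 2)) * K n = b n - b (n + 2)"
begin

lemma K_eq_profile: "K n = of_real (real q powr (- real n / p)) * profile (int n)"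
proof -
  have q0: "0 < real q" using q2 by simp
  have *: "complex_of_real (real q powr (- real n / p)) * of_real (real q powr (d * real n)) = of_real (real q powr (- (real n / 2)))"
  proof -
    have "- real n / p + d * real n = - (real n / 2)"
      by (rule exponent_identity)
    then show ?thesis by (simp flip: of_real_mult powr_add)
  qed
  have "profile (int n) = of_real (real q powr (d * real n)) * (b n - b (n + 2))"
  proof -
    have "real q powr (- 2 * d) * real q powr (d * real (n + 2)) = real q powr (d * real n)"
      unfolding powr_add[symmetric] by (simp add: algebra_simps)
    then have "complex_of_real (real q powr (- 2 * d)) * of_real (real q powr (d * real (n + 2))) = of_real (real q powr (d * real n))"
      by (metis of_real_mult)
    moreover have "tail_kernel (int n + 2) = of_real (real q powr (d * real (n + 2))) * b (n + 2)"
      using tail_kernel_eq[of "n + 2"] by (simp add: add.commute)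
    ultimately show ?thesis
      unfolding profile_def tail_kernel_eq by (simp add: mult.assoc[symmetric] right_diff_distrib)
  qed
  then have "of_real (real q powr (- real n / p)) * profile (int n) = of_real (real q powr (- (real n / 2))) * (b n - b (n + 2))"
    by (simp only: mult.assoc[symmetric] *)
  also have "\<dots> = (of_real (real q powr (- (real n / 2))) * of_real (real q powr (real n / 2))) * K n"
    by (simp only: K mult.assoc)
  also have "complex_of_real (real q powr (- (real n / 2))) * of_real (real q powr (real n / 2)) = 1"
    using q0 by (simp flip: of_real_mult powr_add)
  finally show ?thesis by simp
qed

lemma ray_kernel_K_bound:
  "kernel_bound p (ray_kernel (\<lambda>j. K (i + j))) (8 * B * (1 + 1 / (1 - real q powr (- d))) * real q powr (- (real i / 2)))"
proof -
  define s where "s k = (if 0 \<le> k then profile (int i + k) else 0)" for k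
  have "kernel_bound p (ray_kernel (\<lambda>j. of_real (real q powr (- real j / p)) * s (int j)))
      (2 * (4 * B * (1 + 1 / (1 - real q powr (- d))) * real q powr (d * real i)))"
    by (rule ray_kernel_bound[OF p]) (use shifted_profile_bound[of i] in \<open>simp_all add: s_def\<close>)
  from kernel_bound_scale[OF this, of "of_real (real q powr (- real i / p))"]
  have "kernel_bound p (\<lambda>x z. of_real (real q powr (- real i / p)) * ray_kernel (\<lambda>j. of_real (real q powr (- real j / p)) * s (int j)) x z)
      (real q powr (- real i / p) * (2 * (4 * B * (1 + 1 / (1 - real q powr (- d))) * real q powr (d * real i))))"
    by simp
  moreover have "of_real (real q powr (- real i / p)) * ray_kernel (\<lambda>j. of_real (real q powr (- real j / p)) * s (int j)) x z
      = ray_kernel (\<lambda>j. K (i + j)) x z" for x z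
  proof -
    have "real q powr (- real i / p) * real q powr (- real j / p) = real q powr (- real (i + j) / p)" for j
      unfolding powr_add[symmetric] by (simp add: add_divide_distrib diff_divide_distrib)
    then have "complex_of_real (real q powr (- real i / p)) * of_real (real q powr (- real j / p)) = of_real (real q powr (- real (i + j) / p))" for j
      by (metis of_real_mult)
    then have *: "complex_of_real (real q powr (- real i / p)) * (of_real (real q powr (- real j / p)) * s (int j)) = K (i + j)" for j
      unfolding K_eq_profile s_def mult.assoc[symmetric] by simp
    show ?thesis
      unfolding ray_kernel_def if_distrib[of "(*) _"] * mult_zero_right ..
  qed
  moreover have "real q powr (- real i / p) * (2 * (4 * B * (1 + 1 / (1 - real q powr (- d))) * real q powr (d * real i)))
      = 8 * B * (1 + 1 / (1 - real q powr (- d))) * real q powr (- (real i / 2))"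
  proof -
    have "real q powr (- real i / p) * real q powr (d * real i) = real q powr (- (real i / 2))"
      unfolding powr_add[symmetric] exponent_identity ..
    moreover have "x * (2 * (4 * B * c * y)) = 8 * B * c * (x * y)" for x y c :: real by simp
    ultimately show ?thesis by (simp only:)
  qed
  ultimately show ?thesis by (simp only:)
qed

text \<open>Evaluation at the \<open>i\<close>-th ancestor: a vertex has at most \<open>2 * q ^ i\<close> descendants in generation \<open>i\<close>. The
exponents \<open>- 1 / 2\<close> and \<open>1 - 1 / p\<close> of \<open>q ^ i\<close> add up to \<open>- d\<close>.\<close>

lemma fibre_bound:
  assumes Y: "\<And>y. y \<in> Y \<Longrightarrow> i \<le> level y" and \<kappa>: "kernel_bound p \<kappa> (C * real q powr (- (real i / 2)))" and C: "0 \<le> C"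
  shows "kernel_bound p (\<lambda>x y. if y \<in> Y then \<kappa> x (ancestor i y) else 0) (2 * C * (real q powr (- d)) ^ i)"
proof (rule kernel_bound_mono[OF p])
  show "kernel_bound p (\<lambda>x y. if y \<in> Y then \<kappa> x (ancestor i y) else 0)
      (C * real q powr (- (real i / 2)) * (2 * real q ^ i) powr (1 - 1 / p))"
  proof (rule kernel_bound_fibres[OF p \<kappa>])
    fix z
    have sub: "{y \<in> Y. ancestor i y = z} \<subseteq> descendants i z"
      using Y by (auto simp: descendants_def)
    have "card {y \<in> Y. ancestor i y = z} \<le> 2 * q ^ i"
      using card_mono[OF finite_descendants sub] card_descendants_le[of i z] by linarith
    then have "real (card {y \<in> Y. ancestor i y = z}) \<le> real (2 * q ^ i)"
      by (simp only: of_nat_le_iff)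
    then show "finite {y \<in> Y. ancestor i y = z} \<and> real (card {y \<in> Y. ancestor i y = z}) \<le> 2 * real q ^ i"
      using finite_subset[OF sub finite_descendants] by simp
  qed simp
  have "(2 * real q ^ i) powr (1 - 1 / p) = 2 powr (1 - 1 / p) * real q powr (real i * (1 - 1 / p))"
    using q2 by (simp add: powr_mult powr_powr flip: powr_realpow)
  also have "\<dots> \<le> 2 * real q powr (real i * (1 - 1 / p))"
    using powr_mono[of "1 - 1 / p" 1 2] p by (intro mult_right_mono) auto
  finally have "C * real q powr (- (real i / 2)) * (2 * real q ^ i) powr (1 - 1 / p)
      \<le> C * real q powr (- (real i / 2)) * (2 * real q powr (real i * (1 - 1 / p)))"
    using C by (intro mult_left_mono) auto
  also have "\<dots> = 2 * C * (real q powr (- (real i / 2)) * real q powr (real i * (1 - 1 / p)))"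
    by simp
  also have "real q powr (- (real i / 2)) * real q powr (real i * (1 - 1 / p)) = (real q powr (- d)) ^ i"
  proof -
    have "- (real i / 2) + real i * (1 - 1 / p) = - d * real i"
      unfolding d(2) by (simp add: algebra_simps)
    then have "real q powr (- (real i / 2)) * real q powr (real i * (1 - 1 / p)) = real q powr (- d * real i)"
      by (simp only: powr_add[symmetric])
    then show ?thesis using q2 by (simp add: powr_powr flip: powr_realpow)
  qed
  finally show "C * real q powr (- (real i / 2)) * (2 * real q ^ i) powr (1 - 1 / p) \<le> 2 * C * (real q powr (- d)) ^ i" .
qed

text \<open>The bounds for the terms of \<open>radial_kernel_confluent\<close> form a geometric series in the number \<open>i\<close> of
descending steps.\<close>

theorem inverse_abel_transform_bound:
  "kernel_bound p (\<lambda>x y. K (gdist adj x y)) (bound_constant d * B)"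
proof -
  define \<rho> where "\<rho> = real q powr (- d)"
  have \<rho>: "0 < \<rho>" "\<rho> < 1" using q2 d by (auto simp: \<rho>_def intro!: powr_less_one)
  define C where "C = 8 * B * (1 + 1 / (1 - \<rho>))"
  have C: "0 \<le> C" using \<rho> integer_bound_nonneg by (simp add: C_def)
  have const: "4 * C / (1 - \<rho>) = bound_constant d * B"
    by (simp add: C_def bound_constant_def \<rho>_def)
  define \<kappa>1 where "\<kappa>1 i x y = (if y \<in> {y. i \<le> level y} then ray_kernel (\<lambda>j. K (i + j)) x (ancestor i y) else 0)" for i x y
  define \<kappa>2 where "\<kappa>2 i x y = (if y \<in> {y. i < level y} then ray_kernel (\<lambda>j. K (i + 2 + j)) x (ancestor i y) else 0)" for i x y
  have k1: "kernel_bound p (\<kappa>1 i) (2 * C * \<rho> ^ i)" for i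
    unfolding \<kappa>1_def \<rho>_def
    by (rule fibre_bound) (use ray_kernel_K_bound[of i] C in \<open>simp_all add: C_def \<rho>_def\<close>)
  have k2: "kernel_bound p (\<kappa>2 i) (2 * C * \<rho> ^ i)" for i
    unfolding \<kappa>2_def \<rho>_def
  proof (rule fibre_bound)
    have le: "real q powr (- (real (i + 2) / 2)) \<le> real q powr (- (real i / 2))"
      using q2 by (intro powr_mono) auto
    show "kernel_bound p (ray_kernel (\<lambda>j. K (i + 2 + j))) (C * real q powr (- (real i / 2)))"
      by (rule kernel_bound_mono[OF p ray_kernel_K_bound[of "i + 2", folded \<rho>_def C_def]])
        (fold C_def, intro mult_left_mono le C)
  qed (use C in auto)
  show ?thesis
  proof (rule kernel_bound_local)
    show "0 \<le> bound_constant d * B"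
      unfolding const[symmetric] using C \<rho> by simp
    fix S T :: "'v set"
    assume fin: "finite S" "finite T"
    define N where "N = Max (insert 0 (level ` T))"
    have N: "level y \<le> N" if "y \<in> T" for y
      unfolding N_def using fin that by (intro Max_ge) auto
    define \<kappa>' where "\<kappa>' x y = (\<Sum>i\<le>N. \<kappa>1 i x y) - (\<Sum>i\<le>N. \<kappa>2 i x y)" for x y
    have "kernel_bound p \<kappa>' ((\<Sum>i\<le>N. 2 * C * \<rho> ^ i) + (\<Sum>i\<le>N. 2 * C * \<rho> ^ i))"
      unfolding \<kappa>'_def by (intro kernel_bound_diff[OF p] kernel_bound_sum[OF p] k1 k2) auto
    moreover have "(\<Sum>i\<le>N. 2 * C * \<rho> ^ i) \<le> 2 * C * (1 / (1 - \<rho>))"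
    proof -
      have "(\<Sum>i\<le>N. \<rho> ^ i) \<le> (\<Sum>i. \<rho> ^ i)" using \<rho> by (intro sum_le_suminf) auto
      then have "2 * C * (\<Sum>i\<le>N. \<rho> ^ i) \<le> 2 * C * (1 / (1 - \<rho>))"
        using C \<rho> by (intro mult_left_mono) (auto simp: suminf_geometric)
      then show ?thesis by (simp add: sum_distrib_left)
    qed
    ultimately have "kernel_bound p \<kappa>' (bound_constant d * B)"
      by (intro kernel_bound_mono[OF p, of \<kappa>' _ "bound_constant d * B"]) (auto simp: const[symmetric])
    moreover have "K (gdist adj x y) = \<kappa>' x y" if "y \<in> T" for x y
    proof -
      have "(\<Sum>i\<le>N. \<kappa>1 i x y) = (\<Sum>i\<le>level y. ray_kernel (\<lambda>j. K (i + j)) x (ancestor i y))"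
        using N[OF that] by (intro sum.mono_neutral_cong_right) (auto simp: \<kappa>1_def)
      moreover have "(\<Sum>i\<le>N. \<kappa>2 i x y) = (\<Sum>i<level y. ray_kernel (\<lambda>j. K (i + 2 + j)) x (ancestor i y))"
        using N[OF that] by (intro sum.mono_neutral_cong_right) (auto simp: \<kappa>2_def)
      ultimately show ?thesis
        unfolding \<kappa>'_def by (simp only: radial_kernel_confluent)
    qed
    ultimately show "\<exists>\<kappa>'. kernel_bound p \<kappa>' (bound_constant d * B) \<and> (\<forall>x\<in>S. \<forall>y\<in>T. K (gdist adj x y) = \<kappa>' x y)"
      by blast
  qed
qed

end

end

end

section \<open>Fourier coefficients on a strip\<close>

lemma integral_suminf_sums:
  fixes f :: "nat \<Rightarrow> real \<Rightarrow> complex"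
  assumes cont: "\<And>n. continuous_on {a..b} (f n)"
    and bound: "\<And>n x. x \<in> {a..b} \<Longrightarrow> norm (f n x) \<le> M n" and M: "summable M"
  shows "(\<lambda>n. integral {a..b} (f n)) sums integral {a..b} (\<lambda>x. \<Sum>n. f n x)"
proof -
  have "uniform_limit {a..b} (\<lambda>n x. \<Sum>i<n. f i x) (\<lambda>x. \<Sum>n. f n x) sequentially"
    by (rule Weierstrass_m_test[OF bound M])
  then obtain I J where I: "\<And>n. ((\<lambda>x. \<Sum>i<n. f i x) has_integral I n) {a..b}"
      and J: "((\<lambda>x. \<Sum>n. f n x) has_integral J) {a..b}" and lim: "I \<longlonglongrightarrow> J"
    by (rule uniform_limit_integral) (auto intro!: continuous_on_sum cont)
  have "I n = (\<Sum>i<n. integral {a..b} (f i))" for n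
    using integral_unique[OF I[of n]]
    by (subst (asm) integral_sum) (auto intro: integrable_continuous_interval cont)
  then have "I = (\<lambda>n. \<Sum>i<n. integral {a..b} (f i))" by blast
  then show ?thesis
    using lim integral_unique[OF J] unfolding sums_def by simp
qed

context tree_degree
begin

text \<open>The function \<open>q powr (\<i> * z)\<close>, whose restrictions to the real axis are the characters of the torus.\<close>

definition wave :: "complex \<Rightarrow> complex" where
  "wave z = exp (\<i> * z * of_real (ln (real q)))"

lemma ln_q_pos: "0 < ln (real q)"
  using q2 by simp

lemma tau_pos: "0 < tau q"
  using ln_q_pos by (simp add: tau_def)

lemma q_powr: "of_nat q powr z = exp (z * of_real (ln (real q)))" for z :: complex
  using q2 Ln_of_nat[of q] by (simp add: powr_def)

lemma wave_powr: "of_nat q powr (\<i> * z) = wave z" for z :: complex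
  by (simp add: q_powr wave_def)

lemma wave_0 [simp]: "wave 0 = 1"
  by (simp add: wave_def)

lemma wave_add: "wave (z + w) = wave z * wave w"
  by (simp add: wave_def ring_distribs flip: exp_add)

lemma wave_minus: "wave (- z) = inverse (wave z)"
  by (simp add: wave_def exp_minus)

lemma wave_of_nat: "wave (of_nat n * z) = wave z ^ n"
  by (simp add: wave_def mult_ac flip: exp_of_nat_mult)

lemma norm_wave: "norm (wave z) = real q powr (- Im z)"
  using q2 by (simp add: wave_def powr_def)

lemma norm_wave_real [simp]: "norm (wave (of_int d * of_real s)) = 1"
  using q2 by (simp add: norm_wave)

lemma wave_nonzero [simp]: "wave z \<noteq> 0"
  by (simp add: wave_def)

lemma wave_period: "wave (of_int d * of_real (tau q)) = 1"
proof -
  have "tau q * ln (real q) = 2 * pi"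
    using ln_q_pos by (simp add: tau_def)
  then have "complex_of_real (tau q * ln (real q)) = of_real (2 * pi)" by simp
  moreover have "\<i> * (of_int d * of_real (tau q)) * of_real (ln (real q))
      = \<i> * of_int d * complex_of_real (tau q * ln (real q))" by simp
  ultimately have "\<i> * (of_int d * of_real (tau q)) * of_real (ln (real q)) = of_real (2 * of_int d * pi) * \<i>"
    by simp
  then show ?thesis
    unfolding wave_def using exp_integer_2pi[of "of_int d", OF Ints_of_int] by (simp only:)
qed

lemma wave_shift: "wave (of_int d * (z + of_real (tau q))) = wave (of_int d * z)"
  by (simp add: distrib_left wave_add wave_period)

lemma continuous_on_wave [continuous_intros]:
  "continuous_on A f \<Longrightarrow> continuous_on A (\<lambda>x. wave (f x))"
  unfolding wave_def by (intro continuous_intros)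

lemma holomorphic_on_wave [holomorphic_intros]:
  "f holomorphic_on A \<Longrightarrow> (\<lambda>x. wave (f x)) holomorphic_on A"
  unfolding wave_def by (intro holomorphic_intros)

lemma wave_has_vector_derivative:
  "((\<lambda>s. wave (of_int d * of_real s)) has_vector_derivative
     (\<i> * of_int d * of_real (ln (real q))) * wave (of_int d * of_real s)) (at s within A)"
proof -
  have "((\<lambda>z. wave (of_int d * z)) has_field_derivative
      (\<i> * of_int d * of_real (ln (real q))) * wave (of_int d * z)) (at z)" for z
    unfolding wave_def by (auto intro!: derivative_eq_intros)
  then have "((\<lambda>z. wave (of_int d * z)) \<circ> of_real has_vector_derivative
      1 * ((\<i> * of_int d * of_real (ln (real q))) * wave (of_int d * of_real s))) (at s within A)"
    by (intro field_vector_diff_chain_within) (auto intro!: derivative_eq_intros intro: has_field_derivative_at_within)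
  then show ?thesis by (simp add: o_def)
qed

lemma strip_altdef: "strip t = {z. Im z < t} \<inter> {z. Im z > - t}"
  by (auto simp: strip_def)

lemma convex_strip: "convex (strip t)"
  unfolding strip_altdef by (intro convex_Int convex_halfspace_Im_lt convex_halfspace_Im_gt)

lemma open_strip: "open (strip t)"
  unfolding strip_altdef by (intro open_Int open_halfspace_Im_lt open_halfspace_Im_gt)

lemma continuous_on_horizontal:
  assumes "g holomorphic_on strip t" "\<bar>v\<bar> < t"
  shows "continuous_on A (\<lambda>u. g (Complex u v))"
proof -
  have "continuous_on A (\<lambda>u. g (of_real u + \<i> * of_real v))"
    using assms(2) by (intro continuous_on_compose2[OF holomorphic_on_imp_continuous_on[OF assms(1)]] continuous_intros)
      (auto simp: strip_def)
  then show ?thesis by (simp add: Complex_eq)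
qed

lemma continuous_on_real_axis:
  assumes "g holomorphic_on strip t" "0 < t"
  shows "continuous_on A (\<lambda>u. g (complex_of_real u))"
  using continuous_on_horizontal[OF assms(1), of 0 A] assms(2) by (simp add: Complex_eq)

text \<open>A primitive \<open>H\<close> exists on the strip. By periodicity \<open>H (z + T) - H z\<close> has derivative \<open>0\<close>, and its constant
value is the integral over one period at any height.\<close>

lemma periodic_contour_shift:
  assumes h: "h holomorphic_on strip t" and per: "\<And>z. z \<in> strip t \<Longrightarrow> h (z + of_real T) = h z"
    and T: "0 \<le> T" and v: "\<bar>v\<bar> < t"
  shows "integral {0..T} (\<lambda>u. h (Complex u v)) = integral {0..T} (\<lambda>u. h (of_real u))"
proof -
  obtain H where H: "\<And>z. z \<in> strip t \<Longrightarrow> (H has_field_derivative h z) (at z within strip t)"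
    using holomorphic_convex_primitive'[OF convex_strip open_strip h] by blast
  have H': "(H has_field_derivative h z) (at z)" if "z \<in> strip t" for z
    using H[OF that] that at_within_open[OF _ open_strip] by metis
  have int: "integral {0..T} (\<lambda>u. h (Complex u w)) = H (Complex 0 w + of_real T) - H (Complex 0 w)"
    if w: "\<bar>w\<bar> < t" for w
  proof -
    have "((\<lambda>u. h (Complex u w)) has_integral (H \<circ> (\<lambda>u. of_real u + \<i> * of_real w)) T
        - (H \<circ> (\<lambda>u. of_real u + \<i> * of_real w)) 0) {0..T}"
    proof (rule fundamental_theorem_of_calculus[OF T])
      fix u
      have "Complex u w \<in> strip t" using w by (simp add: strip_def)
      from has_field_derivative_at_within[OF H'[OF this]]
      have "(H \<circ> (\<lambda>u. of_real u + \<i> * of_real w) has_vector_derivative 1 * h (Complex u w)) (at u within {0..T})"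
        by (intro field_vector_diff_chain_within) (auto intro!: derivative_eq_intros simp: Complex_eq)
      then show "(H \<circ> (\<lambda>u. of_real u + \<i> * of_real w) has_vector_derivative h (Complex u w)) (at u within {0..T})"
        by simp
    qed
    then show ?thesis by (simp add: integral_unique Complex_eq add.commute)
  qed
  define D where "D z = H (z + of_real T) - H z" for z
  have "(D has_field_derivative 0) (at z within strip t)" if z: "z \<in> strip t" for z
  proof -
    have z': "z + of_real T \<in> strip t" using z by (simp add: strip_def)
    have "((\<lambda>z. H (z + of_real T) - H z) has_field_derivative h (z + of_real T) * (1 + 0) - h z) (at z within strip t)"
      by (intro derivative_intros DERIV_chain2[of H] H'[OF z'] has_field_derivative_at_within[OF H'[OF z]])
    then show ?thesis using per[OF z] unfolding D_def by simp
  qed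
  then obtain c where c: "\<And>z. z \<in> strip t \<Longrightarrow> D z = c"
    using has_field_derivative_zero_constant[OF convex_strip] by metis
  have "D (Complex 0 v) = D (Complex 0 0)"
    using v by (subst (1 2) c) (auto simp: strip_def)
  then show ?thesis
    using int[OF v] int[of 0] v by (simp add: D_def Complex_eq)
qed

lemma wave_Complex:
  "wave (of_int d * Complex u v) = of_real (real q powr (- (of_int d * v))) * wave (of_int d * of_real u)"
proof -
  have "of_int d * Complex u v = of_int d * of_real u + \<i> * of_real (of_int d * v)"
    by (simp add: Complex_eq algebra_simps)
  moreover have "wave (\<i> * of_real (of_int d * v)) = of_real (real q powr (- (of_int d * v)))"
    using q2 by (simp add: wave_def powr_def exp_of_real[symmetric] mult_ac)
  ultimately show ?thesis
    by (simp add: wave_add)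
qed

definition fourier_coeff :: "(complex \<Rightarrow> complex) \<Rightarrow> int \<Rightarrow> complex" where
  "fourier_coeff g d = integral {0..tau q} (\<lambda>s. g (of_real s) * wave (of_int d * of_real s)) / of_real (tau q)"

lemma integral_horizontal_wave:
  assumes g: "g holomorphic_on strip t" and per: "\<And>z. z \<in> strip t \<Longrightarrow> g (z + of_real (tau q)) = g z"
    and v: "\<bar>v\<bar> < t"
  shows "integral {0..tau q} (\<lambda>u. g (Complex u v) * wave (of_int d * of_real u))
    = of_real (tau q * real q powr (v * d)) * fourier_coeff g d"
proof -
  define h where "h z = g z * wave (of_int d * z)" for z
  have "h holomorphic_on strip t" unfolding h_def by (intro holomorphic_intros g)
  then have *: "integral {0..tau q} (\<lambda>u. h (Complex u v)) = integral {0..tau q} (\<lambda>u. h (of_real u))"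
    by (rule periodic_contour_shift) (use per v tau_pos in \<open>auto simp: h_def wave_shift\<close>)
  have w: "wave (of_int d * of_real u) = of_real (real q powr (v * d)) * wave (of_int d * Complex u v)" for u
    using q2 by (simp add: wave_Complex powr_minus mult.commute)
  have "integral {0..tau q} (\<lambda>u. g (Complex u v) * wave (of_int d * of_real u))
      = integral {0..tau q} (\<lambda>u. of_real (real q powr (v * d)) * h (Complex u v))"
    unfolding w h_def by (simp add: mult_ac)
  also have "\<dots> = of_real (real q powr (v * d)) * integral {0..tau q} (\<lambda>u. h (of_real u))"
    by (simp add: *)
  finally show ?thesis
    using tau_pos by (simp add: fourier_coeff_def h_def)
qed

text \<open>Reflection maps the period \<open>{0..tau q}\<close> to \<open>{- tau q..0}\<close>, and periodicity moves it back.\<close>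

lemma fourier_coeff_even:
  assumes w: "weyl_invariant_on_strip q t g" and t: "0 < t"
  shows "fourier_coeff g (- d) = fourier_coeff g d"
proof -
  define k where "k s = g (complex_of_real s) * wave (of_int d * of_real s)" for s
  have real: "complex_of_real s \<in> strip t" for s using t by (simp add: strip_def)
  have even: "g (- of_real s) = g (of_real s)" and "g (of_real s + of_real (tau q)) = g (of_real s)" for s
    using w real[of s] unfolding weyl_invariant_on_strip_def by blast+
  then have per: "k (s + tau q) = k s" for s by (simp add: k_def wave_shift)
  have "integral {0..tau q} (\<lambda>s. k (- s)) = integral {- tau q..0} k"
    using Henstock_Kurzweil_Integration.integral_reflect_real[of "tau q" 0 "\<lambda>s. k (- s)"] by simp
  also have "\<dots> = integral {0 - tau q..tau q - tau q} (\<lambda>s. k (s + tau q))"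
    by (simp add: per)
  also have "\<dots> = integral {0..tau q} k"
    by (rule integral_shift_real_ivl)
  finally show ?thesis
    by (simp add: fourier_coeff_def k_def[abs_def] even)
qed

lemma nth_vderiv_wave:
  fixes d :: int
  defines "c \<equiv> \<i> * of_int d * of_real (ln (real q))"
  shows "nth_vderiv n (\<lambda>s. wave (of_int d * of_real s)) = (\<lambda>s. c ^ n * wave (of_int d * of_real s))"
proof (induction n)
  case 0
  show ?case by (simp add: nth_vderiv_def)
next
  case (Suc n)
  have "((\<lambda>s. c ^ n * wave (of_int d * of_real s)) has_vector_derivative
      c ^ n * (c * wave (of_int d * of_real s))) (at s)" for s
    unfolding c_def by (intro has_vector_derivative_mult_right wave_has_vector_derivative)
  then have "vector_derivative (\<lambda>s. c ^ n * wave (of_int d * of_real s)) (at s)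
      = c ^ Suc n * wave (of_int d * of_real s)" for s
    by (simp add: vector_derivative_at mult_ac)
  moreover have "nth_vderiv (Suc n) (\<lambda>s. wave (of_int d * of_real s))
      = (\<lambda>x. vector_derivative (nth_vderiv n (\<lambda>s. wave (of_int d * of_real s))) (at x))"
    by (simp add: nth_vderiv_def)
  ultimately show ?case
    unfolding Suc.IH by (simp only:)
qed

lemma wave_test_function: "(\<lambda>s. wave (of_int d * of_real s)) \<in> test_functions q"
proof -
  have "nth_vderiv n (\<lambda>s. wave (of_int d * of_real s)) differentiable at x" for n x
    unfolding nth_vderiv_wave
    by (rule differentiableI_vector[OF has_vector_derivative_mult_right[OF wave_has_vector_derivative]])
  then show ?thesis
    using wave_shift[of d] by (simp add: test_functions_def)
qed

text \<open>The distribution is tested on a character, for which the integral at height \<open>v\<close> is known for every \<open>v\<close>.\<close>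

lemma inv_fourier_boundary_value:
  assumes g: "g holomorphic_on strip t" and w: "weyl_invariant_on_strip q t g" and t: "0 < t"
    and m: "has_boundary_value q t g m"
  shows "inv_fourier q m d = of_real (real q powr (t * d)) * fourier_coeff g d"
proof -
  define e where "e s = wave (of_int d * of_real s)" for s
  have per: "g (z + of_real (tau q)) = g z" if "z \<in> strip t" for z
    using w that unfolding weyl_invariant_on_strip_def by blast
  have "((\<lambda>v. integral {0..tau q} (\<lambda>u. g (Complex u v) * e u)) \<longlongrightarrow> m e) (at_left t)"
    using m wave_test_function[of d] unfolding has_boundary_value_def e_def[abs_def] by simp
  moreover have "((\<lambda>v. integral {0..tau q} (\<lambda>u. g (Complex u v) * e u))
      \<longlongrightarrow> of_real (tau q * real q powr (t * d)) * fourier_coeff g d) (at_left t)"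
  proof (rule Lim_transform_eventually)
    show "((\<lambda>v. of_real (tau q * real q powr (v * d)) * fourier_coeff g d)
        \<longlongrightarrow> of_real (tau q * real q powr (t * d)) * fourier_coeff g d) (at_left t)"
      using q2 by (intro tendsto_intros) auto
    have "eventually (\<lambda>v. v \<in> {-t<..<t}) (at_left t)"
      using t by (intro eventually_at_left_real) auto
    then show "eventually (\<lambda>v. of_real (tau q * real q powr (v * d)) * fourier_coeff g d
        = integral {0..tau q} (\<lambda>u. g (Complex u v) * e u)) (at_left t)"
      unfolding e_def by eventually_elim (rule integral_horizontal_wave[OF g per, symmetric], auto)
  qed
  ultimately have "m e = of_real (tau q * real q powr (t * d)) * fourier_coeff g d"
    by (intro tendsto_unique) auto
  moreover have "(\<lambda>s. of_nat q powr (\<i> * of_int d * of_real s)) = e"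
    using wave_powr by (simp add: e_def[abs_def] mult.assoc)
  ultimately show ?thesis
    using tau_pos by (simp add: inv_fourier_def)
qed

text \<open>The sequence \<open>b\<close> of the introduction. The denominator is one of the two geometric factors of
\<open>1 / c\<close>; it vanishes only on the line \<open>Im z = - (1 / 2)\<close>.\<close>

definition tail_coeff :: "(complex \<Rightarrow> complex) \<Rightarrow> int \<Rightarrow> complex" where
  "tail_coeff g = fourier_coeff (\<lambda>z. g z / (1 - wave (2 * z) / of_nat q))"

lemma tail_denominator:
  assumes "- (1 / 2) < Im z"
  shows "wave (2 * z) / of_nat q \<noteq> 1"
proof
  assume "wave (2 * z) / of_nat q = 1"
  then have "norm (wave (2 * z)) = real q"
    using q2 by (simp add: field_simps)
  then have "real q powr (- 2 * Im z) = real q powr 1"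
    using q2 by (simp add: norm_wave)
  moreover have "real q powr (- 2 * Im z) < real q powr 1"
    using q2 assms by (intro powr_less_mono) auto
  ultimately show False by simp
qed

lemma fourier_coeff_tail:
  assumes "continuous_on {0..tau q} (\<lambda>s. g (of_real s))"
  shows "fourier_coeff g n = tail_coeff g n - tail_coeff g (n + 2) / of_nat q"
proof -
  define h where "h z = g z / (1 - wave (2 * z) / of_nat q)" for z
  have nz: "1 - wave (2 * of_real s) / of_nat q \<noteq> 0" for s
    using tail_denominator[of "of_real s"] by simp
  have ch: "continuous_on {0..tau q} (\<lambda>s. h (of_real s))"
    unfolding h_def using nz q2 by (intro continuous_intros assms) auto
  have "g (of_real s) * wave (of_int n * of_real s) = h (of_real s) * wave (of_int n * of_real s)
      - h (of_real s) * wave (of_int (n + 2) * of_real s) / of_nat q" for s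
  proof -
    have "g (of_real s) = h (of_real s) * (1 - wave (2 * of_real s) / of_nat q)"
      using nz[of s] by (simp add: h_def)
    moreover have "wave (of_int (n + 2) * of_real s) = wave (of_int n * of_real s) * wave (2 * of_real s)"
      by (simp add: wave_add distrib_right)
    ultimately show ?thesis by (simp only: right_diff_distrib left_diff_distrib mult_1_right mult_1_left mult_ac times_divide_eq_right)
  qed
  then have "integral {0..tau q} (\<lambda>s. g (of_real s) * wave (of_int n * of_real s))
      = integral {0..tau q} (\<lambda>s. h (of_real s) * wave (of_int n * of_real s))
        - integral {0..tau q} (\<lambda>s. h (of_real s) * wave (of_int (n + 2) * of_real s) / of_nat q)"
    using q2 by (simp only:) (intro integral_diff integrable_continuous_interval continuous_intros ch, auto)
  then show ?thesis
    unfolding tail_coeff_def fourier_coeff_def h_def[symmetric] by (simp add: diff_divide_distrib)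
qed

text \<open>At the points where \<open>c\<close> has a pole both sides are \<open>0\<close>, on the left because division by zero gives zero.\<close>

lemma inverse_c_fun:
  "of_real (2 * c_G q) * inverse (c_fun q (- of_real s))
    = (1 - wave (2 * of_real s)) / (1 - wave (2 * of_real s) / of_nat q) / of_real (tau q)"
proof -
  define W where "W = wave (of_real s)"
  define r where "r = complex_of_real (sqrt (real q))"
  have r: "r * r = of_nat q" "r \<noteq> 0"
    using q2 by (auto simp: r_def simp flip: of_real_mult)
  have W: "W \<noteq> 0" by (simp add: W_def)
  have W2: "wave (2 * of_real s) = W * W"
    by (simp add: W_def flip: wave_add)
  have nz: "1 - W * W / of_nat q \<noteq> 0"
    using tail_denominator[of "of_real s"] by (simp add: W2)
  have half: "of_nat q powr (1 / 2) = r"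
    using q2 by (simp add: r_def q_powr powr_half_sqrt[symmetric] powr_def flip: exp_of_real)
  have p3: "of_nat q powr (\<i> * (- of_real s)) = inverse W" "of_nat q powr (- \<i> * (- of_real s)) = W"
    using wave_powr[of "- of_real s"] wave_powr[of "of_real s"] by (simp_all add: W_def wave_minus)
  have p1: "of_nat q powr (1 / 2 + \<i> * (- of_real s)) = r * inverse W"
    unfolding powr_add half p3 ..
  have p2: "of_nat q powr (- 1 / 2 - \<i> * (- of_real s)) = inverse r * W"
  proof -
    have "of_nat q powr (- 1 / 2 - \<i> * (- of_real s)) = of_nat q powr (- (1 / 2) + \<i> * of_real s)"
      by simp
    also have "\<dots> = inverse r * W"
      unfolding powr_add using powr_minus[of "of_nat q" "1 / 2 :: complex"] half
      by (simp add: wave_powr W_def)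
    finally show ?thesis .
  qed
  have c: "c_fun q (- of_real s) = r / (of_nat q + 1) * ((r * inverse W - inverse r * W) / (inverse W - W))"
    unfolding c_fun_def p1 p2 p3 by (simp add: r_def)
  have "r * inverse W - inverse r * W = r * inverse W * (1 - W * W / of_nat q)"
    using r W by (simp add: field_simps flip: r(1))
  moreover have "inverse W - W = inverse W * (1 - W * W)"
    using W by (simp add: field_simps)
  ultimately have "c_fun q (- of_real s) = of_nat q / (of_nat q + 1) * ((1 - W * W / of_nat q) / (1 - W * W))"
    unfolding c using W r(2) by (simp flip: r(1))
  then have "inverse (c_fun q (- of_real s)) = (of_nat q + 1) / of_nat q * ((1 - W * W) / (1 - W * W / of_nat q))"
    by (simp add: inverse_eq_divide)
  moreover have "complex_of_real (2 * c_G q) * ((of_nat q + 1) / of_nat q) = 1 / of_real (tau q)"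
  proof -
    have "2 * c_G q * ((real q + 1) / real q) = 1 / tau q"
      using q2 ln_q_pos by (simp add: c_G_def tau_def divide_simps)
    then have "complex_of_real (2 * c_G q * ((real q + 1) / real q)) = of_real (1 / tau q)" by simp
    then show ?thesis by simp
  qed
  moreover have "of_real (2 * c_G q) * ((of_nat q + 1) / of_nat q * X)
      = of_real (2 * c_G q) * ((of_nat q + 1) / of_nat q) * X" for X :: complex
    by (simp only: mult.assoc)
  ultimately show ?thesis
    unfolding W2 by (simp only:) simp
qed

lemma inversion_integral:
  assumes "continuous_on {0..tau q} (\<lambda>s. g (of_real s))"
  shows "of_real (2 * c_G q) * integral {0..tau q} (\<lambda>s. g (of_real s) * inverse (c_fun q (- of_real s)) *
      of_nat q powr (\<i> * of_real s * of_nat n)) = tail_coeff g (int n) - tail_coeff g (int n + 2)"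
proof -
  define h where "h z = g z / (1 - wave (2 * z) / of_nat q)" for z
  have nz: "1 - wave (2 * of_real s) / of_nat q \<noteq> 0" for s
    using tail_denominator[of "of_real s"] by simp
  have ch: "continuous_on {0..tau q} (\<lambda>s. h (of_real s))"
    unfolding h_def using nz q2 by (intro continuous_intros assms) auto
  have "of_real (2 * c_G q) * (g (of_real s) * inverse (c_fun q (- of_real s)) * of_nat q powr (\<i> * of_real s * of_nat n))
      = (h (of_real s) * wave (of_int (int n) * of_real s)
        - h (of_real s) * wave (of_int (int n + 2) * of_real s)) / of_real (tau q)" for s
  proof -
    have "of_nat q powr (\<i> * of_real s * of_nat n) = wave (of_int (int n) * of_real s)"
      using wave_powr[of "of_real s * of_nat n"] by (simp add: mult_ac)
    moreover have "wave (of_int (int n + 2) * of_real s) = wave (of_int (int n) * of_real s) * wave (2 * of_real s)"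
      by (simp add: wave_add distrib_right)
    moreover have "of_real (2 * c_G q) * (g (of_real s) * inverse (c_fun q (- of_real s)) * E)
        = g (of_real s) * (of_real (2 * c_G q) * inverse (c_fun q (- of_real s))) * E" for E
      by (simp only: mult_ac)
    moreover have "a * ((1 - X) / D / T) * E = (a / D * E - a / D * (E * X)) / T" for a X D T E :: complex
      by (simp add: algebra_simps diff_divide_distrib)
    ultimately show ?thesis
      unfolding inverse_c_fun h_def by (simp only:)
  qed
  then have "of_real (2 * c_G q) * integral {0..tau q} (\<lambda>s. g (of_real s) * inverse (c_fun q (- of_real s)) *
      of_nat q powr (\<i> * of_real s * of_nat n))
      = integral {0..tau q} (\<lambda>s. (h (of_real s) * wave (of_int (int n) * of_real s)
        - h (of_real s) * wave (of_int (int n + 2) * of_real s)) / of_real (tau q))"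
    by (simp only: integral_mult_right[symmetric])
  also have "\<dots> = (integral {0..tau q} (\<lambda>s. h (of_real s) * wave (of_int (int n) * of_real s))
      - integral {0..tau q} (\<lambda>s. h (of_real s) * wave (of_int (int n + 2) * of_real s))) / of_real (tau q)"
    by (subst integral_divide, subst integral_diff)
      (auto intro!: integrable_continuous_interval continuous_intros ch)
  finally show ?thesis
    unfolding tail_coeff_def fourier_coeff_def h_def[symmetric] by (simp add: diff_divide_distrib)
qed

text \<open>The integrand is still holomorphic on the strip, so the contour can be moved to a positive height \<open>v\<close>,
where the coefficient of index \<open>n\<close> carries the factor \<open>q powr (- v * n)\<close>.\<close>

lemma tail_coeff_tendsto_0:
  assumes g: "g holomorphic_on strip t" and per: "\<And>z. z \<in> strip t \<Longrightarrow> g (z + of_real (tau q)) = g z"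
    and t: "0 < t" "t \<le> 1 / 2"
  shows "(\<lambda>n. tail_coeff g (int n)) \<longlonglongrightarrow> 0"
proof -
  define h where "h z = g z / (1 - wave (2 * z) / of_nat q)" for z
  define v where "v = t / 2"
  have v: "\<bar>v\<bar> < t" "0 < v" using t by (auto simp: v_def)
  have nz: "1 - wave (2 * z) / of_nat q \<noteq> 0" if "z \<in> strip t" for z
    using tail_denominator[of z] that t by (auto simp: strip_def)
  have h: "h holomorphic_on strip t"
    unfolding h_def using nz q2 by (intro holomorphic_intros g) auto
  have hper: "h (z + of_real (tau q)) = h z" if "z \<in> strip t" for z
    using per[OF that] wave_shift[of 2 z] by (simp add: h_def)
  define M where "M = integral {0..tau q} (\<lambda>u. norm (h (Complex u v)))"
  have ci: "continuous_on {0..tau q} (\<lambda>u. h (Complex u v))"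
    by (rule continuous_on_horizontal[OF h v(1)])
  have th: "tail_coeff g = fourier_coeff h"
    by (simp add: tail_coeff_def h_def[abs_def])
  have bound: "norm (tail_coeff g (int n)) \<le> M / tau q * (real q powr (- v)) ^ n" for n
  proof -
    have "norm (integral {0..tau q} (\<lambda>u. h (Complex u v) * wave (of_int (int n) * of_real u))) \<le> M"
      unfolding M_def
    proof (rule integral_norm_bound_integral)
      show "norm (h (Complex u v) * wave (of_int (int n) * of_real u)) \<le> norm (h (Complex u v))" for u
        by (simp only: norm_mult norm_wave_real)
    qed (intro integrable_continuous_interval continuous_intros ci)+
    moreover have "integral {0..tau q} (\<lambda>u. h (Complex u v) * wave (of_int (int n) * of_real u))
        = of_real (tau q * real q powr (v * int n)) * tail_coeff g (int n)"
      unfolding th using integral_horizontal_wave[OF h hper v(1), of "int n"] by simp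
    ultimately have "tau q * real q powr (v * int n) * norm (tail_coeff g (int n)) \<le> M"
      using tau_pos by (simp only: norm_mult norm_of_real) simp
    moreover have r: "(real q powr (- v)) ^ n = inverse (real q powr (v * int n))"
      using q2 by (simp add: powr_minus powr_powr power_inverse flip: powr_realpow)
    moreover have "0 < real q powr (v * int n)" using q2 by simp
    ultimately show ?thesis
      unfolding r using tau_pos by (simp add: field_simps)
  qed
  have "real q powr (- v) < 1"
    using q2 v by (simp add: powr_less_one)
  then have "(\<lambda>n. M / tau q * (real q powr (- v)) ^ n) \<longlonglongrightarrow> 0"
    by (intro tendsto_mult_right_zero LIMSEQ_power_zero) auto
  then show ?thesis
    by (rule Lim_null_comparison[rotated]) (use bound in auto)
qed

end

section \<open>Functions on a strip with prescribed coefficients\<close>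

lemma periodic_add_int:
  fixes T :: real
  assumes "\<And>x. f (x + T) = f x"
  shows "f (x + of_int k * T) = f x"
proof (induction k rule: int_induct[where k = 0])
  case (step1 i)
  then show ?case using assms[of "x + of_int i * T"] by (simp add: algebra_simps)
next
  case (step2 i)
  then show ?case using assms[of "x + of_int (i - 1) * T"] by (simp add: algebra_simps)
qed simp

text \<open>Every point can be moved into one compact period.\<close>

lemma periodic_continuous_bounded:
  fixes f :: "real \<Rightarrow> 'a::real_normed_vector"
  assumes per: "\<And>x. f (x + T) = f x" and T: "0 < T" and cont: "continuous_on UNIV f"
  shows "bdd_above (range (\<lambda>x. norm (f x)))"
proof -
  have "bounded (f ` {0..T})"
    by (intro compact_imp_bounded compact_continuous_image continuous_on_subset[OF cont]) auto
  then obtain M where M: "\<And>x. x \<in> {0..T} \<Longrightarrow> norm (f x) \<le> M"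
    unfolding bounded_iff by blast
  have "norm (f x) \<le> M" for x
  proof -
    define k where "k = \<lfloor>x / T\<rfloor>"
    have "of_int k \<le> x / T" "x / T \<le> of_int k + 1"
      unfolding k_def by linarith+
    then have "x + of_int (- k) * T \<in> {0..T}"
      using T by (simp add: field_simps)
    from M[OF this] show ?thesis
      unfolding periodic_add_int[of f T, OF per] .
  qed
  then show ?thesis by (auto intro: bdd_aboveI[of _ M])
qed

context tree_degree
begin

lemma nth_vderiv_Suc: "nth_vderiv (Suc n) f = nth_vderiv n (\<lambda>x. vector_derivative f (at x))"
  unfolding nth_vderiv_def funpow_Suc_right by simp

lemma test_function_has_derivative:
  assumes "f \<in> test_functions q"
  shows "(f has_vector_derivative vector_derivative f (at x)) (at x)"
proof -
  have "nth_vderiv 0 f differentiable at x"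
    using assms unfolding test_functions_def by blast
  then show ?thesis by (simp add: nth_vderiv_def vector_derivative_works)
qed

lemma test_function_continuous: "f \<in> test_functions q \<Longrightarrow> continuous_on A f"
  by (rule continuous_on_vector_derivative)
    (rule has_vector_derivative_at_within[OF test_function_has_derivative])

lemma test_function_periodic: "f \<in> test_functions q \<Longrightarrow> f (x + tau q) = f x"
  by (simp add: test_functions_def)

lemma test_function_derivative:
  assumes f: "f \<in> test_functions q"
  shows "(\<lambda>x. vector_derivative f (at x)) \<in> test_functions q"
proof -
  have "nth_vderiv n (\<lambda>x. vector_derivative f (at x)) differentiable at x" for n x
    using f unfolding test_functions_def nth_vderiv_Suc[symmetric] by blast
  moreover have "vector_derivative f (at (x + tau q)) = vector_derivative f (at x)" for x
  proof -
    have "((f \<circ> (\<lambda>x. x + tau q)) has_vector_derivative (1 + 0) *\<^sub>R vector_derivative f (at (x + tau q))) (at x)"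
      by (intro vector_diff_chain_at test_function_has_derivative[OF f] derivative_intros)
    moreover have "f \<circ> (\<lambda>x. x + tau q) = f"
      using test_function_periodic[OF f] by auto
    ultimately show ?thesis
      by (simp add: vector_derivative_at)
  qed
  ultimately show ?thesis
    unfolding test_functions_def by simp
qed

lemma test_function_nth_vderiv: "f \<in> test_functions q \<Longrightarrow> nth_vderiv n f \<in> test_functions q"
proof (induction n arbitrary: f)
  case 0
  then show ?case by (simp add: nth_vderiv_def)
next
  case (Suc n)
  then show ?case using test_function_derivative by (simp add: nth_vderiv_Suc)
qed

lemma test_function_le_SUP:
  assumes "f \<in> test_functions q"
  shows "norm (f x) \<le> (SUP u. norm (f u))"
  by (intro cSUP_upper UNIV_I
      periodic_continuous_bounded[OF test_function_periodic[OF assms] tau_pos test_function_continuous[OF assms]])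

definition wave_integral :: "(real \<Rightarrow> complex) \<Rightarrow> int \<Rightarrow> complex" where
  "wave_integral f d = integral {0..tau q} (\<lambda>u. f u * wave (of_int d * of_real u))"

lemma wave_integral_norm_le:
  assumes "continuous_on {0..tau q} f" "\<And>u. norm (f u) \<le> M"
  shows "norm (wave_integral f d) \<le> M * tau q"
proof -
  have "norm (wave_integral f d) \<le> M * (tau q - 0)"
    unfolding wave_integral_def
  proof (rule integral_bound)
    show "norm (f u * wave (of_int d * of_real u)) \<le> M" for u
      using assms(2)[of u] by (simp only: norm_mult norm_wave_real mult_1_right)
  qed (use tau_pos in \<open>auto intro!: continuous_intros assms(1)\<close>)
  then show ?thesis by simp
qed

text \<open>Integration by parts; the boundary terms cancel by periodicity.\<close>

lemma wave_integral_derivative: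
  assumes f: "f \<in> test_functions q"
  shows "wave_integral (\<lambda>x. vector_derivative f (at x)) d
    = - (\<i> * of_int d * of_real (ln (real q))) * wave_integral f d"
proof -
  define c where "c = \<i> * of_int d * complex_of_real (ln (real q))"
  define e where "e s = wave (of_int d * of_real s)" for s
  have e: "(e has_vector_derivative c * e u) (at u within A)" for u A
    unfolding c_def e_def[abs_def] by (rule wave_has_vector_derivative)
  have ec: "continuous_on {0..tau q} e" unfolding e_def[abs_def] by (intro continuous_intros)
  have fc: "continuous_on {0..tau q} f" "continuous_on {0..tau q} (\<lambda>x. vector_derivative f (at x))"
    using f test_function_derivative[OF f] by (auto intro: test_function_continuous)
  have "((\<lambda>u. f u * (c * e u) + vector_derivative f (at u) * e u) has_integral f (tau q) * e (tau q) - f 0 * e 0) {0..tau q}"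
    using tau_pos
    by (intro fundamental_theorem_of_calculus has_vector_derivative_mult e
        has_vector_derivative_at_within[OF test_function_has_derivative[OF f]]) auto
  moreover have "f (tau q) * e (tau q) = f 0 * e 0"
    using test_function_periodic[OF f, of 0] wave_shift[of d 0] by (simp add: e_def)
  ultimately have "0 = integral {0..tau q} (\<lambda>u. f u * (c * e u) + vector_derivative f (at u) * e u)"
    by (simp add: integral_unique)
  also have "\<dots> = integral {0..tau q} (\<lambda>u. c * (f u * e u)) + integral {0..tau q} (\<lambda>u. vector_derivative f (at u) * e u)"
    by (subst integral_add[symmetric])
      (auto intro!: integrable_continuous_interval continuous_intros fc ec simp: mult_ac)
  also have "\<dots> = c * wave_integral f d + wave_integral (\<lambda>x. vector_derivative f (at x)) d"
    by (simp add: wave_integral_def e_def)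
  finally show ?thesis
    unfolding c_def[symmetric] by (simp add: eq_neg_iff_add_eq_0 add.commute)
qed

text \<open>A summable majorant of the Fourier coefficients of a test function; its value at \<open>0\<close> is \<open>1\<close> since
\<open>inverse 0 = 0\<close>.\<close>

definition decay :: "nat \<Rightarrow> real" where
  "decay n = (if n = 0 then 1 else 0) + inverse (real n ^ 2)"

lemma summable_decay: "summable decay"
  unfolding decay_def[abs_def] by (intro summable_add summable_single inverse_power_summable) auto

lemma decay_nonneg: "0 \<le> decay n"
  by (simp add: decay_def)

definition seminorm2 :: "(real \<Rightarrow> complex) \<Rightarrow> real" where
  "seminorm2 f = tau q * (1 + inverse (ln (real q) ^ 2)) * (\<Sum>j\<le>2. SUP u. norm (nth_vderiv j f u))"

text \<open>Two integrations by parts.\<close>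

lemma wave_integral_decay:
  assumes f: "f \<in> test_functions q"
  shows "norm (wave_integral f d) \<le> seminorm2 f * decay (nat \<bar>d\<bar>)"
proof -
  define N where "N j = (SUP u. norm (nth_vderiv j f u))" for j
  have N: "norm (nth_vderiv j f u) \<le> N j" for j u
    unfolding N_def by (rule test_function_le_SUP[OF test_function_nth_vderiv[OF f]])
  have N0: "0 \<le> N j" for j using N[of j 0] norm_ge_zero order_trans by blast
  have le: "N j \<le> (\<Sum>j\<le>2. N j)" if "j \<le> 2" for j
    using that N0 by (intro member_le_sum) auto
  have b: "norm (wave_integral (nth_vderiv j f) d) \<le> N j * tau q" for j
    by (rule wave_integral_norm_le[OF test_function_continuous[OF test_function_nth_vderiv[OF f]] N])
  have L: "0 < ln (real q)" by (rule ln_q_pos)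
  show ?thesis
  proof (cases "d = 0")
    case True
    have "norm (wave_integral f d) \<le> N 0 * tau q"
      using b[of 0] by (simp add: nth_vderiv_def)
    also have "\<dots> \<le> (\<Sum>j\<le>2. N j) * tau q"
      using le[of 0] tau_pos by (intro mult_right_mono) auto
    also have "\<dots> \<le> (\<Sum>j\<le>2. N j) * tau q * (1 + inverse (ln (real q) ^ 2))"
    proof -
      have "0 \<le> (\<Sum>j\<le>2. N j) * tau q * inverse (ln (real q) ^ 2)"
        using tau_pos N0 by (intro mult_nonneg_nonneg sum_nonneg) auto
      then show ?thesis by (simp add: distrib_left)
    qed
    finally show ?thesis using True by (simp add: decay_def seminorm2_def N_def mult_ac)
  next
    case False
    have "nth_vderiv 2 f = (\<lambda>x. vector_derivative (\<lambda>x. vector_derivative f (at x)) (at x))"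
      by (simp add: nth_vderiv_def numeral_2_eq_2)
    then have "wave_integral (nth_vderiv 2 f) d = (\<i> * of_int d * of_real (ln (real q)))\<^sup>2 * wave_integral f d"
      using wave_integral_derivative[OF test_function_derivative[OF f]] wave_integral_derivative[OF f]
      by (simp add: power2_eq_square)
    then have "norm (wave_integral (nth_vderiv 2 f) d) = (\<bar>d\<bar> * ln (real q))\<^sup>2 * norm (wave_integral f d)"
      using L by (simp add: norm_mult norm_power)
    then have "norm (wave_integral f d) = norm (wave_integral (nth_vderiv 2 f) d) * inverse ((\<bar>d\<bar> * ln (real q))\<^sup>2)"
      using False L by simp
    also have "\<dots> \<le> N 2 * tau q * inverse ((\<bar>d\<bar> * ln (real q))\<^sup>2)"
      by (intro mult_right_mono b) auto
    also have "\<dots> = N 2 * tau q * inverse (ln (real q) ^ 2) * decay (nat \<bar>d\<bar>)"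
      using False by (simp add: decay_def power_mult_distrib)
    also have "\<dots> \<le> (\<Sum>j\<le>2. N j) * tau q * (1 + inverse (ln (real q) ^ 2)) * decay (nat \<bar>d\<bar>)"
      using le[of 2] tau_pos decay_nonneg N0 by (intro mult_right_mono mult_mono mult_nonneg_nonneg sum_nonneg) auto
    finally show ?thesis by (simp add: seminorm2_def N_def mult_ac)
  qed
qed

lemma wave_integral_wave:
  "wave_integral (\<lambda>u. wave (of_int d * of_real u)) n = (if n + d = 0 then of_real (tau q) else 0)"
proof -
  have "wave_integral (\<lambda>u. wave (of_int d * of_real u)) n = wave_integral (\<lambda>_. 1) (n + d)"
  proof -
    have "wave (of_int d * of_real u) * wave (of_int n * of_real u) = 1 * wave (of_int (n + d) * of_real u)" for u
      by (simp add: distrib_right wave_add)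
    then show ?thesis
      unfolding wave_integral_def by (simp only:)
  qed
  also have "\<dots> = (if n + d = 0 then of_real (tau q) else 0)"
  proof (cases "n + d = 0")
    case True
    then show ?thesis using tau_pos unfolding wave_integral_def True by (simp add: scaleR_conv_of_real)
  next
    case False
    have "(\<lambda>_. 1) \<in> test_functions q" using wave_test_function[of 0] by simp
    from wave_integral_derivative[OF this, of "n + d"] have "wave_integral (\<lambda>_. 1) (n + d) = 0"
      using False ln_q_pos q2 by (simp add: wave_integral_def del: of_int_add)
    then show ?thesis using False by simp
  qed
  finally show ?thesis .
qed

context
  fixes G :: "nat \<Rightarrow> complex" and B t :: real
  assumes t: "0 < t" and G: "\<And>n. norm (G n) \<le> B * real q powr (- (t * n))"
begin

lemma coefficient_bound_nonneg: "0 \<le> B"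
  using order_trans[OF norm_ge_zero G[of 0]] q2 by simp

definition half_series :: "complex \<Rightarrow> complex" where
  "half_series w = (\<Sum>n. G n * w ^ n)"

text \<open>The sum of \<open>G \<bar>d\<bar> * q powr (- \<i> * d * z)\<close> over all integers \<open>d\<close>. The index \<open>0\<close> occurs in both halves
and is subtracted once.\<close>

definition cosine_series :: "complex \<Rightarrow> complex" where
  "cosine_series z = half_series (wave z) + half_series (wave (- z)) - G 0"

lemma half_series_sums:
  assumes "norm w < real q powr t"
  shows "(\<lambda>n. G n * w ^ n) sums half_series w"
  unfolding half_series_def
proof (rule summable_sums, rule summable_comparison_test')
  define r where "r = real q powr (- t) * norm w"
  have "r < real q powr (- t) * real q powr t"
    unfolding r_def using assms q2 by (intro mult_strict_left_mono) auto
  also have "\<dots> = 1" using q2 by (simp flip: powr_add)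
  finally show "summable (\<lambda>n. B * r ^ n)"
    using q2 by (intro summable_mult) (simp add: r_def)
  fix n
  have "norm (G n * w ^ n) \<le> B * real q powr (- (t * n)) * norm w ^ n"
    using G[of n] by (simp add: norm_mult norm_power mult_right_mono)
  also have "real q powr (- (t * n)) = (real q powr (- t)) ^ n"
    using q2 by (simp add: powr_powr flip: powr_realpow)
  finally show "norm (G n * w ^ n) \<le> B * r ^ n"
    by (simp add: r_def power_mult_distrib mult.assoc)
qed

lemma wave_in_ball: "z \<in> strip t \<Longrightarrow> wave z \<in> ball 0 (real q powr t)"
  using q2 by (auto simp: norm_wave strip_def intro!: powr_less_mono)

lemma cosine_series_holomorphic: "cosine_series holomorphic_on strip t"
proof -
  have hol: "half_series holomorphic_on ball 0 (real q powr t)"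
    by (rule power_series_holomorphic[of _ _ G]) (use half_series_sums in auto)
  have "half_series \<circ> wave holomorphic_on strip t"
    by (intro holomorphic_on_compose_gen[OF _ hol] holomorphic_intros)
      (use wave_in_ball in \<open>auto intro: holomorphic_on_wave[OF holomorphic_on_ident]\<close>)
  moreover have "half_series \<circ> (\<lambda>z. wave (- z)) holomorphic_on strip t"
  proof (intro holomorphic_on_compose_gen[OF _ hol] holomorphic_intros)
    show "(\<lambda>z. wave (- z)) ` strip t \<subseteq> ball 0 (real q powr t)"
      using wave_in_ball[of "- z" for z] by (auto simp: strip_def)
  qed
  ultimately have "(\<lambda>z. (half_series \<circ> wave) z + (half_series \<circ> (\<lambda>z. wave (- z))) z - G 0) holomorphic_on strip t"
    by (intro holomorphic_intros)
  then show ?thesis by (simp add: cosine_series_def[abs_def])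
qed

lemma cosine_series_weyl_invariant: "weyl_invariant_on_strip q t cosine_series"
  using wave_shift[of 1] wave_shift[of "- 1"]
  by (simp add: weyl_invariant_on_strip_def cosine_series_def)

lemma half_series_integral:
  assumes v: "\<bar>v\<bar> < t" and \<sigma>: "\<sigma> \<in> {1, - 1}" and f: "continuous_on {0..tau q} f"
  shows "(\<lambda>n. G n * of_real (real q powr (- (of_int (\<sigma> * int n) * v))) * wave_integral f (\<sigma> * int n)) sums
    integral {0..tau q} (\<lambda>u. half_series (wave (of_int \<sigma> * Complex u v)) * f u)"
proof -
  define F where "F n u = G n * wave (of_int \<sigma> * Complex u v) ^ n * f u" for n u
  have in_strip: "of_int \<sigma> * Complex u v \<in> strip t" for u
    using v \<sigma> by (auto simp: strip_def)
  have sums: "(\<lambda>n. F n u) sums (half_series (wave (of_int \<sigma> * Complex u v)) * f u)" for u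
    unfolding F_def by (intro sums_mult2 half_series_sums) (use wave_in_ball[OF in_strip] in simp)
  have wn: "wave (of_int \<sigma> * Complex u v) ^ n
      = of_real (real q powr (- (of_int (\<sigma> * int n) * v))) * wave (of_int (\<sigma> * int n) * of_real u)" for n u
    using wave_of_nat[of n "of_int \<sigma> * Complex u v"] wave_Complex[of "\<sigma> * int n" u v] by (simp add: mult_ac)
  obtain M where M: "\<And>u. u \<in> {0..tau q} \<Longrightarrow> norm (f u) \<le> M"
    using compact_imp_bounded[OF compact_continuous_image[OF f compact_Icc]]
    unfolding bounded_iff by blast
  define r where "r = real q powr (- (t + \<sigma> * v))"
  have r: "0 < r" "r < 1"
    using q2 v \<sigma> by (auto simp: r_def intro!: powr_less_one)
  have cont: "continuous_on {0..tau q} (F n)" for n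
    unfolding F_def wn by (intro continuous_intros f)
  have bound: "norm (F n u) \<le> B * M * r ^ n" if u: "u \<in> {0..tau q}" for n u
  proof -
    have "norm (F n u) = norm (G n) * real q powr (- (of_int (\<sigma> * int n) * v)) * norm (f u)"
      unfolding F_def wn norm_mult norm_wave_real by simp
    also have "\<dots> \<le> B * real q powr (- (t * n)) * real q powr (- (of_int (\<sigma> * int n) * v)) * M"
      using G[of n] M[OF u] coefficient_bound_nonneg by (intro mult_mono) auto
    also have "real q powr (- (t * n)) * real q powr (- (of_int (\<sigma> * int n) * v)) = r ^ n"
      using q2 by (simp add: r_def powr_powr algebra_simps flip: powr_add powr_realpow)
    then have "B * real q powr (- (t * n)) * real q powr (- (of_int (\<sigma> * int n) * v)) * M = B * M * r ^ n"
      by (metis mult.assoc mult.commute)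
    finally show ?thesis .
  qed
  have "(\<lambda>n. integral {0..tau q} (F n)) sums integral {0..tau q} (\<lambda>u. \<Sum>n. F n u)"
    by (rule integral_suminf_sums[OF cont bound]) (use r in \<open>auto intro!: summable_mult\<close>)
  moreover have "integral {0..tau q} (F n)
      = G n * of_real (real q powr (- (of_int (\<sigma> * int n) * v))) * wave_integral f (\<sigma> * int n)" for n
  proof -
    have "F n = (\<lambda>u. G n * of_real (real q powr (- (of_int (\<sigma> * int n) * v))) * (f u * wave (of_int (\<sigma> * int n) * of_real u)))"
      unfolding F_def wn by (simp only: mult_ac)
    then show ?thesis by (simp add: wave_integral_def)
  qed
  moreover have "(\<lambda>u. \<Sum>n. F n u) = (\<lambda>u. half_series (wave (of_int \<sigma> * Complex u v)) * f u)"
    using sums by (simp add: sums_iff)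
  ultimately show ?thesis by simp
qed

text \<open>The sign \<open>\<sigma>\<close> selects the half of \<open>cosine_series\<close>; the series of these terms is the integral of that half
against \<open>f\<close> at height \<open>v\<close>.\<close>

definition boundary_term :: "int \<Rightarrow> real \<Rightarrow> (real \<Rightarrow> complex) \<Rightarrow> nat \<Rightarrow> complex" where
  "boundary_term \<sigma> v f n = G n * of_real (real q powr (- (of_int (\<sigma> * int n) * v))) * wave_integral f (\<sigma> * int n)"

lemma cosine_series_integral:
  assumes v: "\<bar>v\<bar> < t" and f: "continuous_on {0..tau q} f"
  shows "integral {0..tau q} (\<lambda>u. cosine_series (Complex u v) * f u)
    = (\<Sum>n. boundary_term 1 v f n) + (\<Sum>n. boundary_term (- 1) v f n) - G 0 * wave_integral f 0"
proof -
  have strip: "Complex u v \<in> strip t" "- Complex u v \<in> strip t" for u using v by (auto simp: strip_def)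
  have hol: "half_series holomorphic_on ball 0 (real q powr t)"
    by (rule power_series_holomorphic[of _ _ G]) (use half_series_sums in auto)
  have c: "continuous_on {0..tau q} (\<lambda>u. half_series (wave (of_int \<sigma> * Complex u v)))" if "\<sigma> \<in> {1, - 1}" for \<sigma>
  proof (rule continuous_on_compose2[OF holomorphic_on_imp_continuous_on[OF hol]])
    show "continuous_on {0..tau q} (\<lambda>u. wave (of_int \<sigma> * Complex u v))"
      unfolding Complex_eq by (intro continuous_intros)
    show "(\<lambda>u. wave (of_int \<sigma> * Complex u v)) ` {0..tau q} \<subseteq> ball 0 (real q powr t)"
      using that wave_in_ball[OF strip(1)] wave_in_ball[OF strip(2)] by auto
  qed
  have "integral {0..tau q} (\<lambda>u. cosine_series (Complex u v) * f u)
      = integral {0..tau q} (\<lambda>u. half_series (wave (of_int 1 * Complex u v)) * f u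
          + half_series (wave (of_int (- 1) * Complex u v)) * f u - G 0 * f u)"
    by (simp add: cosine_series_def ring_distribs)
  also have "\<dots> = integral {0..tau q} (\<lambda>u. half_series (wave (of_int 1 * Complex u v)) * f u)
      + integral {0..tau q} (\<lambda>u. half_series (wave (of_int (- 1) * Complex u v)) * f u)
      - integral {0..tau q} (\<lambda>u. G 0 * f u)"
    by (subst integral_diff; (subst integral_add)?)
      (auto intro!: integrable_continuous_interval continuous_intros f c simp del: of_int_1 of_int_minus)
  also have "\<dots> = (\<Sum>n. boundary_term 1 v f n) + (\<Sum>n. boundary_term (- 1) v f n) - G 0 * wave_integral f 0"
    using sums_unique[OF half_series_integral[OF v _ f, of 1]] sums_unique[OF half_series_integral[OF v _ f, of "- 1"]]
    by (simp add: boundary_term_def[abs_def] wave_integral_def)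
  finally show ?thesis .
qed

lemma fourier_coeff_cosine_series: "fourier_coeff cosine_series d = G (nat \<bar>d\<bar>)"
proof -
  define e where "e u = wave (of_int d * of_real u)" for u
  have e: "continuous_on {0..tau q} e" unfolding e_def[abs_def] by (intro continuous_intros)
  have coeff: "boundary_term \<sigma> 0 e n = G n * (if \<sigma> * int n + d = 0 then of_real (tau q) else 0)" for \<sigma> n
    unfolding boundary_term_def e_def[abs_def] wave_integral_wave using q2 by simp
  have "boundary_term 1 0 e = (\<lambda>n. if n = nat (- d) then if d \<le> 0 then G n * of_real (tau q) else 0 else 0)"
    unfolding coeff by (intro ext) auto
  then have s1: "(\<Sum>n. boundary_term 1 0 e n) = (if d \<le> 0 then G (nat (- d)) * of_real (tau q) else 0)"
    using sums_unique[OF sums_single[of "nat (- d)" "\<lambda>n. if d \<le> 0 then G n * of_real (tau q) else 0"]] by simp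
  have "boundary_term (- 1) 0 e = (\<lambda>n. if n = nat d then if 0 \<le> d then G n * of_real (tau q) else 0 else 0)"
    unfolding coeff by (intro ext) auto
  then have s2: "(\<Sum>n. boundary_term (- 1) 0 e n) = (if 0 \<le> d then G (nat d) * of_real (tau q) else 0)"
    using sums_unique[OF sums_single[of "nat d" "\<lambda>n. if 0 \<le> d then G n * of_real (tau q) else 0"]] by simp
  have s3: "wave_integral e 0 = (if d = 0 then of_real (tau q) else 0)"
    unfolding e_def[abs_def] wave_integral_wave by simp
  have "integral {0..tau q} (\<lambda>u. cosine_series (Complex u 0) * e u) = G (nat \<bar>d\<bar>) * of_real (tau q)"
    unfolding cosine_series_integral[OF _ e, of 0, simplified, OF t] s1 s2 s3
    by (cases "d = 0"; cases "0 \<le> d") auto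
  then show ?thesis
    using tau_pos by (simp add: fourier_coeff_def e_def Complex_eq)
qed

definition boundary_functional :: "(real \<Rightarrow> complex) \<Rightarrow> complex" where
  "boundary_functional f
    = (\<Sum>n. boundary_term 1 t f n) + (\<Sum>n. boundary_term (- 1) t f n) - G 0 * wave_integral f 0"

text \<open>On the half that grows with the height, the growth \<open>q powr (t * n)\<close> is exactly compensated by the
decay of \<open>G\<close>; the test function makes the series converge.\<close>

lemma boundary_term_bound:
  assumes \<sigma>: "\<sigma> \<in> {1, - 1}" and v: "\<bar>v\<bar> \<le> t" and f: "f \<in> test_functions q"
  shows "norm (boundary_term \<sigma> v f n) \<le> B * seminorm2 f * decay n"
proof -
  note B = coefficient_bound_nonneg
  have "norm (boundary_term \<sigma> v f n)
      = (norm (G n) * real q powr (- (of_int (\<sigma> * int n) * v))) * norm (wave_integral f (\<sigma> * int n))"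
    by (simp add: boundary_term_def norm_mult)
  also have "\<dots> \<le> B * (seminorm2 f * decay n)"
  proof (rule mult_mono)
    have "norm (G n) * real q powr (- (of_int (\<sigma> * int n) * v))
        \<le> B * real q powr (- (t * n)) * real q powr (- (of_int (\<sigma> * int n) * v))"
      by (intro mult_right_mono G) auto
    also have "\<dots> = B * real q powr (- (n * (t + \<sigma> * v)))"
      using q2 by (simp add: algebra_simps flip: powr_add)
    also have "\<dots> \<le> B * 1"
    proof (rule mult_left_mono[OF _ B])
      have "real q powr (- (n * (t + \<sigma> * v))) \<le> real q powr 0"
        using q2 v \<sigma> by (intro powr_mono) auto
      then show "real q powr (- (n * (t + \<sigma> * v))) \<le> 1" using q2 by simp
    qed
    finally show "norm (G n) * real q powr (- (of_int (\<sigma> * int n) * v)) \<le> B" by simp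
    show "norm (wave_integral f (\<sigma> * int n)) \<le> seminorm2 f * decay n"
      using wave_integral_decay[OF f, of "\<sigma> * int n"] \<sigma> by (auto simp: abs_mult)
  qed (use B in auto)
  finally show ?thesis by (simp add: mult.assoc)
qed

lemma summable_boundary_term:
  assumes "\<sigma> \<in> {1, - 1}" "f \<in> test_functions q"
  shows "summable (boundary_term \<sigma> t f)"
  by (rule summable_comparison_test'[where g = "\<lambda>n. B * seminorm2 f * decay n" and N = 0])
    (use boundary_term_bound[OF assms(1) _ assms(2)] t summable_decay in \<open>auto intro: summable_mult\<close>)

lemma torus_distribution_boundary_functional: "torus_distribution q boundary_functional"
proof -
  have integrable: "(\<lambda>u. f u * wave (of_int d * of_real u)) integrable_on {0..tau q}"
    if "f \<in> test_functions q" for f d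
    by (intro integrable_continuous_interval continuous_intros test_function_continuous[OF that])
  have w_add: "wave_integral (\<lambda>u. f u + g u) d = wave_integral f d + wave_integral g d"
    if "f \<in> test_functions q" "g \<in> test_functions q" for f g d
    unfolding wave_integral_def distrib_right by (intro integral_add integrable that)
  have w_mult: "wave_integral (\<lambda>u. a * f u) d = a * wave_integral f d" for a f d
    by (simp add: wave_integral_def mult.assoc)
  have add: "boundary_functional (\<lambda>u. f u + g u) = boundary_functional f + boundary_functional g"
    if f: "f \<in> test_functions q" and g: "g \<in> test_functions q" for f g
  proof -
    have "boundary_term \<sigma> t (\<lambda>u. f u + g u) = (\<lambda>n. boundary_term \<sigma> t f n + boundary_term \<sigma> t g n)" for \<sigma>
      by (simp add: boundary_term_def[abs_def] w_add[OF f g] distrib_left)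
    moreover have "(\<Sum>n. boundary_term \<sigma> t f n + boundary_term \<sigma> t g n)
        = (\<Sum>n. boundary_term \<sigma> t f n) + (\<Sum>n. boundary_term \<sigma> t g n)" if "\<sigma> \<in> {1, - 1}" for \<sigma>
      by (rule suminf_add[symmetric]) (intro summable_boundary_term that f g)+
    ultimately show ?thesis
      by (simp add: boundary_functional_def w_add[OF f g] distrib_left)
  qed
  have mult: "boundary_functional (\<lambda>u. a * f u) = a * boundary_functional f"
    if f: "f \<in> test_functions q" for a f
  proof -
    have "boundary_term \<sigma> t (\<lambda>u. a * f u) = (\<lambda>n. a * boundary_term \<sigma> t f n)" for \<sigma>
      by (simp add: boundary_term_def[abs_def] w_mult mult_ac)
    moreover have "(\<Sum>n. a * boundary_term \<sigma> t f n) = a * (\<Sum>n. boundary_term \<sigma> t f n)" if "\<sigma> \<in> {1, - 1}" for \<sigma>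
      by (rule suminf_mult) (intro summable_boundary_term that f)
    ultimately show ?thesis
      by (simp add: boundary_functional_def w_mult algebra_simps)
  qed
  have bound: "norm (boundary_functional f)
      \<le> (B * suminf decay + B * suminf decay + norm (G 0)) * seminorm2 f"
    if f: "f \<in> test_functions q" for f
  proof -
    have half: "norm (\<Sum>n. boundary_term \<sigma> t f n) \<le> B * suminf decay * seminorm2 f" if "\<sigma> \<in> {1, - 1}" for \<sigma>
    proof -
      have s: "summable (\<lambda>n. B * seminorm2 f * decay n)" by (intro summable_mult summable_decay)
      have "norm (\<Sum>n. boundary_term \<sigma> t f n) \<le> (\<Sum>n. B * seminorm2 f * decay n)"
        using boundary_term_bound[OF that _ f, of t] t by (intro norm_suminf_le s) auto
      also have "\<dots> = B * seminorm2 f * suminf decay"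
        by (intro suminf_mult summable_decay)
      finally show ?thesis by (simp add: mult_ac)
    qed
    have "norm (wave_integral f 0) \<le> seminorm2 f"
      using wave_integral_decay[OF f, of 0] by (simp add: decay_def)
    then have "norm (G 0 * wave_integral f 0) \<le> norm (G 0) * seminorm2 f"
      by (simp add: norm_mult mult_left_mono)
    moreover have "norm (boundary_functional f) \<le> norm (\<Sum>n. boundary_term 1 t f n)
        + norm (\<Sum>n. boundary_term (- 1) t f n) + norm (G 0 * wave_integral f 0)"
      unfolding boundary_functional_def
      by (rule order_trans[OF norm_triangle_ineq4 add_right_mono[OF norm_triangle_ineq]])
    ultimately show ?thesis
      using half[of 1] half[of "- 1"] by (simp add: algebra_simps)
  qed
  show ?thesis
    unfolding torus_distribution_def
  proof (intro conjI ballI allI exI)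
    fix f assume "f \<in> test_functions q"
    from bound[OF this] show "norm (boundary_functional f)
        \<le> (B * suminf decay + B * suminf decay + norm (G 0)) * (tau q * (1 + inverse (ln (real q) ^ 2)))
          * (\<Sum>j\<le>2. SUP u. norm (nth_vderiv j f u))"
      by (simp add: seminorm2_def mult.assoc)
  qed (use add mult in auto)
qed

text \<open>Dominated convergence for series, with the majorant of \<open>boundary_term_bound\<close>.\<close>

lemma cosine_series_boundary_value: "has_boundary_value q t cosine_series boundary_functional"
  unfolding has_boundary_value_def
proof (intro conjI ballI torus_distribution_boundary_functional)
  fix f assume f: "f \<in> test_functions q"
  have ev: "eventually (\<lambda>v. v \<in> {- t<..<t}) (at_left t)"
    using t by (intro eventually_at_left_real) auto
  have lim: "((\<lambda>v. \<Sum>n. boundary_term \<sigma> v f n) \<longlongrightarrow> (\<Sum>n. boundary_term \<sigma> t f n)) (at_left t)"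
    if \<sigma>: "\<sigma> \<in> {1, - 1}" for \<sigma>
  proof (rule tannerys_theorem[THEN conjunct2, THEN conjunct2])
    show "((\<lambda>v. boundary_term \<sigma> v f n) \<longlongrightarrow> boundary_term \<sigma> t f n) (at_left t)" for n
      unfolding boundary_term_def using q2 by (intro tendsto_intros) auto
    have "\<forall>\<^sub>F v in at_left t. \<forall>n. norm (boundary_term \<sigma> v f n) \<le> B * seminorm2 f * decay n"
      using ev by eventually_elim (auto intro!: boundary_term_bound[OF \<sigma> _ f])
    then show "\<forall>\<^sub>F (n, v) in at_top \<times>\<^sub>F at_left t. norm (boundary_term \<sigma> v f n) \<le> B * seminorm2 f * decay n"
      unfolding eventually_prod_filter 
      by (intro exI[of _ "\<lambda>_. True"] exI[of _ "\<lambda>v. \<forall>n. norm (boundary_term \<sigma> v f n) \<le> B * seminorm2 f * decay n"]) auto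
    show "summable (\<lambda>n. B * seminorm2 f * decay n)"
      by (intro summable_mult summable_decay)
  qed simp
  have "((\<lambda>v. (\<Sum>n. boundary_term 1 v f n) + (\<Sum>n. boundary_term (- 1) v f n) - G 0 * wave_integral f 0)
      \<longlongrightarrow> boundary_functional f) (at_left t)"
    unfolding boundary_functional_def by (intro tendsto_intros lim) auto
  then show "((\<lambda>v. integral {0..tau q} (\<lambda>u. cosine_series (Complex u v) * f u)) \<longlongrightarrow> boundary_functional f) (at_left t)"
  proof (rule Lim_transform_eventually)
    show "\<forall>\<^sub>F v in at_left t. (\<Sum>n. boundary_term 1 v f n) + (\<Sum>n. boundary_term (- 1) v f n) - G 0 * wave_integral f 0
        = integral {0..tau q} (\<lambda>u. cosine_series (Complex u v) * f u)"
      using ev by eventually_elim (auto intro!: cosine_series_integral[symmetric] test_function_continuous[OF f])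
  qed
qed

end

lemma exists_boundary_function:
  fixes G :: "nat \<Rightarrow> complex"
  assumes "0 < t" and "\<And>n. norm (G n) \<le> B * real q powr (- (t * n))"
  shows "\<exists>g m. g holomorphic_on strip t \<and> weyl_invariant_on_strip q t g \<and>
    has_boundary_value q t g m \<and> (\<forall>d. fourier_coeff g d = G (nat \<bar>d\<bar>))"
  using cosine_series_holomorphic[OF assms] cosine_series_weyl_invariant[OF assms]
    cosine_series_boundary_value[OF assms] fourier_coeff_cosine_series[OF assms] by blast

end

section \<open>The multiplier theorem\<close>

lemma lp_opnorm_le_scaled:
  assumes "lp_bounded p A'" "0 < C" "\<And>B. lp_bound p A' B \<Longrightarrow> lp_bound p A (C * B)"
  shows "lp_opnorm p A \<le> C * lp_opnorm p A'"
proof -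
  have bdd: "bdd_below {B. lp_bound p A B}"
    by (rule bdd_belowI[of _ 0]) (simp add: lp_bound_def)
  have "lp_opnorm p A / C \<le> B" if "lp_bound p A' B" for B
  proof -
    have "lp_opnorm p A \<le> C * B"
      unfolding lp_opnorm_def using bdd assms(3)[OF that] by (intro cInf_lower) auto
    then show ?thesis using assms(2) by (simp add: field_simps)
  qed
  then have "lp_opnorm p A / C \<le> lp_opnorm p A'"
    unfolding lp_opnorm_def[of p A'] using assms(1) by (intro cInf_greatest) (auto simp: lp_bounded_def)
  then show ?thesis using assms(2) by (simp add: field_simps)
qed

text \<open>The smaller one of \<open>p\<close> and its conjugate exponent; \<open>delta\<close> is the same for both.\<close>

definition small_exponent :: "real \<Rightarrow> real" where
  "small_exponent p = (if p < 2 then p else p / (p - 1))"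

lemma small_exponent_props:
  assumes "1 \<le> p" "p \<noteq> 2"
  shows "1 \<le> small_exponent p" "small_exponent p < 2" "1 / small_exponent p = delta p + 1 / 2"
    "0 < delta p" "delta p \<le> 1 / 2"
proof -
  have "1 \<le> small_exponent p \<and> small_exponent p < 2 \<and> 1 / small_exponent p = delta p + 1 / 2
      \<and> 0 < delta p \<and> delta p \<le> 1 / 2"
  proof (cases "p < 2")
    case True
    then have "1 / 2 < 1 / p" "1 / p \<le> 1" using assms by (auto simp: field_simps)
    moreover from this have d: "delta p = 1 / p - 1 / 2" by (simp add: delta_def)
    moreover have e: "small_exponent p = p" using True by (simp add: small_exponent_def)
    ultimately show ?thesis using True assms unfolding d e by (intro conjI; linarith)
  next
    case False
    then have "1 / p < 1 / 2" "0 < 1 / p" and "1 / (p / (p - 1)) = 1 - 1 / p"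
      and "1 \<le> p / (p - 1)" "p / (p - 1) < 2"
      using assms by (auto simp: field_simps)
    moreover from this have d: "delta p = 1 / 2 - 1 / p" by (simp add: delta_def)
    moreover have e: "small_exponent p = p / (p - 1)" using False by (simp add: small_exponent_def)
    ultimately show ?thesis unfolding d e by (intro conjI; linarith)
  qed
  then show "1 \<le> small_exponent p" "small_exponent p < 2" "1 / small_exponent p = delta p + 1 / 2"
    "0 < delta p" "delta p \<le> 1 / 2" by auto
qed

lemma kernel_bound_small_exponent:
  assumes "1 \<le> p" "p \<noteq> 2"
    and transpose: "\<And>r. kernel_bound r (\<lambda>y x. \<kappa> x y) B \<longleftrightarrow> kernel_bound r \<kappa> B"
  shows "kernel_bound (small_exponent p) \<kappa> B \<longleftrightarrow> kernel_bound p \<kappa> B"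
proof (cases "p < 2")
  case False
  then have p: "1 < p" "1 < p / (p - 1)" "1 / p + 1 / (p / (p - 1)) = 1" "1 / (p / (p - 1)) + 1 / p = 1"
    using assms by (auto simp: field_simps)
  show ?thesis
    using kernel_bound_dual[OF p(1-3), of \<kappa> B] kernel_bound_dual[OF p(2,1,4), of \<kappa> B] transpose False
    by (auto simp: small_exponent_def)
qed (simp add: small_exponent_def)

text \<open>The transposed convolution is the reflected one, and reflection preserves all norms.\<close>

lemma kernel_bound_transpose_int:
  fixes F :: "int \<Rightarrow> complex"
  shows "kernel_bound r (\<lambda>m n. F (n - m)) B \<longleftrightarrow> kernel_bound r (\<lambda>n m. F (n - m)) B"
  using kernel_bound_reindex[of r "\<lambda>m n. F (n - m)" B uminus uminus]
    kernel_bound_reindex[of r "\<lambda>n m. F (n - m)" B uminus uminus]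
  by (auto simp: algebra_simps)

lemma int_conv_bound_iff:
  assumes "1 \<le> p" "p \<noteq> 2"
  shows "lp_bound p (int_conv F) B \<longleftrightarrow> kernel_bound (small_exponent p) (\<lambda>n m. F (n - m)) B"
proof -
  have "lp_bound p (int_conv F) B \<longleftrightarrow> kernel_bound p (\<lambda>n m. F (n - m)) B"
    using lp_bound_iff_kernel_bound[OF assms(1), of "\<lambda>n m. F (n - m)" B]
    by (simp add: int_conv_def[abs_def])
  then show ?thesis
    using kernel_bound_small_exponent[OF assms kernel_bound_transpose_int] by simp
qed

context htree
begin

lemma radial_profile_eq:
  assumes "radial adj x0 k"
  shows "k x = radial_profile adj x0 k (level x)"
proof -
  obtain K where K: "\<And>x. k x = K (gdist adj x x0)"
    using assms unfolding radial_def by blast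
  have "radial_profile adj x0 k = K"
    unfolding radial_profile_def
  proof (rule the_equality)
    fix K' assume K': "\<forall>x. k x = K' (gdist adj x x0)"
    show "K' = K"
    proof
      fix n
      obtain x where "level x = n" using sphere_at_nonempty[of n] by (auto simp: sphere_at_def)
      then show "K' n = K n" using K' K[of x] by (auto simp: level_def)
    qed
  qed (use K in blast)
  then show ?thesis using K by (simp add: level_def)
qed

lemma tree_conv_bound_iff:
  assumes "1 \<le> p" "p \<noteq> 2"
  shows "lp_bound p (tree_conv adj x0 k) B
    \<longleftrightarrow> kernel_bound (small_exponent p) (\<lambda>x y. radial_profile adj x0 k (gdist adj x y)) B"
proof -
  have "lp_bound p (tree_conv adj x0 k) B \<longleftrightarrow> kernel_bound p (\<lambda>x y. radial_profile adj x0 k (gdist adj x y)) B"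
    using lp_bound_iff_kernel_bound[OF assms(1), of "\<lambda>x y. radial_profile adj x0 k (gdist adj x y)" B]
    by (simp add: tree_conv_def[abs_def])
  then show ?thesis
    using kernel_bound_small_exponent[OF assms, of "\<lambda>x y. radial_profile adj x0 k (gdist adj x y)"]
    by (simp add: gdist_sym)
qed

text \<open>The difference of two solutions is constant along \<open>n + 2 * j\<close> and tends to \<open>0\<close>.\<close>

lemma difference_pair_unique:
  assumes "difference_pair K b" "difference_pair K b'"
  shows "b = b'"
proof
  fix n
  define D where "D n = b n - b' n" for n
  have step: "D (n + 2) = D n" for n
  proof -
    have "b n - b (n + 2) = b' n - b' (n + 2)"
      using assms by (metis difference_pair_def)
    moreover have "D n - D (n + 2) = (b n - b (n + 2)) - (b' n - b' (n + 2))"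
      by (simp add: D_def)
    ultimately have "D n - D (n + 2) = 0" by (simp only: diff_self)
    then show ?thesis by simp
  qed
  have const: "D (n + 2 * j) = D n" for j
  proof (induction j)
    case (Suc j)
    have "n + 2 * Suc j = (n + 2 * j) + 2" by simp
    then show ?case using step[of "n + 2 * j"] Suc.IH by (simp only:)
  qed simp
  have "D \<longlonglongrightarrow> 0 - 0"
    unfolding D_def[abs_def] using assms by (intro tendsto_diff) (simp_all add: difference_pair_def)
  moreover have "filterlim (\<lambda>j. n + 2 * j) at_top sequentially"
    by (rule filterlim_subseq) (auto simp: strict_mono_def)
  ultimately have "(\<lambda>j. D (n + 2 * j)) \<longlonglongrightarrow> 0 - 0"
    by (rule filterlim_compose)
  then have "D n = 0" unfolding const by (simp add: LIMSEQ_const_iff)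
  then show "b n = b' n" by (simp add: D_def)
qed

lemma tree_bound_imp_integer_bound:
  assumes p: "1 \<le> p" "p < 2" "1 / p = t + 1 / 2"
    and \<kappa>: "kernel_bound p (\<lambda>x y. K (gdist adj x y)) B"
  shows "\<exists>b. difference_pair K b \<and> kernel_bound p (\<lambda>n m. boundary_coeff t b (n - m)) B"
proof -
  define a where "a n = of_real (real q powr (real n / 2)) * K n" for n
  define r where "r = real q powr (- (1 / p - 1 / 2))"
  have t: "1 / p - 1 / 2 = t" using p(3) by simp
  have "1 / 2 < 1 / p" using p by (simp add: field_simps)
  then have r: "0 < r" "r < 1" using q2 by (auto simp: r_def intro!: powr_less_one)
  have ar: "norm (a n) \<le> B * r ^ n" for n
    unfolding a_def r_def by (intro half_power_decay radial_kernel_decay[OF p(1) \<kappa>])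
  have "difference_pair K (tail_sum a)"
    using tail_sum_tendsto_0[OF r ar] tail_sum_step[OF r ar] by (simp add: difference_pair_def a_def[abs_def])
  moreover have "kernel_bound p (\<lambda>n m. boundary_coeff t (tail_sum a) (n - m)) B"
    using abel_transform_bound[OF p(1,2) \<kappa>] unfolding t a_def[abs_def] .
  ultimately show ?thesis by blast
qed

lemma integer_bound_imp_tree_bound:
  assumes p: "1 \<le> p" "0 < t" "1 / p = t + 1 / 2" and b: "difference_pair K b"
    and F: "kernel_bound p (\<lambda>n m. boundary_coeff t b (n - m)) B"
  shows "kernel_bound p (\<lambda>x y. K (gdist adj x y)) (bound_constant t * B)"
  by (rule inverse_abel_transform_bound[OF p F]) (use b in \<open>auto simp: difference_pair_def boundary_coeff_def\<close>)

lemma spherical_inversion: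
  assumes "g holomorphic_on strip t" "0 < t"
  shows "of_real (2 * c_G q * real q powr (- real n / 2)) *
        integral {0..tau q} (\<lambda>s. g (of_real s) * inverse (c_fun q (- of_real s)) *
          of_nat q powr (\<i> * of_real s * of_nat n))
    = of_real (real q powr (- real n / 2)) * (tail_coeff g (int n) - tail_coeff g (int (n + 2)))"
proof -
  have "of_real (x * y) * z = of_real y * (of_real x * z)" for x y and z :: complex
    by simp
  then show ?thesis
    using inversion_integral[OF continuous_on_real_axis[OF assms], of n] by (simp only: of_nat_add of_nat_numeral)
qed

lemma half_power_cancel:
  "z = of_real (real q powr (- real n / 2)) * w \<longleftrightarrow> of_real (real q powr (real n / 2)) * z = w" for z w :: complex
  using q2 by (auto simp: powr_minus divide_minus_left)

text \<open>A spherical transform and its boundary value are read off from the same sequence of tail coefficients.\<close>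

lemma spherical_transform_coeffs:
  assumes t: "0 < t" "t \<le> 1 / 2" and k: "radial adj x0 k"
    and g: "is_spherical_transform q adj x0 t k g" and m: "has_boundary_value q t g m"
  shows "difference_pair (radial_profile adj x0 k) (\<lambda>n. tail_coeff g (int n))"
    and "inv_fourier q m = boundary_coeff t (\<lambda>n. tail_coeff g (int n))"
proof -
  have hol: "g holomorphic_on strip t" and weyl: "weyl_invariant_on_strip q t g"
    using g by (simp_all add: is_spherical_transform_def)
  have per: "g (z + of_real (tau q)) = g z" if "z \<in> strip t" for z
    using weyl that unfolding weyl_invariant_on_strip_def by blast
  have "of_real (real q powr (real n / 2)) * radial_profile adj x0 k n
      = tail_coeff g (int n) - tail_coeff g (int (n + 2))" for n
  proof -
    obtain x where x: "level x = n" using sphere_at_nonempty[of n] by (auto simp: sphere_at_def)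
    have "k x = of_real (2 * c_G q * real q powr (- real n / 2)) *
        integral {0..tau q} (\<lambda>s. g (of_real s) * inverse (c_fun q (- of_real s)) *
          of_nat q powr (\<i> * of_real s * of_nat n))"
      using g x unfolding is_spherical_transform_def level_def by blast
    also note spherical_inversion[OF hol t(1), of n]
    finally have "of_real (real q powr (real n / 2)) * k x = tail_coeff g (int n) - tail_coeff g (int (n + 2))"
      by (rule half_power_cancel[THEN iffD1])
    then show ?thesis
      using radial_profile_eq[OF k, of x] x by simp
  qed
  then show "difference_pair (radial_profile adj x0 k) (\<lambda>n. tail_coeff g (int n))"
    using tail_coeff_tendsto_0[OF hol per t] by (simp add: difference_pair_def)
  show "inv_fourier q m = boundary_coeff t (\<lambda>n. tail_coeff g (int n))"
  proof
    fix n
    have "fourier_coeff g n = fourier_coeff g (int (nat \<bar>n\<bar>))"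
      using fourier_coeff_even[OF weyl t(1), of n] by (cases "0 \<le> n") auto
    also have "\<dots> = tail_coeff g (int (nat \<bar>n\<bar>)) - tail_coeff g (int (nat \<bar>n\<bar> + 2)) / of_nat q"
      using fourier_coeff_tail[OF continuous_on_real_axis[OF hol t(1)], of "int (nat \<bar>n\<bar>)"]
      by (simp only: of_nat_add of_nat_numeral)
    finally show "inv_fourier q m n = boundary_coeff t (\<lambda>n. tail_coeff g (int n)) n"
      using inv_fourier_boundary_value[OF hol weyl t(1) m, of n] by (simp add: boundary_coeff_def)
  qed
qed

text \<open>The tail coefficients of the function with coefficients \<open>G\<close> solve the recursion that defines \<open>G\<close> from \<open>b\<close>,
and by \<open>geometric_inversion\<close> it has only one null solution.\<close>

lemma exists_spherical_transform:
  assumes t: "0 < t" "t \<le> 1 / 2" and k: "radial adj x0 k"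
    and b: "difference_pair (radial_profile adj x0 k) b" and B: "\<And>n. norm (boundary_coeff t b n) \<le> B"
  shows "\<exists>g m. is_spherical_transform q adj x0 t k g \<and> has_boundary_value q t g m"
proof -
  define G where "G n = b n - b (n + 2) / of_nat q" for n
  have "norm (G n) \<le> B * real q powr (- (t * real n))" for n
  proof -
    have "boundary_coeff t b (int n) = of_real (real q powr (t * real n)) * G n"
      by (simp add: G_def boundary_coeff_def)
    then have "real q powr (t * real n) * norm (G n) \<le> B"
      using B[of "int n"] by (simp add: norm_mult)
    then show ?thesis
      using q2 by (simp add: powr_minus field_simps)
  qed
  then obtain g m where g: "g holomorphic_on strip t" and weyl: "weyl_invariant_on_strip q t g"
      and m: "has_boundary_value q t g m" and coeff: "\<And>d. fourier_coeff g d = G (nat \<bar>d\<bar>)"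
    using exists_boundary_function[OF t(1), of G B] by blast
  have per: "g (z + of_real (tau q)) = g z" if "z \<in> strip t" for z
    using weyl that unfolding weyl_invariant_on_strip_def by blast
  define c where "c n = tail_coeff g (int n)" for n
  have c0: "c \<longlonglongrightarrow> 0"
    unfolding c_def by (rule tail_coeff_tendsto_0[OF g per t])
  have "c n - c (n + 2) / of_nat q = b n - b (n + 2) / of_nat q" for n
    using fourier_coeff_tail[OF continuous_on_real_axis[OF g t(1)], of "int n"] coeff[of "int n"]
    by (simp add: c_def G_def add.commute)
  then have "c n = b n" for n
    using geometric_inversion[OF c0, of n] geometric_inversion[of b n] b sums_unique2
    by (simp add: difference_pair_def)
  then have cb: "tail_coeff g (int n) = b n" for n by (simp add: c_def)
  have "k x = of_real (2 * c_G q * real q powr (- real (gdist adj x x0) / 2)) *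
        integral {0..tau q} (\<lambda>s. g (of_real s) * inverse (c_fun q (- of_real s)) *
          of_nat q powr (\<i> * of_real s * of_nat (gdist adj x x0)))" for x
  proof -
    have "of_real (real q powr (real (level x) / 2)) * k x = b (level x) - b (level x + 2)"
      using b radial_profile_eq[OF k, of x] unfolding difference_pair_def by simp
    then have "k x = of_real (real q powr (- real (level x) / 2)) * (b (level x) - b (level x + 2))"
      by (rule half_power_cancel[THEN iffD2])
    then show ?thesis
      unfolding spherical_inversion[OF g t(1)] cb level_def .
  qed
  then show ?thesis
    using g weyl m unfolding is_spherical_transform_def by blast
qed

theorem Cv_tree_iff_spherical_transform:
  assumes p: "1 \<le> p" "p \<noteq> 2" and k: "radial adj x0 k"
  shows "k \<in> Cv_tree p adj x0 \<longleftrightarrow>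
    (\<exists>g m. is_spherical_transform q adj x0 (delta p) k g \<and> has_boundary_value q (delta p) g m \<and> m \<in> M_torus p q)"
proof
  note r = small_exponent_props[OF p]
  assume "k \<in> Cv_tree p adj x0"
  then obtain B where "kernel_bound (small_exponent p) (\<lambda>x y. radial_profile adj x0 k (gdist adj x y)) B"
    by (auto simp: Cv_tree_def lp_bounded_def tree_conv_bound_iff[OF p])
  from tree_bound_imp_integer_bound[OF r(1-3) this]
  obtain b where b: "difference_pair (radial_profile adj x0 k) b"
      and F: "kernel_bound (small_exponent p) (\<lambda>n m. boundary_coeff (delta p) b (n - m)) B" by blast
  have "norm (boundary_coeff (delta p) b n) \<le> B" for n
    using kernel_bound_entry[OF r(1) F, of n 0] by simp
  from exists_spherical_transform[OF r(4,5) k b this]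
  obtain g m where gm: "is_spherical_transform q adj x0 (delta p) k g" "has_boundary_value q (delta p) g m" by blast
  have "inv_fourier q m = boundary_coeff (delta p) b"
    using spherical_transform_coeffs[OF r(4,5) k gm] difference_pair_unique[OF b] by metis
  then have "inv_fourier q m \<in> Cv_int p"
    using F by (auto simp: Cv_int_def lp_bounded_def int_conv_bound_iff[OF p])
  then show "\<exists>g m. is_spherical_transform q adj x0 (delta p) k g \<and> has_boundary_value q (delta p) g m \<and> m \<in> M_torus p q"
    using gm by (auto simp: M_torus_def has_boundary_value_def)
next
  note r = small_exponent_props[OF p]
  assume "\<exists>g m. is_spherical_transform q adj x0 (delta p) k g \<and> has_boundary_value q (delta p) g m \<and> m \<in> M_torus p q"
  then obtain g m where gm: "is_spherical_transform q adj x0 (delta p) k g" "has_boundary_value q (delta p) g m"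
      and m: "inv_fourier q m \<in> Cv_int p" by (auto simp: M_torus_def)
  note c = spherical_transform_coeffs[OF r(4,5) k gm]
  from m obtain B where "kernel_bound (small_exponent p) (\<lambda>n m. boundary_coeff (delta p) (\<lambda>n. tail_coeff g (int n)) (n - m)) B"
    by (auto simp: Cv_int_def lp_bounded_def int_conv_bound_iff[OF p] c(2))
  from integer_bound_imp_tree_bound[OF r(1,4,3) c(1) this]
  show "k \<in> Cv_tree p adj x0"
    using k by (auto simp: Cv_tree_def lp_bounded_def tree_conv_bound_iff[OF p])
qed

text \<open>Both sides are infima over the bounds of two operators, and \<open>tree_bound_imp_integer_bound\<close> and
\<open>integer_bound_imp_tree_bound\<close> convert these bounds into each other.\<close>

theorem Cv_tree_norm_equivalence:
  assumes p: "1 \<le> p" "p \<noteq> 2" and k: "k \<in> Cv_tree p adj x0"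
    and gm: "is_spherical_transform q adj x0 (delta p) k g" "has_boundary_value q (delta p) g m"
  shows "M_torus_norm p q m \<le> Cv_tree_norm p adj x0 k"
    and "Cv_tree_norm p adj x0 k \<le> bound_constant (delta p) * M_torus_norm p q m"
proof -
  note r = small_exponent_props[OF p]
  have rad: "radial adj x0 k" and bdd: "lp_bounded p (tree_conv adj x0 k)"
    using k by (simp_all add: Cv_tree_def)
  note c = spherical_transform_coeffs[OF r(4,5) rad gm]
  have down: "lp_bound p (int_conv (inv_fourier q m)) B" if "lp_bound p (tree_conv adj x0 k) B" for B
  proof -
    from that have "kernel_bound (small_exponent p) (\<lambda>x y. radial_profile adj x0 k (gdist adj x y)) B"
      by (simp add: tree_conv_bound_iff[OF p])
    from tree_bound_imp_integer_bound[OF r(1-3) this] show ?thesis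
      unfolding int_conv_bound_iff[OF p] c(2) using difference_pair_unique[OF c(1)] by metis
  qed
  have up: "lp_bound p (tree_conv adj x0 k) (bound_constant (delta p) * B)"
    if "lp_bound p (int_conv (inv_fourier q m)) B" for B
    using integer_bound_imp_tree_bound[OF r(1,4,3) c(1)] that
    unfolding int_conv_bound_iff[OF p] tree_conv_bound_iff[OF p] c(2) by blast
  show "M_torus_norm p q m \<le> Cv_tree_norm p adj x0 k"
    using lp_opnorm_le_scaled[OF bdd, of 1 "int_conv (inv_fourier q m)"] down
    by (simp add: M_torus_norm_def Cv_int_norm_def Cv_tree_norm_def)
  have "lp_bounded p (int_conv (inv_fourier q m))"
    using bdd down unfolding lp_bounded_def by blast
  from lp_opnorm_le_scaled[OF this bound_constant_pos[OF r(4)] up]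
  show "Cv_tree_norm p adj x0 k \<le> bound_constant (delta p) * M_torus_norm p q m"
    by (simp add: M_torus_norm_def Cv_int_norm_def Cv_tree_norm_def)
qed

end

theorem theorem4p3:
  fixes p :: real and q :: nat
  assumes "1 \<le> p" and "p \<noteq> 2" and "2 \<le> q"
  shows
    "(\<forall>(adj :: 'v \<Rightarrow> 'v \<Rightarrow> bool) x0 k.
        homogeneous_tree q adj \<longrightarrow> radial adj x0 k \<longrightarrow>
        (k \<in> Cv_tree p adj x0 \<longleftrightarrow>
         (\<exists>g m. is_spherical_transform q adj x0 (delta p) k g \<and>
                has_boundary_value q (delta p) g m \<and> m \<in> M_torus p q)))
     \<and>
     (\<exists>c>0. \<exists>C>0. \<forall>(adj :: 'v \<Rightarrow> 'v \<Rightarrow> bool) x0 k g m.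
        homogeneous_tree q adj \<longrightarrow> k \<in> Cv_tree p adj x0 \<longrightarrow>
        is_spherical_transform q adj x0 (delta p) k g \<longrightarrow>
        has_boundary_value q (delta p) g m \<longrightarrow>
        c * M_torus_norm p q m \<le> Cv_tree_norm p adj x0 k \<and>
        Cv_tree_norm p adj x0 k \<le> C * M_torus_norm p q m)"
proof -
  interpret tree_degree q by unfold_locales (rule assms(3))
  note t = small_exponent_props(4)[OF assms(1,2)]
  have htree: "htree q adj" if "homogeneous_tree q adj" for adj :: "'v \<Rightarrow> 'v \<Rightarrow> bool"
    by unfold_locales (rule that)
  show ?thesis
  proof (intro conjI)
    show "\<forall>(adj :: 'v \<Rightarrow> 'v \<Rightarrow> bool) x0 k. homogeneous_tree q adj \<longrightarrow> radial adj x0 k \<longrightarrow>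
        (k \<in> Cv_tree p adj x0 \<longleftrightarrow> (\<exists>g m. is_spherical_transform q adj x0 (delta p) k g \<and>
           has_boundary_value q (delta p) g m \<and> m \<in> M_torus p q))"
      using htree.Cv_tree_iff_spherical_transform[OF htree assms(1,2)] by blast
    show "\<exists>c>0. \<exists>C>0. \<forall>(adj :: 'v \<Rightarrow> 'v \<Rightarrow> bool) x0 k g m. homogeneous_tree q adj \<longrightarrow>
        k \<in> Cv_tree p adj x0 \<longrightarrow> is_spherical_transform q adj x0 (delta p) k g \<longrightarrow>
        has_boundary_value q (delta p) g m \<longrightarrow>
        c * M_torus_norm p q m \<le> Cv_tree_norm p adj x0 k \<and> Cv_tree_norm p adj x0 k \<le> C * M_torus_norm p q m"
    proof (rule exI[of _ 1], intro conjI, simp, rule exI[of _ "bound_constant (delta p)"],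
        intro conjI bound_constant_pos[OF t] allI impI)
      fix adj :: "'v \<Rightarrow> 'v \<Rightarrow> bool" and x0 k g m
      assume "homogeneous_tree q adj" and a: "k \<in> Cv_tree p adj x0"
        "is_spherical_transform q adj x0 (delta p) k g" "has_boundary_value q (delta p) g m"
      then interpret htree q adj x0 by (intro htree)
      show "1 * M_torus_norm p q m \<le> Cv_tree_norm p adj x0 k"
        "Cv_tree_norm p adj x0 k \<le> bound_constant (delta p) * M_torus_norm p q m"
        using Cv_tree_norm_equivalence[OF assms(1,2) a] by simp_all
    qed
  qed
qed

end
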